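(* Let $F$ be an infinite field and $n\ge 1$. (i) The assignment $\{a_1,\dots,a_n\}\mapsto [a_1,\dots,a_n]$ gives a (well-defined) homomorphism $\nu_n:K_n^M(F)\to H_n(\mathrm{GL}_n(F),\mathbb{Z})$. (ii) Let $s_n:H_n(\mathrm{GL}_n(F),\mathbb{Z})\to K_n^M(F)$ be the map defined by Suslin. Then $s_n\circ\nu_n$ coincides with multiplication by $(-1)^{n-1}(n-1)!$.
   Context: The Milnor $K$-group $K_n^M(F)$ is the degree $n$ part of $T(F^* )/\langle a\otimes(1-a): a\in F^*\setminus\{1\}\rangle$, where $T(F^* )$ is the tensor algebra of the abelian group $F^*$; the class of $a_1\otimes\cdots\otimes a_n$ is $\{a_1,\dots,a_n\}$. For pairwise commuting elements $g_1,\dots,g_n$ of a group $G$, $\mathbf{c}(g_1,\dots,g_n)=\sum_{\sigma\in\Sigma_n}\mathrm{sign}(\sigma)[g_{\sigma(1)}|\cdots|g_{\sigma(n)}]\in H_n(G,\mathbb{Z})$ (bar resolution, $\Sigma_n$ the symmetric group). For $a_1,\dots,a_n\in F^*$ put $A_{1,n}=\mathrm{diag}(a_1,I_{n-1})$ and, for $2\le i\le n$, $A_{i,n}=\mathrm{diag}(a_i,\dots,a_i,a_i^{-(i-1)},I_{n-i})\in\mathrm{GL}_n(F)$ with $i-1$ entries equal to $a_i$. Define $[a_1,\dots,a_n]:=\mathbf{c}(A_{1,n},\dots,A_{n,n})\in H_n(\mathrm{GL}_n(F),\mathbb{Z})$. Suslin's map $s_n$ is the surjection $H_n(\mathrm{GL}_n(F),\mathbb{Z})\to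 K_n^M(F)$ with kernel the image of $H_n(\mathrm{GL}_{n-1}(F),\mathbb{Z})$ that sends $\mathbf{c}(\mathrm{diag}(a_1,I_{n-1}),\mathrm{diag}(1,a_2,I_{n-2}),\dots,\mathrm{diag}(I_{n-1},a_n))$ to $\{a_1,\dots,a_n\}$. *)

theory Defs
  imports
    "HOL-Algebra.Algebra"
    "HOL-Combinatorics.Permutations"
    "Jordan_Normal_Form.Matrix"
begin

definition tuples :: "'a set \<Rightarrow> nat \<Rightarrow> 'a list set" where
  "tuples S n = {xs. length xs = n \<and> set xs \<subseteq> S}"


section \<open>Milnor K-theory\<close>

text \<open>The free associative unital ring on a set \<open>S\<close>: its additive group is free on the words in
  \<open>S\<close>, and words are multiplied by concatenation.\<close>

definition free_ring_mult :: "('a list \<Rightarrow>\<^sub>0 int) \<Rightarrow> ('a list \<Rightarrow>\<^sub>0 int) \<Rightarrow> ('a list \<Rightarrow>\<^sub>0 int)" where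
  "free_ring_mult p q = frag_extend (\<lambda>u. frag_extend (\<lambda>v. frag_of (u @ v)) q) p"

definition free_ring :: "'a set \<Rightarrow> ('a list \<Rightarrow>\<^sub>0 int) ring" where
  "free_ring S = \<lparr>carrier = carrier (free_Abelian_group (lists S)),
     monoid.mult = free_ring_mult, one = frag_of [], ring.zero = 0, ring.add = (+)\<rparr>"

text \<open>The tensor algebra over the integers of an abelian group \<open>A\<close> (written multiplicatively) is the
  free ring on the carrier of \<open>A\<close> modulo the relations making \<open>A \<rightarrow> T(A)\<close> additive. Multiplying the
  relators by words on both sides gives multilinearity in every slot, so the degree \<open>n\<close> part is
  the \<open>n\<close>-fold tensor power of \<open>A\<close>.\<close>

definition tensor_ideal :: "('a, 'm) monoid_scheme \<Rightarrow> ('a list \<Rightarrow>\<^sub>0 int) set" where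
  "tensor_ideal A = genideal (free_ring (carrier A))
     {frag_of [x \<otimes>\<^bsub>A\<^esub> y] - frag_of [x] - frag_of [y] | x y. x \<in> carrier A \<and> y \<in> carrier A}"

definition tensor_algebra :: "('a, 'm) monoid_scheme \<Rightarrow> ('a list \<Rightarrow>\<^sub>0 int) set ring" where
  "tensor_algebra A = free_ring (carrier A) Quot tensor_ideal A"

definition tensor_class ::
    "('a, 'm) monoid_scheme \<Rightarrow> ('a list \<Rightarrow>\<^sub>0 int) \<Rightarrow> ('a list \<Rightarrow>\<^sub>0 int) set" where
  "tensor_class A p = tensor_ideal A +>\<^bsub>free_ring (carrier A)\<^esub> p"

definition pure_tensor :: "('a, 'm) monoid_scheme \<Rightarrow> 'a list \<Rightarrow> ('a list \<Rightarrow>\<^sub>0 int) set" where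
  "pure_tensor A xs = tensor_class A (frag_of xs)"

definition tensor_power :: "('a, 'm) monoid_scheme \<Rightarrow> nat \<Rightarrow> ('a list \<Rightarrow>\<^sub>0 int) set set" where
  "tensor_power A n = tensor_class A ` carrier (free_Abelian_group (tuples (carrier A) n))"

definition mult_group :: "'a::field itself \<Rightarrow> 'a monoid" where
  "mult_group F = \<lparr>carrier = UNIV - {0}, monoid.mult = (*), one = 1\<rparr>"

definition steinberg_ideal :: "'a::field itself \<Rightarrow> ('a list \<Rightarrow>\<^sub>0 int) set set" where
  "steinberg_ideal F = genideal (tensor_algebra (mult_group F))
     {pure_tensor (mult_group F) [a, 1 - a] | a. a \<in> carrier (mult_group F) - {1}}"

definition milnor_ring :: "'a::field itself \<Rightarrow> ('a list \<Rightarrow>\<^sub>0 int) set set ring" where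
  "milnor_ring F = tensor_algebra (mult_group F) Quot steinberg_ideal F"

definition milnor_class ::
    "'a::field itself \<Rightarrow> ('a list \<Rightarrow>\<^sub>0 int) set \<Rightarrow> ('a list \<Rightarrow>\<^sub>0 int) set set" where
  "milnor_class F t = steinberg_ideal F +>\<^bsub>tensor_algebra (mult_group F)\<^esub> t"

definition milnor_K :: "'a::field itself \<Rightarrow> nat \<Rightarrow> ('a list \<Rightarrow>\<^sub>0 int) set set monoid" where
  "milnor_K F n = (add_monoid (milnor_ring F))
     \<lparr>carrier := milnor_class F ` tensor_power (mult_group F) n\<rparr>"

definition milnor_symbol :: "'a::field list \<Rightarrow> ('a list \<Rightarrow>\<^sub>0 int) set set" where
  "milnor_symbol as = milnor_class TYPE('a) (pure_tensor (mult_group TYPE('a)) as)"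


section \<open>Integral group homology via the bar resolution\<close>

text \<open>We use the unnormalized bar resolution. After taking coinvariants, the chains of degree \<open>n\<close> are
  free abelian on the symbols \<open>[g\<^sub>1|\<dots>|g\<^sub>n]\<close>, represented by lists of length \<open>n\<close>.\<close>

definition bar_chains :: "('g, 'm) monoid_scheme \<Rightarrow> nat \<Rightarrow> ('g list \<Rightarrow>\<^sub>0 int) monoid" where
  "bar_chains G n = free_Abelian_group (tuples (carrier G) n)"

definition bar_face :: "('g, 'm) monoid_scheme \<Rightarrow> nat \<Rightarrow> 'g list \<Rightarrow> 'g list" where
  "bar_face G i gs =
     (if i = 0 then tl gs
      else if i = length gs then butlast gs
      else take (i - 1) gs @ [gs ! (i - 1) \<otimes>\<^bsub>G\<^esub> gs ! i] @ drop (i + 1) gs)"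

definition bar_boundary ::
    "('g, 'm) monoid_scheme \<Rightarrow> ('g list \<Rightarrow>\<^sub>0 int) \<Rightarrow> ('g list \<Rightarrow>\<^sub>0 int)" where
  "bar_boundary G = frag_extend (\<lambda>gs. if gs = [] then 0
     else (\<Sum>i\<le>length gs. frag_cmul ((-1) ^ i) (frag_of (bar_face G i gs))))"

definition bar_cycles :: "('g, 'm) monoid_scheme \<Rightarrow> nat \<Rightarrow> ('g list \<Rightarrow>\<^sub>0 int) monoid" where
  "bar_cycles G n = (bar_chains G n)
     \<lparr>carrier := {c \<in> carrier (bar_chains G n). bar_boundary G c = 0}\<rparr>"

definition bar_boundaries :: "('g, 'm) monoid_scheme \<Rightarrow> nat \<Rightarrow> ('g list \<Rightarrow>\<^sub>0 int) set" where
  "bar_boundaries G n = bar_boundary G ` carrier (bar_chains G (Suc n))"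

definition group_homology ::
    "('g, 'm) monoid_scheme \<Rightarrow> nat \<Rightarrow> ('g list \<Rightarrow>\<^sub>0 int) set monoid" where
  "group_homology G n = bar_cycles G n Mod bar_boundaries G n"

definition homology_class ::
    "('g, 'm) monoid_scheme \<Rightarrow> nat \<Rightarrow> ('g list \<Rightarrow>\<^sub>0 int) \<Rightarrow> ('g list \<Rightarrow>\<^sub>0 int) set" where
  "homology_class G n c = bar_boundaries G n #>\<^bsub>bar_cycles G n\<^esub> c"

text \<open>For a homology class \<open>\<xi>\<close>, which is a coset of cycles, the classes of the images of its
  representatives all agree, so that the image below is a singleton.\<close>

definition homology_map ::
    "('h, 'm) monoid_scheme \<Rightarrow> nat \<Rightarrow> ('g \<Rightarrow> 'h) \<Rightarrow> ('g list \<Rightarrow>\<^sub>0 int) set \<Rightarrow> ('h list \<Rightarrow>\<^sub>0 int) set"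
  where
  "homology_map H n f \<xi> =
     the_elem ((\<lambda>c. homology_class H n (frag_extend (\<lambda>gs. frag_of (map f gs)) c)) ` \<xi>)"

text \<open>The class \<open>\<^bold>c(g\<^sub>1,\<dots>,g\<^sub>n)\<close>; the chain is a cycle when the \<open>g\<^sub>i\<close> commute pairwise.\<close>

definition comm_class :: "('g, 'm) monoid_scheme \<Rightarrow> 'g list \<Rightarrow> ('g list \<Rightarrow>\<^sub>0 int) set" where
  "comm_class G gs = homology_class G (length gs)
     (\<Sum>\<sigma> | \<sigma> permutes {..<length gs}. frag_cmul (sign \<sigma>) (frag_of (permute_list \<sigma> gs)))"


section \<open>General linear groups\<close>

definition GL :: "'a::field itself \<Rightarrow> nat \<Rightarrow> 'a mat monoid" where
  "GL F n = units_of (ring_mat F n ())"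

definition GL_stabilize :: "nat \<Rightarrow> 'a::field mat \<Rightarrow> 'a mat" where
  "GL_stabilize m A = four_block_mat A (0\<^sub>m m 1) (0\<^sub>m 1 m) (1\<^sub>m 1)"

text \<open>Indices are zero-based: \<open>A_mat as k\<close> is the matrix \<open>A\<^bsub>k+1,n\<^esub>\<close> of the parameter
  \<open>a\<^bsub>k+1\<^esub> = as ! k\<close>, with \<open>n = length as\<close>. The case \<open>k = 0\<close> is exceptional.\<close>

definition A_mat :: "'a::field list \<Rightarrow> nat \<Rightarrow> 'a mat" where
  "A_mat as k = mat_diag (length as) (\<lambda>j.
     if k = 0 then (if j = 0 then as ! 0 else 1)
     else if j < k then as ! k
     else if j = k then as ! k powi (- int k)
     else 1)"

definition GL_symbol :: "'a::field list \<Rightarrow> ('a mat list \<Rightarrow>\<^sub>0 int) set" where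
  "GL_symbol as = comm_class (GL TYPE('a) (length as)) (map (A_mat as) [0..<length as])"

definition D_mat :: "'a::field list \<Rightarrow> nat \<Rightarrow> 'a mat" where
  "D_mat as k = mat_diag (length as) (\<lambda>j. if j = k then as ! k else 1)"

text \<open>Suslin's map, for \<open>n \<ge> 1\<close>. The conditions determine \<open>s\<close> on its domain: by the first two, \<open>s\<close>
  induces an isomorphism from the cokernel of stabilization onto \<open>K\<^sub>n\<close>, and the third
  prescribes that isomorphism's inverse on the symbols, which generate \<open>K\<^sub>n\<close>.\<close>

definition suslin_map ::
    "'a::field itself \<Rightarrow> nat \<Rightarrow> (('a mat list \<Rightarrow>\<^sub>0 int) set \<Rightarrow> ('a list \<Rightarrow>\<^sub>0 int) set set) \<Rightarrow> bool" where
  "suslin_map F n s \<longleftrightarrow>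
     s \<in> epi (group_homology (GL F n) n) (milnor_K F n) \<and>
     kernel (group_homology (GL F n) n) (milnor_K F n) s =
       homology_map (GL F n) n (GL_stabilize (n - 1)) ` carrier (group_homology (GL F (n - 1)) n) \<and>
     (\<forall>as \<in> tuples (carrier (mult_group F)) n.
        s (comm_class (GL F n) (map (D_mat as) [0..<n])) = milnor_symbol as)"

end

theory Submission
  imports
    Defs
    "Jordan_Normal_Form.Determinant"
    "HOL-Library.Function_Algebras"
begin

text \<open>A class \<open>\<^bold>c(g\<^sub>1,\<dots>,g\<^sub>n)\<close> is the iterated shuffle product of the cycles \<open>[g\<^sub>i]\<close>. Hence it is
  alternating, multilinear and invariant under conjugation, and multiplying by \<open>[g]\<close> is a chain
  map up to sign on the chains of any subset centralized by \<open>g\<close>.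

  Writing \<open>A\<^bsub>i,n\<^esub>\<close> additively through the coordinate cocharacters of the diagonal torus, these
  properties together with invariance under the Weyl group show that \<open>[a\<^sub>1,\<dots>,a\<^sub>n]\<close> changes sign
  when two neighbouring entries are exchanged. The Steinberg relation therefore only has to be
  checked in the first two slots, where it reduces to \<open>\<^bold>c(diag(a,1), diag(b,1/b)) = 0\<close> in
  \<open>H\<^sub>2(GL\<^sub>2)\<close> for \<open>a + b = 1\<close>. This says that lifts of the two matrices to the universal central
  extension commute, which is Steinberg's classical computation with unipotent elements. That the
  unipotents lift homomorphically amounts to the vanishing of an additive function \<open>f\<close> on the
  infinite field with \<open>f(1/t) = -f(t)\<close>, a consequence of Hua's identity.

  For the composition with Suslin's map, replace the \<open>A\<^bsub>i,n\<^esub>\<close> one at a time, starting from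
  \<open>i = n\<close>, by \<open>diag(1,\<dots>,a\<^sub>i,\<dots>,1)\<close>: modulo classes coming from \<open>GL\<^bsub>n-1\<^esub>\<close>, the \<open>i\<close>-th replacement
  contributes the factor \<open>-(i-1)\<close>.\<close>

section \<open>Chain operations on bar words\<close>

text \<open>Multiplication by \<open>[g]\<close> preserves boundaries only when \<open>g\<close>
  commutes with every entry of the bounding chain. Vanishing of a class in the homology of the whole
  group therefore does not survive further multiplication. This is why
  \<open>boundaries G S n\<close> remembers a set \<open>S\<close> of admissible entries, and why
  the Steinberg relation is proved in \<open>gl2\<close> first and then embedded: its bounding chain
  stays inside the block that the remaining diagonal factors centralize.

  The function \<open>f\<close> on the field is f(t) = c(x(t), x(1)) with x(t) upper unipotent. It
  is additive, and conjugation by diag(t,1) gives c(x(1/t), x(1)) = c(x(1), x(t)) = -c(x(t), x(1)).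
  That it vanishes is what makes lifts of unipotents commute, and this is where infinitely many
  scalars are used.

  The Milnor ring is built by two successive quotients of a free ring and not degree by degree. The
  map on symbols is therefore set up on words of every length, with value zero off degree
  \<open>n\<close>, and the relations are tested inside arbitrary contexts \<open>u\<close>,
  \<open>v\<close>.

  Equality of classes is expressed throughout as membership of a difference of chains in an additive
  subgroup.\<close>

definition cons_chain :: "'g \<Rightarrow> ('g list \<Rightarrow>\<^sub>0 int) \<Rightarrow> ('g list \<Rightarrow>\<^sub>0 int)" where
  "cons_chain a = frag_extend (\<lambda>w. frag_of (a # w))"

definition map_chain :: "('g \<Rightarrow> 'h) \<Rightarrow> ('g list \<Rightarrow>\<^sub>0 int) \<Rightarrow> ('h list \<Rightarrow>\<^sub>0 int)" where
  "map_chain f = frag_extend (\<lambda>w. frag_of (map f w))"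

text \<open>This collects the faces of \<open>a # w\<close> other than the one deleting
  \<open>a\<close>, with signs reversed, so that the boundary of \<open>a # w\<close> is
  \<open>w\<close> minus this chain. The recursive form replaces indexed faces and makes induction
  on words possible.\<close>

fun tail_word :: "('g, 'm) monoid_scheme \<Rightarrow> 'g \<Rightarrow> 'g list \<Rightarrow> ('g list \<Rightarrow>\<^sub>0 int)" where
  "tail_word G a [] = frag_of []"
| "tail_word G a (b # w) = frag_of ((a \<otimes>\<^bsub>G\<^esub> b) # w) - cons_chain a (tail_word G b w)"

definition tail_boundary ::
    "('g, 'm) monoid_scheme \<Rightarrow> 'g \<Rightarrow> ('g list \<Rightarrow>\<^sub>0 int) \<Rightarrow> ('g list \<Rightarrow>\<^sub>0 int)" where
  "tail_boundary G a = frag_extend (tail_word G a)"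

text \<open>The prism operator: the alternating sum of the words obtained by inserting
  \<open>g\<close> at each position, with \<psi> applied to the entries before it and \<phi> to
  those after it.\<close>

fun htpy_word :: "'h \<Rightarrow> ('g \<Rightarrow> 'h) \<Rightarrow> ('g \<Rightarrow> 'h) \<Rightarrow> 'g list \<Rightarrow> ('h list \<Rightarrow>\<^sub>0 int)" where
  "htpy_word g \<psi> \<phi> [] = frag_of [g]"
| "htpy_word g \<psi> \<phi> (a # w) =
     frag_of (g # map \<phi> (a # w)) - cons_chain (\<psi> a) (htpy_word g \<psi> \<phi> w)"

definition htpy :: "'h \<Rightarrow> ('g \<Rightarrow> 'h) \<Rightarrow> ('g \<Rightarrow> 'h) \<Rightarrow> ('g list \<Rightarrow>\<^sub>0 int) \<Rightarrow> ('h list \<Rightarrow>\<^sub>0 int)" where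
  "htpy g \<psi> \<phi> = frag_extend (htpy_word g \<psi> \<phi>)"

abbreviation shuffle :: "'g \<Rightarrow> ('g list \<Rightarrow>\<^sub>0 int) \<Rightarrow> ('g list \<Rightarrow>\<^sub>0 int)" where
  "shuffle g \<equiv> htpy g (\<lambda>a. a) (\<lambda>a. a)"

text \<open>The shuffle product with the 2-chain \<open>[g|h]\<close>: both letters are inserted
  with \<open>g\<close> left of \<open>h\<close>, and the sign is the parity of the total number of
  letters they move past.\<close>

fun shuffle2_word :: "'g \<Rightarrow> 'g \<Rightarrow> 'g list \<Rightarrow> ('g list \<Rightarrow>\<^sub>0 int)" where
  "shuffle2_word g h [] = frag_of [g, h]"
| "shuffle2_word g h (a # w) =
     cons_chain g (shuffle h (frag_of (a # w))) + cons_chain a (shuffle2_word g h w)"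

definition shuffle2 :: "'g \<Rightarrow> 'g \<Rightarrow> ('g list \<Rightarrow>\<^sub>0 int) \<Rightarrow> ('g list \<Rightarrow>\<^sub>0 int)" where
  "shuffle2 g h = frag_extend (shuffle2_word g h)"

lemma chain_ops_of [simp]:
  "cons_chain a (frag_of w) = frag_of (a # w)"
  "map_chain f (frag_of w) = frag_of (map f w)"
  "tail_boundary G a (frag_of w) = tail_word G a w"
  "htpy k \<psi> \<phi> (frag_of w) = htpy_word k \<psi> \<phi> w"
  "shuffle2 g h (frag_of w) = shuffle2_word g h w"
  by (simp_all add: cons_chain_def map_chain_def tail_boundary_def htpy_def shuffle2_def)

lemma chain_ops_0 [simp]:
  "cons_chain a 0 = 0" "map_chain f 0 = 0" "tail_boundary G a 0 = 0" "htpy k \<psi> \<phi> 0 = 0"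
  "shuffle2 g h 0 = 0" "bar_boundary G 0 = 0"
  by (simp_all add: cons_chain_def map_chain_def tail_boundary_def htpy_def shuffle2_def bar_boundary_def)

lemma chain_ops_diff:
  "cons_chain a (x - y) = cons_chain a x - cons_chain a y"
  "map_chain f (x - y) = map_chain f x - map_chain f y"
  "tail_boundary G a (x - y) = tail_boundary G a x - tail_boundary G a y"
  "htpy k \<psi> \<phi> (x - y) = htpy k \<psi> \<phi> x - htpy k \<psi> \<phi> y"
  "shuffle2 g h (x - y) = shuffle2 g h x - shuffle2 g h y"
  "bar_boundary G (x - y) = bar_boundary G x - bar_boundary G y"
  by (simp_all add: cons_chain_def map_chain_def tail_boundary_def htpy_def shuffle2_def
      bar_boundary_def frag_extend_diff)

lemma chain_ops_add:
  "cons_chain a (x + y) = cons_chain a x + cons_chain a y"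
  "map_chain f (x + y) = map_chain f x + map_chain f y"
  "tail_boundary G a (x + y) = tail_boundary G a x + tail_boundary G a y"
  "htpy k \<psi> \<phi> (x + y) = htpy k \<psi> \<phi> x + htpy k \<psi> \<phi> y"
  "shuffle2 g h (x + y) = shuffle2 g h x + shuffle2 g h y"
  "bar_boundary G (x + y) = bar_boundary G x + bar_boundary G y"
  by (simp_all add: cons_chain_def map_chain_def tail_boundary_def htpy_def shuffle2_def
      bar_boundary_def frag_extend_add)

lemma chain_ops_minus:
  "cons_chain a (- x) = - cons_chain a x"
  "map_chain f (- x) = - map_chain f x"
  "tail_boundary G a (- x) = - tail_boundary G a x"
  "htpy k \<psi> \<phi> (- x) = - htpy k \<psi> \<phi> x"
  "shuffle2 g h (- x) = - shuffle2 g h x"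
  "bar_boundary G (- x) = - bar_boundary G x"
  by (simp_all add: cons_chain_def map_chain_def tail_boundary_def htpy_def shuffle2_def
      bar_boundary_def frag_extend_minus)

lemmas chain_ops_linear = chain_ops_diff chain_ops_add chain_ops_minus

lemma chain_ops_cmul_sum:
  "cons_chain a (frag_cmul k x) = frag_cmul k (cons_chain a x)"
  "cons_chain a (sum F I) = (\<Sum>i\<in>I. cons_chain a (F i))"
  "htpy g \<psi> \<phi> (frag_cmul k x) = frag_cmul k (htpy g \<psi> \<phi> x)"
  "htpy g \<psi> \<phi> (sum F I) = (\<Sum>i\<in>I. htpy g \<psi> \<phi> (F i))"
  by (simp_all add: cons_chain_def htpy_def frag_extend_cmul)
     (induction I rule: infinite_finite_induct; simp add: frag_extend_add)+

lemma chain_induct [case_names zero word diff]: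
  assumes "P 0" "\<And>w. P (frag_of w)" "\<And>x y. \<lbrakk>P x; P y\<rbrakk> \<Longrightarrow> P (x - y)"
  shows "P (c :: 'a \<Rightarrow>\<^sub>0 int)"
  by (rule frag_induction[of c UNIV]) (use assms in auto)

lemma tail_boundary_cons:
  "tail_boundary G a (cons_chain b c) = cons_chain (a \<otimes>\<^bsub>G\<^esub> b) c - cons_chain a (tail_boundary G b c)"
  by (induction c rule: chain_induct) (simp_all add: chain_ops_linear)

lemma htpy_cons:
  "htpy g \<psi> \<phi> (cons_chain a c) =
     cons_chain g (cons_chain (\<phi> a) (map_chain \<phi> c)) - cons_chain (\<psi> a) (htpy g \<psi> \<phi> c)"
  by (induction c rule: chain_induct) (simp_all add: chain_ops_linear)

lemma map_chain_cons: "map_chain f (cons_chain a c) = cons_chain (f a) (map_chain f c)"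
  by (induction c rule: chain_induct) (simp_all add: chain_ops_linear)

lemma map_chain_id [simp]: "map_chain (\<lambda>a. a) c = c"
  by (induction c rule: chain_induct) (simp_all add: chain_ops_linear)

lemma shuffle2_cons:
  "shuffle2 g h (cons_chain a c) =
     cons_chain g (shuffle h (cons_chain a c)) + cons_chain a (shuffle2 g h c)"
  by (induction c rule: chain_induct) (simp_all add: chain_ops_linear)

lemma tail_word_eq_sum:
  "tail_word G a w = (\<Sum>i\<le>length w. frag_cmul ((-1) ^ i) (frag_of (bar_face G (Suc i) (a # w))))"
proof (induction w arbitrary: a)
  case Nil
  then show ?case by (simp add: bar_face_def)
next
  case (Cons b w)
  have face: "bar_face G (Suc (Suc i)) (a # b # w) = a # bar_face G (Suc i) (b # w)" for i
    by (simp add: bar_face_def)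
  have "(\<Sum>i\<le>length (b # w). frag_cmul ((-1) ^ i) (frag_of (bar_face G (Suc i) (a # b # w)))) =
      frag_of ((a \<otimes>\<^bsub>G\<^esub> b) # w) + (\<Sum>i\<le>length w. frag_cmul ((-1) ^ Suc i) (frag_of (a # bar_face G (Suc i) (b # w))))"
    unfolding list.size add_Suc_right add_0_right sum.atMost_Suc_shift face
    by (simp add: bar_face_def)
  also have "\<dots> = frag_of ((a \<otimes>\<^bsub>G\<^esub> b) # w) - cons_chain a (tail_word G b w)"
    by (simp add: Cons.IH chain_ops_cmul_sum sum_negf[symmetric])
  finally show ?case by simp
qed

lemma bar_boundary_Nil [simp]: "bar_boundary G (frag_of []) = 0"
  by (simp add: bar_boundary_def)

lemma bar_boundary_Cons [simp]: "bar_boundary G (frag_of (a # w)) = frag_of w - tail_word G a w"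
proof -
  have "bar_boundary G (frag_of (a # w)) = (\<Sum>i\<le>Suc (length w). frag_cmul ((-1) ^ i) (frag_of (bar_face G i (a # w))))"
    by (simp add: bar_boundary_def)
  also have "\<dots> = frag_of w - tail_word G a w"
  proof -
    have "frag_cmul ((-1) ^ Suc i) x = - frag_cmul ((-1) ^ i) x" for i and x :: "'a list \<Rightarrow>\<^sub>0 int"
      by simp
    then show ?thesis
      unfolding sum.atMost_Suc_shift tail_word_eq_sum
      by (simp add: sum_negf bar_face_def del: power_Suc minus_frag_cmul)
  qed
  finally show ?thesis .
qed

lemma bar_boundary_cons: "bar_boundary G (cons_chain a c) = c - tail_boundary G a c"
  by (induction c rule: chain_induct) (simp_all add: chain_ops_linear)

lemma map_chain_tail:
  assumes "\<And>a b. a \<in> S \<Longrightarrow> b \<in> S \<Longrightarrow> \<phi> (a \<otimes>\<^bsub>G\<^esub> b) = \<phi> a \<otimes>\<^bsub>H\<^esub> \<phi> b" "a \<in> S" "w \<in> lists S"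
  shows "map_chain \<phi> (tail_word G a w) = tail_word H (\<phi> a) (map \<phi> w)"
  using assms(2,3)
  by (induction w arbitrary: a) (simp_all add: chain_ops_linear map_chain_cons assms(1))

text \<open>A face multiplies at most one pair of neighbouring entries, so only products of two
  elements of \<open>S\<close> ever have to be respected.\<close>

lemma map_chain_boundary:
  assumes hom: "\<And>a b. a \<in> S \<Longrightarrow> b \<in> S \<Longrightarrow> \<phi> (a \<otimes>\<^bsub>G\<^esub> b) = \<phi> a \<otimes>\<^bsub>H\<^esub> \<phi> b"
    and c: "Poly_Mapping.keys c \<subseteq> lists S"
  shows "bar_boundary H (map_chain \<phi> c) = map_chain \<phi> (bar_boundary G c)"
  using c
proof (induction c rule: frag_induction)
  case (one w)
  then show ?case
    by (cases w) (simp_all add: chain_ops_linear map_chain_tail[of S \<phi> G H] hom)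
qed (simp_all add: chain_ops_linear)

text \<open>The inductive core of the homotopy formula. Merging \<open>g\<close> with its left
  neighbour and merging it with its right neighbour occur in adjacent summands with opposite signs,
  and \<open>conj\<close> makes them cancel. The term with \<open>\<psi> a\<close> times
  \<open>g\<close> is left over because its partner appears one recursion level further out.\<close>

lemma tail_htpy:
  assumes hom: "\<And>a b. a \<in> S \<Longrightarrow> b \<in> S \<Longrightarrow> \<phi> (a \<otimes>\<^bsub>G\<^esub> b) = \<phi> a \<otimes>\<^bsub>H\<^esub> \<phi> b"
    and hom': "\<And>a b. a \<in> S \<Longrightarrow> b \<in> S \<Longrightarrow> \<psi> (a \<otimes>\<^bsub>G\<^esub> b) = \<psi> a \<otimes>\<^bsub>H\<^esub> \<psi> b"
    and conj: "\<And>a. a \<in> S \<Longrightarrow> g \<otimes>\<^bsub>H\<^esub> \<phi> a = \<psi> a \<otimes>\<^bsub>H\<^esub> g"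
    and "a \<in> S" "w \<in> lists S"
  shows "tail_boundary H (\<psi> a) (htpy_word g \<psi> \<phi> w) =
    htpy g \<psi> \<phi> (tail_word G a w) - frag_of (map \<psi> (a # w)) + frag_of ((\<psi> a \<otimes>\<^bsub>H\<^esub> g) # map \<phi> w)
      - cons_chain g (map_chain \<phi> (tail_word G a w))"
  using assms(4,5)
proof (induction w arbitrary: a)
  case Nil
  then show ?case by simp
next
  case (Cons b w)
  then have "b \<in> S" "w \<in> lists S" by auto
  with Cons show ?case
    by (simp add: chain_ops_linear tail_boundary_cons htpy_cons map_chain_cons hom hom' conj
        map_chain_tail[of S \<phi> G H])
qed

text \<open>For \<open>\<phi> = \<psi> = id\<close> the homotopy anticommutes with the boundary: this is the product with the
  cycle \<open>[g]\<close>. For \<open>\<phi>\<close> a conjugation and \<open>\<psi> = id\<close> it shows that conjugation acts trivially.\<close>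

lemma bar_boundary_htpy:
  assumes hom: "\<And>a b. a \<in> S \<Longrightarrow> b \<in> S \<Longrightarrow> \<phi> (a \<otimes>\<^bsub>G\<^esub> b) = \<phi> a \<otimes>\<^bsub>H\<^esub> \<phi> b"
    and hom': "\<And>a b. a \<in> S \<Longrightarrow> b \<in> S \<Longrightarrow> \<psi> (a \<otimes>\<^bsub>G\<^esub> b) = \<psi> a \<otimes>\<^bsub>H\<^esub> \<psi> b"
    and conj: "\<And>a. a \<in> S \<Longrightarrow> g \<otimes>\<^bsub>H\<^esub> \<phi> a = \<psi> a \<otimes>\<^bsub>H\<^esub> g"
    and c: "Poly_Mapping.keys c \<subseteq> lists S"
  shows "bar_boundary H (htpy g \<psi> \<phi> c) = map_chain \<phi> c - map_chain \<psi> c - htpy g \<psi> \<phi> (bar_boundary G c)"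
  using c
proof (induction c rule: frag_induction)
  case (one w)
  show ?case
  proof (cases w)
    case Nil
    then show ?thesis by simp
  next
    case (Cons a v)
    with one have "a \<in> S" "v \<in> lists S" by auto
    with Cons show ?thesis
      using tail_htpy[of S \<phi> G H \<psi> g a v] hom hom' conj
      by (simp add: chain_ops_linear bar_boundary_cons map_chain_tail[of S \<phi> G H])
  qed
qed (simp_all add: chain_ops_linear)

lemma bar_boundary_shuffle:
  assumes "\<And>a. a \<in> S \<Longrightarrow> g \<otimes>\<^bsub>G\<^esub> a = a \<otimes>\<^bsub>G\<^esub> g" "Poly_Mapping.keys c \<subseteq> lists S"
  shows "bar_boundary G (shuffle g c) = - shuffle g (bar_boundary G c)"
  using bar_boundary_htpy[of S "\<lambda>a. a" G G "\<lambda>a. a" g c] assms by simp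

lemma tail_shuffle2:
  assumes g: "\<And>a. a \<in> S \<Longrightarrow> g \<otimes>\<^bsub>G\<^esub> a = a \<otimes>\<^bsub>G\<^esub> g"
    and h: "\<And>a. a \<in> S \<Longrightarrow> h \<otimes>\<^bsub>G\<^esub> a = a \<otimes>\<^bsub>G\<^esub> h"
    and "a \<in> S" "w \<in> lists S"
  shows "tail_boundary G a (shuffle2_word g h w) =
    shuffle2 g h (tail_word G a w) + cons_chain (g \<otimes>\<^bsub>G\<^esub> a) (shuffle h (frag_of w))
      - cons_chain g (shuffle h (tail_word G a w)) + cons_chain a (shuffle g (frag_of w))
      - cons_chain a (shuffle (g \<otimes>\<^bsub>G\<^esub> h) (frag_of w))"
  using assms(3,4)
proof (induction w arbitrary: a)
  case Nil
  then show ?case by (simp add: g h tail_boundary_cons chain_ops_linear)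
next
  case (Cons b w)
  then have b: "b \<in> S" "w \<in> lists S" by auto
  have "tail_boundary G b (htpy_word h (\<lambda>a. a) (\<lambda>a. a) w) =
    shuffle h (tail_word G b w) - frag_of (b # w) + frag_of ((b \<otimes>\<^bsub>G\<^esub> h) # w)
      - cons_chain h (tail_word G b w)"
    using tail_htpy[of S "\<lambda>a. a" G G "\<lambda>a. a" h b w] h b by simp
  with Cons b show ?case
    by (simp add: chain_ops_linear tail_boundary_cons htpy_cons shuffle2_cons g h)
qed

text \<open>The Leibniz rule for the product with \<open>[g|h]\<close>, whose boundary is
  \<open>[h] - [gh] + [g]\<close>. Applied to a cycle it gives additivity in one slot.\<close>

lemma bar_boundary_shuffle2:
  assumes g: "\<And>a. a \<in> S \<Longrightarrow> g \<otimes>\<^bsub>G\<^esub> a = a \<otimes>\<^bsub>G\<^esub> g"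
    and h: "\<And>a. a \<in> S \<Longrightarrow> h \<otimes>\<^bsub>G\<^esub> a = a \<otimes>\<^bsub>G\<^esub> h"
    and c: "Poly_Mapping.keys c \<subseteq> lists S"
  shows "bar_boundary G (shuffle2 g h c) =
    shuffle2 g h (bar_boundary G c) + shuffle g c + shuffle h c - shuffle (g \<otimes>\<^bsub>G\<^esub> h) c"
  using c
proof (induction c rule: frag_induction)
  case (one w)
  show ?case
  proof (cases w)
    case Nil
    then show ?thesis by simp
  next
    case (Cons a v)
    with one have a: "a \<in> S" "v \<in> lists S" by auto
    have "tail_boundary G a (htpy_word h (\<lambda>a. a) (\<lambda>a. a) v) =
      shuffle h (tail_word G a v) - frag_of (a # v) + frag_of ((a \<otimes>\<^bsub>G\<^esub> h) # v)
        - cons_chain h (tail_word G a v)"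
      using tail_htpy[of S "\<lambda>a. a" G G "\<lambda>a. a" h a v] h a by simp
    with Cons a show ?thesis
      using tail_shuffle2[OF g h a]
      by (simp add: h chain_ops_linear bar_boundary_cons tail_boundary_cons htpy_cons)
  qed
qed (simp_all add: chain_ops_linear)

text \<open>Inserting \<open>g\<close> and \<open>h\<close> in either order produces the same words,
  but the letter inserted last sees the other one exactly once as an additional letter to move past
  in one of the two orders. Hence antisymmetry holds for chains, before passing to homology.\<close>

lemma shuffle_anticommute: "shuffle g (shuffle h c) = - shuffle h (shuffle g c)"
proof (induction c rule: chain_induct)
  case (word w)
  show ?case
    by (induction w) (simp_all add: chain_ops_linear htpy_cons)
qed (simp_all add: chain_ops_linear)

section \<open>Cycles of commuting elements\<close>

definition comm_chain :: "'g list \<Rightarrow> ('g list \<Rightarrow>\<^sub>0 int)" where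
  "comm_chain gs = foldr shuffle gs (frag_of [])"

lemma comm_chain_simps [simp]:
  "comm_chain [] = frag_of []" "comm_chain (g # gs) = shuffle g (comm_chain gs)"
  by (simp_all add: comm_chain_def)

lemma shuffle_word_eq_sum:
  "htpy_word g (\<lambda>a. a) (\<lambda>a. a) w =
    (\<Sum>i\<le>length w. frag_cmul ((-1) ^ i) (frag_of (take i w @ g # drop i w)))"
proof (induction w)
  case Nil
  then show ?case by simp
next
  case (Cons a w)
  have "frag_cmul ((-1) ^ Suc i) x = - frag_cmul ((-1) ^ i) x" for i and x :: "'a list \<Rightarrow>\<^sub>0 int"
    by simp
  then show ?case
    unfolding list.size add_Suc_right add_0_right sum.atMost_Suc_shift
    by (simp add: sum_negf Cons.IH chain_ops_cmul_sum del: power_Suc minus_frag_cmul)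
qed

text \<open>The inserted permutation sends position \<open>i\<close> to index 0, which is where
  \<open>x\<close> sits in \<open>x # xs\<close>.\<close>

lemma permute_list_insert:
  assumes p: "p permutes {0..<length xs}" and i: "i \<le> length xs"
  shows "permute_list (permutation_insert i 0 p) (x # xs) =
    take i (permute_list p xs) @ x # drop i (permute_list p xs)" (is "?l = ?r")
proof (rule nth_equalityI)
  show "length ?l = length ?r" using i by simp
next
  fix k assume "k < length ?l"
  then have k: "k < Suc (length xs)" by simp
  have q: "permutation_insert i 0 p permutes {..<length (x # xs)}"
    using permutation_insert_permutes[OF p, of i 0] i by (simp add: lessThan_atLeast0)
  have p': "p permutes {..<length xs}" using p by (simp add: lessThan_atLeast0)
  have "?l ! k = (x # xs) ! (permutation_insert i 0 p k)"
    using permute_list_nth[OF q, of k] k by simp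
  also have "\<dots> = ?r ! k"
    using i k by (auto simp: permutation_insert_expand nth_append min_def permute_list_nth[OF p'] nth_Cons' nth_drop)
  finally show "?l ! k = ?r ! k" .
qed

lemma inj_on_permutation_insert: "inj_on (permutation_insert i j) {p. p permutes {0..<n}}"
proof (rule inj_on_inverseI)
  fix p :: "nat \<Rightarrow> nat"
  show "permutation_delete (permutation_insert i j p) i = p"
    by (rule ext) (auto simp: permutation_delete_expand permutation_insert_expand)
qed

text \<open>Permutations of one more letter are sorted by the position \<open>i\<close> at which the
  head \<open>g\<close> lands. Each fibre consists of the permutations of the remaining letters, and
  the sign changes by the factor (-1)^i that \<open>shuffle\<close> attaches to that
  position.\<close>

lemma comm_chain_eq_sum:
  "comm_chain gs =
    (\<Sum>\<sigma> | \<sigma> permutes {..<length gs}. frag_cmul (sign \<sigma>) (frag_of (permute_list \<sigma> gs)))"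
proof (induction gs)
  case Nil
  then show ?case by simp
next
  case (Cons g gs)
  let ?n = "length gs"
  let ?P = "\<lambda>n. {p. p permutes {0..<n::nat}}"
  let ?F = "\<lambda>\<sigma>. frag_cmul (sign \<sigma>) (frag_of (permute_list \<sigma> (g # gs)))"
  have fin: "finite (?P n)" for n by (simp add: finite_permutations)
  have "(\<Sum>\<sigma> \<in> ?P (Suc ?n). ?F \<sigma>) = (\<Sum>i\<in>{0..<Suc ?n}. \<Sum>\<sigma> \<in> {\<sigma> \<in> ?P (Suc ?n). \<sigma> i = 0}. ?F \<sigma>)"
  proof -
    have eq: "?P (Suc ?n) = (\<Union>i\<in>{0..<Suc ?n}. {\<sigma> \<in> ?P (Suc ?n). \<sigma> i = 0})"
      using permutation_split_ran[of 0 "{0..<Suc ?n}"] by auto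
    show ?thesis
      by (subst eq, rule sum.UNION_disjoint)
         (use fin permutation_disjoint_dom[of _ "{0..<Suc ?n}" _ 0] in auto)
  qed
  also have "\<dots> = (\<Sum>i\<in>{0..<Suc ?n}. \<Sum>p\<in>?P ?n. ?F (permutation_insert i 0 p))"
  proof (rule sum.cong[OF refl])
    fix i assume "i \<in> {0..<Suc ?n}"
    then have i: "i < Suc ?n" by simp
    show "(\<Sum>\<sigma> \<in> {\<sigma> \<in> ?P (Suc ?n). \<sigma> i = 0}. ?F \<sigma>) = (\<Sum>p\<in>?P ?n. ?F (permutation_insert i 0 p))"
      using permutation_fix[OF i, of 0] sum.reindex[OF inj_on_permutation_insert[of i 0 ?n], of ?F]
      by simp
  qed
  also have "\<dots> = (\<Sum>i\<in>{0..<Suc ?n}. \<Sum>p\<in>?P ?n. frag_cmul (sign p) (frag_cmul ((-1) ^ i)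
      (frag_of (take i (permute_list p gs) @ g # drop i (permute_list p gs)))))"
  proof (intro sum.cong refl)
    fix i p assume "i \<in> {0..<Suc ?n}" "p \<in> ?P ?n"
    then have i: "i < Suc ?n" and p: "p permutes {0..<?n}" by auto
    have "sign (permutation_insert i 0 p) = (-1) ^ i * sign p"
      using signof_permutation_insert[OF p i, of 0, where 'a=int] by simp
    then show "?F (permutation_insert i 0 p) = frag_cmul (sign p) (frag_cmul ((-1) ^ i)
      (frag_of (take i (permute_list p gs) @ g # drop i (permute_list p gs))))"
      using permute_list_insert[OF p, of i g] i by (simp add: mult.commute)
  qed
  also have "\<dots> = (\<Sum>p\<in>?P ?n. frag_cmul (sign p) (htpy_word g (\<lambda>a. a) (\<lambda>a. a) (permute_list p gs)))"
    by (subst sum.swap) (simp add: shuffle_word_eq_sum frag_cmul_sum atLeast0LessThan lessThan_Suc_atMost)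
  also have "\<dots> = comm_chain (g # gs)"
    by (simp add: Cons.IH chain_ops_cmul_sum atLeast0LessThan)
  finally show ?case by (simp add: atLeast0LessThan)
qed

lemma comm_class_eq: "comm_class G gs = homology_class G (length gs) (comm_chain gs)"
  by (simp add: comm_class_def comm_chain_eq_sum)

section \<open>Congruences modulo additive subgroups, and chains with prescribed entries\<close>

definition add_subgroup :: "'a::ab_group_add set \<Rightarrow> bool" where
  "add_subgroup N \<longleftrightarrow> 0 \<in> N \<and> (\<forall>x\<in>N. \<forall>y\<in>N. x - y \<in> N)"

lemma add_subgroup_zero: "add_subgroup N \<Longrightarrow> 0 \<in> N"
  and add_subgroup_diff: "add_subgroup N \<Longrightarrow> x \<in> N \<Longrightarrow> y \<in> N \<Longrightarrow> x - y \<in> N"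
  by (auto simp: add_subgroup_def)

lemma add_subgroup_minus: "add_subgroup N \<Longrightarrow> x \<in> N \<Longrightarrow> - x \<in> N"
  using add_subgroup_diff[of N 0 x] by (simp add: add_subgroup_zero)

lemma add_subgroup_minus_iff: "add_subgroup N \<Longrightarrow> - x \<in> N \<longleftrightarrow> x \<in> N"
  using add_subgroup_minus[of N x] add_subgroup_minus[of N "- x"] by auto

lemma add_subgroup_add: "add_subgroup N \<Longrightarrow> x \<in> N \<Longrightarrow> y \<in> N \<Longrightarrow> x + y \<in> N"
  using add_subgroup_diff[of N x "- y"] by (simp add: add_subgroup_minus)

lemma add_subgroup_sum: "add_subgroup N \<Longrightarrow> (\<And>i. i \<in> I \<Longrightarrow> f i \<in> N) \<Longrightarrow> sum f I \<in> N"
  by (induction I rule: infinite_finite_induct) (auto simp: add_subgroup_zero add_subgroup_add)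

lemma add_subgroup_cmul:
  assumes "add_subgroup N" "x \<in> N"
  shows "frag_cmul k x \<in> N"
proof (induction k)
  case (nonneg n)
  show ?case
    by (induction n) (use assms in \<open>auto simp: add_subgroup_zero add_subgroup_add frag_cmul_distrib\<close>)
next
  case (neg n)
  have "frag_cmul (int m) x \<in> N" for m
    by (induction m) (use assms in \<open>auto simp: add_subgroup_zero add_subgroup_add frag_cmul_distrib\<close>)
  from add_subgroup_minus[OF assms(1) this[of "Suc n"]] show ?case by simp
qed

lemma frag_extend_in:
  assumes "add_subgroup N" "Poly_Mapping.keys c \<subseteq> S" "\<And>w. w \<in> S \<Longrightarrow> f w \<in> N"
  shows "frag_extend f c \<in> N"
  using assms(2)
  by (induction c rule: frag_induction)
     (auto simp: assms add_subgroup_zero add_subgroup_diff frag_extend_diff)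

definition chains_over :: "'g set \<Rightarrow> nat \<Rightarrow> ('g list \<Rightarrow>\<^sub>0 int) set" where
  "chains_over S n = {c. Poly_Mapping.keys c \<subseteq> tuples S n}"

text \<open>Only the bounding chain is confined to \<open>S\<close>. The set need not be closed
  under products, so the boundary itself may have entries outside it.\<close>

definition boundaries :: "('g, 'm) monoid_scheme \<Rightarrow> 'g set \<Rightarrow> nat \<Rightarrow> ('g list \<Rightarrow>\<^sub>0 int) set" where
  "boundaries G S n = bar_boundary G ` chains_over S (Suc n)"

definition pairwise_commuting :: "('g, 'm) monoid_scheme \<Rightarrow> 'g set \<Rightarrow> bool" where
  "pairwise_commuting G S \<longleftrightarrow> (\<forall>a\<in>S. \<forall>b\<in>S. a \<otimes>\<^bsub>G\<^esub> b = b \<otimes>\<^bsub>G\<^esub> a)"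

lemma pairwise_commutingD: "pairwise_commuting G S \<Longrightarrow> a \<in> S \<Longrightarrow> b \<in> S \<Longrightarrow> a \<otimes>\<^bsub>G\<^esub> b = b \<otimes>\<^bsub>G\<^esub> a"
  by (simp add: pairwise_commuting_def)

lemma pairwise_commuting_subset: "pairwise_commuting G S \<Longrightarrow> T \<subseteq> S \<Longrightarrow> pairwise_commuting G T"
  by (auto simp: pairwise_commuting_def)

lemma carrier_bar_chains: "carrier (bar_chains G n) = chains_over (carrier G) n"
  by (auto simp: bar_chains_def chains_over_def)

lemma bar_boundaries_eq: "bar_boundaries G n = boundaries G (carrier G) n"
  by (simp add: bar_boundaries_def boundaries_def carrier_bar_chains)

lemma chains_mono: "S \<subseteq> T \<Longrightarrow> chains_over S n \<subseteq> chains_over T n"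
  by (auto simp: chains_over_def tuples_def)

lemma boundaries_mono: "S \<subseteq> T \<Longrightarrow> boundaries G S n \<subseteq> boundaries G T n"
  unfolding boundaries_def by (intro image_mono chains_mono)

lemma chains_lists: "c \<in> chains_over S n \<Longrightarrow> Poly_Mapping.keys c \<subseteq> lists S"
  by (auto simp: chains_over_def tuples_def)

lemma add_subgroup_chains: "add_subgroup (chains_over S n)"
  unfolding add_subgroup_def chains_over_def using keys_diff by fastforce

lemma frag_of_chains [simp]: "frag_of w \<in> chains_over S n \<longleftrightarrow> w \<in> tuples S n"
  by (simp add: chains_over_def)

lemma add_subgroup_boundaries: "add_subgroup (boundaries G S n)"
  unfolding add_subgroup_def boundaries_def
proof (intro conjI ballI)
  show "0 \<in> bar_boundary G ` chains_over S (Suc n)"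
    using add_subgroup_zero[OF add_subgroup_chains] by (rule rev_image_eqI) simp
  fix x y assume "x \<in> bar_boundary G ` chains_over S (Suc n)" "y \<in> bar_boundary G ` chains_over S (Suc n)"
  then show "x - y \<in> bar_boundary G ` chains_over S (Suc n)"
    using add_subgroup_diff[OF add_subgroup_chains, of _ S "Suc n"]
    by (auto simp: chain_ops_diff(6)[symmetric] intro!: imageI)
qed

lemma add_subgroup_bar_boundaries: "add_subgroup (bar_boundaries G n)"
  by (simp add: bar_boundaries_eq add_subgroup_boundaries)

lemma cons_chain_closed: "c \<in> chains_over S n \<Longrightarrow> a \<in> S \<Longrightarrow> cons_chain a c \<in> chains_over S (Suc n)"
  unfolding cons_chain_def
  by (rule frag_extend_in[OF add_subgroup_chains, of _ "tuples S n"])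
     (auto simp: chains_over_def tuples_def)

lemma map_chain_closed: "c \<in> chains_over S n \<Longrightarrow> f ` S \<subseteq> T \<Longrightarrow> map_chain f c \<in> chains_over T n"
  unfolding map_chain_def
  by (rule frag_extend_in[OF add_subgroup_chains, of _ "tuples S n"])
     (auto simp: chains_over_def tuples_def)

lemma htpy_closed:
  assumes "c \<in> chains_over S n" "\<phi> ` S \<subseteq> T" "\<psi> ` S \<subseteq> T" "g \<in> T"
  shows "htpy g \<psi> \<phi> c \<in> chains_over T (Suc n)"
  unfolding htpy_def
proof (rule frag_extend_in[OF add_subgroup_chains, of _ "tuples S n"])
  fix w assume "w \<in> tuples S n"
  then show "htpy_word g \<psi> \<phi> w \<in> chains_over T (Suc n)"
  proof (induction w arbitrary: n)
    case Nil
    then show ?case using assms by (auto simp: tuples_def)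
  next
    case (Cons a w)
    then obtain m where m: "n = Suc m" "w \<in> tuples S m" "a \<in> S"
      by (cases n) (auto simp: tuples_def)
    then have "cons_chain (\<psi> a) (htpy_word g \<psi> \<phi> w) \<in> chains_over T (Suc n)"
      using Cons.IH[of m] assms by (auto intro: cons_chain_closed)
    then show ?case
      using Cons.prems assms(2-)
      unfolding htpy_word.simps
      by (intro add_subgroup_diff[OF add_subgroup_chains]) (auto simp: tuples_def image_subset_iff)
  qed
qed (use assms in \<open>auto simp: chains_over_def\<close>)

lemma shuffle_closed: "c \<in> chains_over S n \<Longrightarrow> g \<in> S \<Longrightarrow> shuffle g c \<in> chains_over S (Suc n)"
  by (rule htpy_closed[where S = S]) auto

lemma shuffle2_closed:
  assumes "c \<in> chains_over S n" "g \<in> S" "h \<in> S"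
  shows "shuffle2 g h c \<in> chains_over S (Suc (Suc n))"
  unfolding shuffle2_def
proof (rule frag_extend_in[OF add_subgroup_chains, of _ "tuples S n"])
  fix w assume "w \<in> tuples S n"
  then show "shuffle2_word g h w \<in> chains_over S (Suc (Suc n))"
  proof (induction w arbitrary: n)
    case Nil
    then show ?case using assms by (auto simp: tuples_def)
  next
    case (Cons a w)
    then obtain m where m: "n = Suc m" "w \<in> tuples S m" "a \<in> S"
      by (cases n) (auto simp: tuples_def)
    have "cons_chain g (shuffle h (frag_of (a # w))) \<in> chains_over S (Suc (Suc n))"
      using Cons.prems assms by (intro cons_chain_closed shuffle_closed) auto
    moreover have "cons_chain a (shuffle2_word g h w) \<in> chains_over S (Suc (Suc n))"
      using m Cons.IH[of m] by (auto intro: cons_chain_closed)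
    ultimately show ?case
      by (auto intro!: add_subgroup_add[OF add_subgroup_chains])
  qed
qed (use assms in \<open>auto simp: chains_over_def\<close>)

lemma comm_chain_closed: "set gs \<subseteq> S \<Longrightarrow> comm_chain gs \<in> chains_over S (length gs)"
  by (induction gs) (auto simp: tuples_def intro: shuffle_closed)

lemma bar_boundary_comm_chain:
  assumes "pairwise_commuting G (set gs)"
  shows "bar_boundary G (comm_chain gs) = 0"
  using assms
proof (induction gs)
  case (Cons g gs)
  have "bar_boundary G (shuffle g (comm_chain gs)) = - shuffle g (bar_boundary G (comm_chain gs))"
  proof (rule bar_boundary_shuffle)
    show "Poly_Mapping.keys (comm_chain gs) \<subseteq> lists (set gs)"
      using comm_chain_closed[OF subset_refl] by (rule chains_lists)
  qed (rule pairwise_commutingD[OF Cons.prems], auto)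
  moreover have "bar_boundary G (comm_chain gs) = 0"
    using Cons.IH pairwise_commuting_subset[OF Cons.prems] by auto
  ultimately show ?case by simp
qed simp

text \<open>If \<open>u\<close> bounds \<open>c\<close>, then the product of \<open>-u\<close> with
  \<open>[g]\<close> bounds the product of \<open>c\<close>. The sign comes from the anticommutation
  of \<open>shuffle g\<close> with the boundary.\<close>

lemma shuffle_boundaries:
  assumes "\<And>a. a \<in> S \<Longrightarrow> g \<otimes>\<^bsub>G\<^esub> a = a \<otimes>\<^bsub>G\<^esub> g" "g \<in> S" "c \<in> boundaries G S n"
  shows "shuffle g c \<in> boundaries G S (Suc n)"
proof -
  from assms obtain u where u: "c = bar_boundary G u" "u \<in> chains_over S (Suc n)"
    by (auto simp: boundaries_def)
  have "shuffle g c = bar_boundary G (shuffle g (- u))"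
    using bar_boundary_shuffle[OF assms(1) chains_lists[OF u(2)]] u(1)
    by (simp add: chain_ops_minus)
  moreover have "shuffle g (- u) \<in> chains_over S (Suc (Suc n))"
    using u assms by (intro shuffle_closed add_subgroup_minus[OF add_subgroup_chains])
  ultimately show ?thesis by (auto simp: boundaries_def)
qed

lemma foldr_shuffle_boundaries:
  assumes "\<And>a b. a \<in> set xs \<Longrightarrow> b \<in> S \<Longrightarrow> a \<otimes>\<^bsub>G\<^esub> b = b \<otimes>\<^bsub>G\<^esub> a" "set xs \<subseteq> S" "c \<in> boundaries G S n"
  shows "foldr shuffle xs c \<in> boundaries G S (length xs + n)"
  using assms
proof (induction xs)
  case (Cons x xs)
  show ?case
    unfolding foldr.simps comp_apply list.size add_Suc_right add_0_right add_Suc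
    by (rule shuffle_boundaries) (use Cons in auto)
qed simp

lemma comm_chain_append: "comm_chain (xs @ ys) = foldr shuffle xs (comm_chain ys)"
  by (simp add: comm_chain_def)

lemma foldr_shuffle_diff: "foldr shuffle xs (c - d) = foldr shuffle xs c - foldr shuffle xs d"
  by (induction xs) (simp_all add: chain_ops_diff)

lemma foldr_shuffle_minus: "foldr shuffle xs (- c) = - foldr shuffle xs c"
  by (induction xs) (simp_all add: chain_ops_minus)

text \<open>The Leibniz rule for \<open>shuffle2 g h\<close> is applied to the inner cycle of
  \<open>ys\<close>. The outer entries \<open>xs\<close> then act on a boundary over
  \<open>S\<close>, all of whose entries they commute with.\<close>

lemma comm_chain_mult:
  assumes "pairwise_commuting G S" "set xs \<subseteq> S" "set ys \<subseteq> S" "g \<in> S" "h \<in> S"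
  shows "comm_chain (xs @ (g \<otimes>\<^bsub>G\<^esub> h) # ys) - comm_chain (xs @ g # ys) - comm_chain (xs @ h # ys)
    \<in> boundaries G S (length xs + Suc (length ys))"
proof -
  let ?c = "comm_chain ys"
  have c: "?c \<in> chains_over S (length ys)" "bar_boundary G ?c = 0"
    using assms(3) comm_chain_closed[of ys S] bar_boundary_comm_chain[OF pairwise_commuting_subset[OF assms(1)]]
    by auto
  have "bar_boundary G (- shuffle2 g h ?c) = shuffle (g \<otimes>\<^bsub>G\<^esub> h) ?c - shuffle g ?c - shuffle h ?c"
    using bar_boundary_shuffle2[of S G g h ?c] pairwise_commutingD[OF assms(1)] assms(4,5) c chains_lists[OF c(1)]
    by (simp add: chain_ops_minus)
  moreover have "- shuffle2 g h ?c \<in> chains_over S (Suc (Suc (length ys)))"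
    using assms c by (intro add_subgroup_minus[OF add_subgroup_chains] shuffle2_closed)
  ultimately have "shuffle (g \<otimes>\<^bsub>G\<^esub> h) ?c - shuffle g ?c - shuffle h ?c \<in> boundaries G S (Suc (length ys))"
    unfolding boundaries_def by (metis image_eqI)
  then have "foldr shuffle xs (shuffle (g \<otimes>\<^bsub>G\<^esub> h) ?c - shuffle g ?c - shuffle h ?c)
      \<in> boundaries G S (length xs + Suc (length ys))"
    using assms(2) by (intro foldr_shuffle_boundaries) (auto intro!: pairwise_commutingD[OF assms(1)])
  then show ?thesis by (simp add: comm_chain_append foldr_shuffle_diff)
qed

lemma comm_chain_swap: "comm_chain (xs @ g # h # ys) = - comm_chain (xs @ h # g # ys)"
  using shuffle_anticommute[of g h "comm_chain ys"] by (simp add: comm_chain_append foldr_shuffle_minus)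

text \<open>Moving a pair past one entry takes two transpositions, so no sign appears. This brings
  the first two entries to the innermost place, where the other entries multiply a chain already
  known to be a boundary.\<close>

lemma comm_chain_rotate2: "comm_chain (g # h # ys) = comm_chain (ys @ [g, h])"
proof (induction ys rule: rev_induct)
  case (snoc z ys)
  have "comm_chain (ys @ [z] @ [g, h]) = comm_chain (ys @ [g, h] @ [z])"
    using comm_chain_swap[of ys z g "[h]"] comm_chain_swap[of "ys @ [g]" z h "[]"] by simp
  moreover have "comm_chain (g # h # ys @ [z]) = comm_chain ((ys @ [g, h]) @ [z])"
  proof -
    have eq: "foldr shuffle (g # h # zs) c = foldr shuffle (zs @ [g, h]) c" for zs c
    proof (induction zs)
      case (Cons y zs)
      have "foldr shuffle (g # h # y # zs) c = foldr shuffle (y # g # h # zs) c"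
        using shuffle_anticommute[of h y "foldr shuffle zs c"]
          shuffle_anticommute[of g y "shuffle h (foldr shuffle zs c)"]
        by (simp add: chain_ops_minus)
      with Cons show ?case by simp
    qed simp
    show ?thesis
      using eq[of ys "comm_chain [z]"] by (simp add: comm_chain_append)
  qed
  ultimately show ?case by simp
qed simp

lemma map_chain_shuffle: "map_chain f (shuffle g c) = shuffle (f g) (map_chain f c)"
proof (induction c rule: chain_induct)
  case (word w)
  show ?case by (induction w) (simp_all add: chain_ops_linear map_chain_cons)
qed (simp_all add: chain_ops_linear)

lemma map_chain_comm_chain: "map_chain f (comm_chain gs) = comm_chain (map f gs)"
  by (induction gs) (simp_all add: map_chain_shuffle)

lemma map_chain_boundaries:
  assumes "\<And>a b. a \<in> S \<Longrightarrow> b \<in> S \<Longrightarrow> f (a \<otimes>\<^bsub>G\<^esub> b) = f a \<otimes>\<^bsub>H\<^esub> f b" "f ` S \<subseteq> T"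
    and "c \<in> boundaries G S n"
  shows "map_chain f c \<in> boundaries H T n"
proof -
  from assms obtain u where u: "c = bar_boundary G u" "u \<in> chains_over S (Suc n)"
    by (auto simp: boundaries_def)
  then have "map_chain f c = bar_boundary H (map_chain f u)"
    using map_chain_boundary[of S f G H u] assms chains_lists[OF u(2)] by simp
  then show ?thesis
    using map_chain_closed[OF u(2) assms(2)] by (auto simp: boundaries_def)
qed

text \<open>Since the chain of commuting elements is a cycle, the last term of the homotopy formula
  vanishes and \<open>htpy g (\<lambda>a. a) \<phi>\<close> of it bounds the difference.\<close>

lemma comm_chain_conj:
  assumes "pairwise_commuting G (set gs)" "set gs \<subseteq> T" "\<phi> ` set gs \<subseteq> T" "g \<in> T"
    and "\<And>a b. a \<in> set gs \<Longrightarrow> b \<in> set gs \<Longrightarrow> \<phi> (a \<otimes>\<^bsub>G\<^esub> b) = \<phi> a \<otimes>\<^bsub>G\<^esub> \<phi> b"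
    and "\<And>a. a \<in> set gs \<Longrightarrow> g \<otimes>\<^bsub>G\<^esub> \<phi> a = a \<otimes>\<^bsub>G\<^esub> g"
  shows "comm_chain (map \<phi> gs) - comm_chain gs \<in> boundaries G T (length gs)"
proof -
  let ?c = "comm_chain gs"
  have c: "?c \<in> chains_over (set gs) (length gs)" by (simp add: comm_chain_closed)
  have "bar_boundary G (htpy g (\<lambda>a. a) \<phi> ?c) = map_chain \<phi> ?c - ?c"
    using bar_boundary_htpy[OF assms(5) _ assms(6) chains_lists[OF c]]
      bar_boundary_comm_chain[OF assms(1)] by simp
  moreover have "htpy g (\<lambda>a. a) \<phi> ?c \<in> chains_over T (Suc (length gs))"
    using assms by (intro htpy_closed[OF c]) auto
  ultimately show ?thesis
    unfolding boundaries_def map_chain_comm_chain by (metis image_eqI)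
qed

section \<open>The Steinberg relation in central extensions of \<open>GL\<^sub>2\<close>\<close>

text \<open>For fixed \<open>a\<close>, Hua's identity yields f(a^2 b) = f(a) + f(b) modulo
  \<open>N\<close> for all but two values of b. The left side is additive in b, while the right side
  is additive only up to the constant f(a), so comparing b, b' and b + b' forces that constant into
  \<open>N\<close>.\<close>

lemma additive_inversion_odd_vanishes:
  fixes f :: "'a::field \<Rightarrow> 'b::ab_group_add"
  assumes inf: "infinite (UNIV :: 'a set)" and N: "add_subgroup N"
    and add: "\<And>s t. f (s + t) - f s - f t \<in> N"
    and inv: "\<And>t. t \<noteq> 0 \<Longrightarrow> f (1 / t) + f t \<in> N"
  shows "f a \<in> N"
proof (cases "a = 0")
  case True
  have "f (0 + 0) - f 0 - f 0 \<in> N" by (rule add)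
  then show ?thesis using True by (simp add: add_subgroup_minus_iff[OF N])
next
  case a: False
  note plus = add_subgroup_add[OF N] and minus = add_subgroup_diff[OF N]
  have diff: "f (s - t) - f s + f t \<in> N" for s t
    using add_subgroup_minus[OF N add[of "s - t" t]] by (simp add: algebra_simps)
  \<comment> \<open>Hua's identity \<open>1 / (a - a\<^sup>2 b) = 1 / a + 1 / (1 / b - a)\<close>\<close>
  have hua: "f (a\<^sup>2 * b) - f a - f b \<in> N" if b: "b \<noteq> 0" "b \<noteq> 1 / a" for b
  proof -
    have ab: "1 - a * b \<noteq> 0" using b a by (auto simp: field_simps)
    have A: "a - a\<^sup>2 * b \<noteq> 0"
    proof -
      have "a - a\<^sup>2 * b = a * (1 - a * b)" by (simp add: algebra_simps power2_eq_square)
      then show ?thesis using a ab by simp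
    qed
    have B: "1 / b - a \<noteq> 0" using ab b by (auto simp: field_simps)
    have e1: "1 / (a - a\<^sup>2 * b) = 1 / a + b / (1 - a * b)"
      using a ab A by (simp add: field_simps) (simp add: algebra_simps power2_eq_square power3_eq_cube)
    have e2: "b / (1 - a * b) = 1 / (1 / b - a)"
    proof -
      have "1 / b - a = (1 - a * b) / b" using b(1) by (simp add: field_simps)
      then show ?thesis by simp
    qed
    have m1: "f (a - a\<^sup>2 * b) - f a + f (a\<^sup>2 * b) \<in> N" by (rule diff)
    have m2: "f (1 / (a - a\<^sup>2 * b)) + f (a - a\<^sup>2 * b) \<in> N" using inv A .
    have m3: "f (1 / (a - a\<^sup>2 * b)) - f (1 / a) - f (b / (1 - a * b)) \<in> N"
      using add[of "1 / a" "b / (1 - a * b)"] e1 by simp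
    have m4: "f (1 / a) + f a \<in> N" using inv a .
    have m5: "f (b / (1 - a * b)) + f (1 / b - a) \<in> N" using inv[OF B] e2 by simp
    have m6: "f (1 / b - a) - f (1 / b) + f a \<in> N" by (rule diff)
    have m7: "f (1 / b) + f b \<in> N" using inv b(1) .
    have "f (a\<^sup>2 * b) - f a - f b =
      (((((((f (a - a\<^sup>2 * b) - f a + f (a\<^sup>2 * b)) - (f (1 / (a - a\<^sup>2 * b)) + f (a - a\<^sup>2 * b)))
      + (f (1 / (a - a\<^sup>2 * b)) - f (1 / a) - f (b / (1 - a * b)))) + (f (1 / a) + f a))
      + (f (b / (1 - a * b)) + f (1 / b - a))) - (f (1 / b - a) - f (1 / b) + f a)) - (f (1 / b) + f b))"
      by simp
    also have "\<dots> \<in> N" by (intro plus minus m1 m2 m3 m4 m5 m6 m7)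
    finally show ?thesis .
  qed
  obtain b where b: "b \<notin> {0, 1 / a}"
    using ex_new_if_finite[OF inf, of "{0, 1 / a}"] by blast
  \<comment> \<open>The last two excluded values keep \<open>b + b'\<close> away from 0 and
    \<open>1 / a\<close>.\<close>
  obtain b' where b': "b' \<notin> {0, 1 / a, - b, 1 / a - b}"
    using ex_new_if_finite[OF inf, of "{0, 1 / a, - b, 1 / a - b}"] by blast
  have bb: "b + b' \<noteq> 0" "b + b' \<noteq> 1 / a"
    using b' by (auto simp: add_eq_0_iff eq_diff_eq add.commute)
  have p1: "f (a\<^sup>2 * b) - f a - f b \<in> N" and p2: "f (a\<^sup>2 * b') - f a - f b' \<in> N"
    and p3: "f (a\<^sup>2 * (b + b')) - f a - f (b + b') \<in> N"
    using b b' bb by (auto intro!: hua)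
  have q1: "f (a\<^sup>2 * (b + b')) - f (a\<^sup>2 * b) - f (a\<^sup>2 * b') \<in> N"
    using add[of "a\<^sup>2 * b" "a\<^sup>2 * b'"] by (simp add: distrib_left)
  have q2: "f (b + b') - f b - f b' \<in> N" by (rule add)
  have "f a = ((((f (a\<^sup>2 * (b + b')) - f a - f (b + b')) - (f (a\<^sup>2 * b) - f a - f b))
      - (f (a\<^sup>2 * b') - f a - f b')) - (f (a\<^sup>2 * (b + b')) - f (a\<^sup>2 * b) - f (a\<^sup>2 * b')))
      + (f (b + b') - f b - f b')" by simp
  also have "\<dots> \<in> N" by (intro plus minus p1 p2 p3 q1 q2)
  finally show ?thesis .
qed

text \<open>With h(u) = w(u) w(-1), the fact \<open>prod\<close> below says h(b) h(a) = h(ab), which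
  is the triviality of the Steinberg symbol. Conjugation by \<open>d\<close> scales the argument of
  \<open>w\<close> by \<open>a\<close>, so it sends h(b) to w(ab) w(-a). As w(-a) is inverse to
  w(a), this is again h(b).\<close>

lemma (in group) steinberg_relation_lift:
  fixes x y w :: "'f::field \<Rightarrow> 'a"
  assumes x [simp]: "\<And>t. x t \<in> carrier G" and y [simp]: "\<And>t. y t \<in> carrier G"
    and Xadd: "\<And>s t. x (s + t) = x s \<otimes> x t" and Yadd: "\<And>s t. y (s + t) = y s \<otimes> y t"
    and w: "\<And>u. w u = x u \<otimes> y (- 1 / u) \<otimes> x u"
    and WX: "\<And>u t. u \<noteq> 0 \<Longrightarrow> w u \<otimes> x t = y (- t / u\<^sup>2) \<otimes> w u"
    and WY: "\<And>u t. u \<noteq> 0 \<Longrightarrow> w u \<otimes> y t = x (- t * u\<^sup>2) \<otimes> w u"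
    and d [simp]: "d \<in> carrier G"
    and dX: "\<And>t. d \<otimes> x t = x (a * t) \<otimes> d" and dY: "\<And>t. d \<otimes> y t = y (t / a) \<otimes> d"
    and ab: "a + b = 1" "a \<noteq> 0" "b \<noteq> 0"
  shows "d \<otimes> (w b \<otimes> w (- 1)) = (w b \<otimes> w (- 1)) \<otimes> d"
proof -
  have Wc [simp]: "w u \<in> carrier G" for u by (simp add: w)
  have X0: "x 0 = \<one>" and Y0: "y 0 = \<one>"
    using Xadd[of 0 0] Yadd[of 0 0] by (simp_all add: l_cancel_one' r_cancel_one')
  have swapX: "w u \<otimes> (x t \<otimes> z) = y (- t / u\<^sup>2) \<otimes> (w u \<otimes> z)"
    and swapY: "w u \<otimes> (y t \<otimes> z) = x (- t * u\<^sup>2) \<otimes> (w u \<otimes> z)"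
    if "u \<noteq> 0" "z \<in> carrier G" for u t z
    using WX[OF that(1), of t] WY[OF that(1), of t] that by (simp_all add: m_assoc[symmetric])
  have joinX: "x s \<otimes> (x t \<otimes> z) = x (s + t) \<otimes> z" and joinY: "y s \<otimes> (y t \<otimes> z) = y (s + t) \<otimes> z"
    if "z \<in> carrier G" for s t z
    using that by (simp_all add: Xadd Yadd m_assoc)
  have Wx: "w u = x u \<otimes> (y (- 1 / u) \<otimes> x u)" for u by (simp add: w m_assoc)
  \<comment> \<open>This includes u = 0, where division by zero makes w(0) trivial.\<close>
  have Winv: "w (- u) \<otimes> (w u \<otimes> z) = z" if "z \<in> carrier G" for u z
    unfolding Wx using that by (simp add: m_assoc joinX joinY X0 Y0)
  \<comment> \<open>The same Weyl element with the roles of the two unipotent subgroups exchanged.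
    It is found by pushing \<open>x u\<close> through \<open>w u\<close> and cancelling it.\<close>
  have Wy: "w u = y (- 1 / u) \<otimes> (x u \<otimes> y (- 1 / u))" if u: "u \<noteq> 0" for u
  proof -
    have "(y (- 1 / u) \<otimes> (x u \<otimes> y (- 1 / u))) \<otimes> x u = y (- 1 / u) \<otimes> w u"
      by (simp add: Wx m_assoc)
    also have "\<dots> = w u \<otimes> x u" using WX[OF u, of u] u by (simp add: power2_eq_square)
    finally show ?thesis by simp
  qed
  \<comment> \<open>Conjugation by \<open>w u\<close> turns the form x y x of \<open>w t\<close>
    into the form y x y, which \<open>Wy\<close> recognizes as a Weyl element with parameter
    u^2/t.\<close>
  have WW: "w u \<otimes> w t = w (u\<^sup>2 / t) \<otimes> w u" if u: "u \<noteq> 0" "t \<noteq> 0" for u t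
  proof -
    have "w u \<otimes> w t = y (- t / u\<^sup>2) \<otimes> (x (u\<^sup>2 / t) \<otimes> (y (- t / u\<^sup>2) \<otimes> w u))"
      using u unfolding Wx[of t] by (simp add: swapX swapY WX)
    also have "\<dots> = w (u\<^sup>2 / t) \<otimes> w u"
      using u by (simp add: Wy[of "u\<^sup>2 / t"] m_assoc)
    finally show ?thesis .
  qed
  \<comment> \<open>Because a + b = 1, the two inner factors combine to y(-1/(ab)). The splittings b
    = b^2 + ab and a = ab + a^2 then expose w(ab) in the middle. Moving it to the right produces
    w(b^2) by means of a b^2 = b^2 - b^3, and the leftover y(-1/b) and y(1/b) cancel.\<close>
  have key: "w b \<otimes> w a = w (b\<^sup>2) \<otimes> w (a * b)"
  proof -
    have e1: "- (1 / b) + - (1 / a) = - 1 / (a * b)"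
    proof -
      have "- (1 / b) + - (1 / a) = - (a + b) / (a * b)" using ab(2,3) by (simp add: field_simps)
      with ab(1) show ?thesis by simp
    qed
    have a: "a = 1 - b" using ab(1) by (simp add: algebra_simps)
    have e2: "b\<^sup>2 + a * b = b" "a * b + a\<^sup>2 = a" "b\<^sup>2 + - (b ^ 3) = a * b\<^sup>2"
      unfolding a by (simp_all add: algebra_simps power2_eq_square power3_eq_cube)
    have "w b \<otimes> w a = y (- 1 / b) \<otimes> (x b \<otimes> (y (- 1 / (a * b)) \<otimes> (x a \<otimes> y (- 1 / a))))"
      using ab e1 by (simp add: Wy[of b] Wy[of a] m_assoc joinY)
    also have "\<dots> = y (- 1 / b) \<otimes> (x (b\<^sup>2 + a * b) \<otimes> (y (- 1 / (a * b)) \<otimes> (x (a * b + a\<^sup>2) \<otimes> y (- 1 / a))))"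
      by (simp only: e2)
    also have "\<dots> = y (- 1 / b) \<otimes> (x (b\<^sup>2) \<otimes> (w (a * b) \<otimes> (x (a\<^sup>2) \<otimes> y (- 1 / a))))"
      by (simp add: Xadd Wx[of "a * b"] m_assoc)
    also have "w (a * b) \<otimes> (x (a\<^sup>2) \<otimes> y (- 1 / a)) = y (- 1 / b\<^sup>2) \<otimes> (x (a * b\<^sup>2) \<otimes> w (a * b))"
      using ab by (simp add: swapX WY power_mult_distrib) (simp add: power2_eq_square)
    also have "x (a * b\<^sup>2) = x (b\<^sup>2) \<otimes> x (- (b ^ 3))"
      by (simp only: e2(3)[symmetric] Xadd)
    also have "y (- 1 / b) \<otimes> (x (b\<^sup>2) \<otimes> (y (- 1 / b\<^sup>2) \<otimes> (x (b\<^sup>2) \<otimes> x (- (b ^ 3)) \<otimes> w (a * b)))) =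
        y (- 1 / b) \<otimes> (w (b\<^sup>2) \<otimes> (x (- (b ^ 3)) \<otimes> w (a * b)))"
      by (simp add: Wx[of "b\<^sup>2"] m_assoc)
    also have "\<dots> = y (- 1 / b) \<otimes> (y (1 / b) \<otimes> (w (b\<^sup>2) \<otimes> w (a * b)))"
    proof -
      have "b ^ 3 / (b\<^sup>2)\<^sup>2 = 1 / b" using ab by (simp add: field_simps eval_nat_numeral)
      then show ?thesis using ab by (simp add: swapX)
    qed
    also have "\<dots> = w (b\<^sup>2) \<otimes> w (a * b)" by (simp add: joinY Y0)
    finally show ?thesis .
  qed
  have prod: "w b \<otimes> (w (- 1) \<otimes> w a) = w (a * b)"
  proof -
    have "w b \<otimes> (w (- 1) \<otimes> w a) = w (- (b\<^sup>2)) \<otimes> (w b \<otimes> w a)"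
      using WW[of b "- 1"] ab by (simp add: m_assoc[symmetric])
    also have "\<dots> = w (a * b)" by (simp add: key Winv)
    finally show ?thesis .
  qed
  have dW: "d \<otimes> w u = w (a * u) \<otimes> d" for u
  proof -
    have eq: "d \<otimes> (x t \<otimes> z) = x (a * t) \<otimes> (d \<otimes> z)" "d \<otimes> (y t \<otimes> z) = y (t / a) \<otimes> (d \<otimes> z)"
      if "z \<in> carrier G" for t z
      using dX[of t] dY[of t] that by (simp_all add: m_assoc[symmetric])
    show ?thesis using ab by (simp add: Wx eq dX m_assoc) (simp add: field_simps)
  qed
  have "d \<otimes> (w b \<otimes> w (- 1)) = w (a * b) \<otimes> (w (- a) \<otimes> d)"
  proof -
    have "d \<otimes> (w b \<otimes> w (- 1)) = (d \<otimes> w b) \<otimes> w (- 1)" by (simp add: m_assoc)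
    also have "\<dots> = w (a * b) \<otimes> (d \<otimes> w (- 1))" by (simp add: dW m_assoc)
    also have "\<dots> = w (a * b) \<otimes> (w (- a) \<otimes> d)" by (simp add: dW)
    finally show ?thesis .
  qed
  also have "\<dots> = w b \<otimes> (w (- 1) \<otimes> (w a \<otimes> (w (- a) \<otimes> d)))"
    by (simp add: prod[symmetric] m_assoc)
  also have "w a \<otimes> (w (- a) \<otimes> d) = d" using Winv[of d "- a"] by simp
  finally show ?thesis by (simp add: m_assoc)
qed

text \<open>Quadruples stand for the matrices with rows (p, q) and (r, s), so that products are
  computed by rewriting. They are carried into the matrix groups by
  \<open>gl2_embed\<close>.\<close>

definition gl2 :: "('a::field \<times> 'a \<times> 'a \<times> 'a) monoid" where
  "gl2 = \<lparr>carrier = {(p, q, r, s). p * s - q * r \<noteq> 0},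
     monoid.mult = (\<lambda>(p, q, r, s) (p', q', r', s').
       (p * p' + q * r', p * q' + q * s', r * p' + s * r', r * q' + s * s')),
     one = (1, 0, 0, 1)\<rparr>"

lemma gl2_simps [simp]:
  "(p, q, r, s) \<otimes>\<^bsub>gl2\<^esub> (p', q', r', s') =
    (p * p' + q * r', p * q' + q * s', r * p' + s * r', r * q' + s * s')"
  "(p, q, r, s) \<in> carrier gl2 \<longleftrightarrow> p * s - q * r \<noteq> 0"
  "\<one>\<^bsub>gl2\<^esub> = (1, 0, 0, 1)"
  by (simp_all add: gl2_def)

lemma group_gl2: "group (gl2 :: ('a::field \<times> 'a \<times> 'a \<times> 'a) monoid)"
proof (rule groupI)
  fix x y z :: "'a \<times> 'a \<times> 'a \<times> 'a"
  obtain p q r s where x: "x = (p, q, r, s)" by (cases x)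
  obtain p' q' r' s' where y: "y = (p', q', r', s')" by (cases y)
  obtain p'' q'' r'' s'' where z: "z = (p'', q'', r'', s'')" by (cases z)
  show "x \<otimes>\<^bsub>gl2\<^esub> y \<otimes>\<^bsub>gl2\<^esub> z = x \<otimes>\<^bsub>gl2\<^esub> (y \<otimes>\<^bsub>gl2\<^esub> z)"
    by (simp add: x y z algebra_simps)
  show "\<one>\<^bsub>gl2\<^esub> \<otimes>\<^bsub>gl2\<^esub> x = x" by (simp add: x)
  {
    assume "x \<in> carrier gl2" "y \<in> carrier gl2"
    then have nz: "p * s - q * r \<noteq> 0" "p' * s' - q' * r' \<noteq> 0" by (simp_all add: x y)
    have "(p * p' + q * r') * (r * q' + s * s') - (p * q' + q * s') * (r * p' + s * r') =
      (p * s - q * r) * (p' * s' - q' * r')" by (simp add: algebra_simps)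
    then show "x \<otimes>\<^bsub>gl2\<^esub> y \<in> carrier gl2" using nz by (simp add: x y)
  }
  {
    assume "x \<in> carrier gl2"
    then have nz: "p * s - q * r \<noteq> 0" by (simp add: x)
    let ?D = "p * s - q * r"
    have "s / ?D * (p / ?D) - (- q / ?D) * (- r / ?D) = 1 / ?D"
    proof -
      have "s / ?D * (p / ?D) - (- q / ?D) * (- r / ?D) = (p * s - q * r) / (?D * ?D)"
        by (simp add: diff_divide_distrib mult.commute)
      then show ?thesis using nz by simp
    qed
    then have "(s / ?D, - q / ?D, - r / ?D, p / ?D) \<in> carrier gl2"
      using nz by (simp only: gl2_simps) simp
    moreover have "(s / ?D, - q / ?D, - r / ?D, p / ?D) \<otimes>\<^bsub>gl2\<^esub> x = \<one>\<^bsub>gl2\<^esub>"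
    proof -
      have "s / ?D * p + - q / ?D * r = ?D / ?D" "s / ?D * q + - q / ?D * s = 0 / ?D"
        "- r / ?D * p + p / ?D * r = 0 / ?D" "- r / ?D * q + p / ?D * s = ?D / ?D"
        by (simp_all only: times_divide_eq_left add_divide_distrib[symmetric])
           (simp_all add: algebra_simps)
      then show ?thesis using nz by (simp add: x)
    qed
    ultimately show "\<exists>y\<in>carrier gl2. y \<otimes>\<^bsub>gl2\<^esub> x = \<one>\<^bsub>gl2\<^esub>" by blast
  }
qed simp

section \<open>Commutators of lifts in a central extension\<close>

locale central_extension = E: group E + G: group G for E (structure) and G (structure) +
  fixes p :: "'a \<Rightarrow> 'c" and lift :: "'c \<Rightarrow> 'a"
  assumes p_hom: "p \<in> hom E G"
    and lift: "\<And>g. g \<in> carrier G \<Longrightarrow> lift g \<in> carrier E" "\<And>g. g \<in> carrier G \<Longrightarrow> p (lift g) = g"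
    and central: "\<And>z g. z \<in> carrier E \<Longrightarrow> p z = \<one>\<^bsub>G\<^esub> \<Longrightarrow> g \<in> carrier E \<Longrightarrow> z \<otimes> g = g \<otimes> z"
begin

lemma p_closed [simp]: "g \<in> carrier E \<Longrightarrow> p g \<in> carrier G"
  using p_hom by (rule hom_in_carrier)

lemma p_mult [simp]: "g \<in> carrier E \<Longrightarrow> h \<in> carrier E \<Longrightarrow> p (g \<otimes> h) = p g \<otimes>\<^bsub>G\<^esub> p h"
  using p_hom by (simp add: hom_mult)

lemma p_one [simp]: "p \<one> = \<one>\<^bsub>G\<^esub>"
  using p_hom by (rule hom_one) (unfold_locales)

lemma p_inv [simp]: "g \<in> carrier E \<Longrightarrow> p (inv g) = inv\<^bsub>G\<^esub> p g"
  using p_hom G.is_group E.is_group by (metis group_hom.hom_inv group_hom_axioms.intro group_hom.intro)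

definition comm :: "'a \<Rightarrow> 'a \<Rightarrow> 'a" where
  "comm g h = g \<otimes> h \<otimes> inv (h \<otimes> g)"

lemma comm_closed [simp]: "g \<in> carrier E \<Longrightarrow> h \<in> carrier E \<Longrightarrow> comm g h \<in> carrier E"
  by (simp add: comm_def)

lemma comm_eq: "g \<in> carrier E \<Longrightarrow> h \<in> carrier E \<Longrightarrow> g \<otimes> h = comm g h \<otimes> (h \<otimes> g)"
  using E.m_assoc[of "g \<otimes> h" "inv (h \<otimes> g)" "h \<otimes> g"] by (simp add: comm_def)

lemma comm_unique:
  assumes "g \<in> carrier E" "h \<in> carrier E" "c \<in> carrier E" "g \<otimes> h = c \<otimes> (h \<otimes> g)"
  shows "comm g h = c"
  using assms comm_eq[of g h] by (metis E.m_closed E.r_cancel comm_closed)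

lemma same_image:
  assumes "g \<in> carrier E" "g' \<in> carrier E" "p g = p g'"
  obtains z where "z \<in> carrier E" "g' = z \<otimes> g" "\<And>h. h \<in> carrier E \<Longrightarrow> z \<otimes> h = h \<otimes> z"
proof
  show "g' \<otimes> inv g \<in> carrier E" "g' = (g' \<otimes> inv g) \<otimes> g" using assms by (simp_all add: E.m_assoc)
  show "(g' \<otimes> inv g) \<otimes> h = h \<otimes> (g' \<otimes> inv g)" if "h \<in> carrier E" for h
    using assms that by (intro central) simp_all
qed

text \<open>Two lifts of the same element differ by a central factor, which cancels from the
  commutator.\<close>

lemma comm_indep:
  assumes c: "g \<in> carrier E" "g' \<in> carrier E" "h \<in> carrier E" "h' \<in> carrier E"
    and "p g = p g'" "p h = p h'"
  shows "comm g' h' = comm g h"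
proof (rule comm_unique)
  obtain z where z: "z \<in> carrier E" "g' = z \<otimes> g" "\<And>k. k \<in> carrier E \<Longrightarrow> z \<otimes> k = k \<otimes> z"
    using same_image[of g g'] assms by metis
  obtain y where y: "y \<in> carrier E" "h' = y \<otimes> h" "\<And>k. k \<in> carrier E \<Longrightarrow> y \<otimes> k = k \<otimes> y"
    using same_image[of h h'] assms by metis
  have "g' \<otimes> h' = z \<otimes> y \<otimes> (g \<otimes> h)"
  proof -
    have "g \<otimes> (y \<otimes> h) = y \<otimes> (g \<otimes> h)"
      using c(1,3) y(1) y(3) by (metis E.m_assoc)
    then show ?thesis using c z(1) y(1) by (simp add: z(2) y(2) E.m_assoc)
  qed
  also have "\<dots> = z \<otimes> y \<otimes> (comm g h \<otimes> (h \<otimes> g))" by (simp only: comm_eq[OF c(1,3), symmetric])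
  also have "\<dots> = comm g h \<otimes> (y \<otimes> (h \<otimes> (z \<otimes> g)))"
  proof -
    have "z \<otimes> y \<otimes> (comm g h \<otimes> (h \<otimes> g)) = z \<otimes> (y \<otimes> comm g h) \<otimes> (h \<otimes> g)"
      using c z(1) y(1) by (simp add: E.m_assoc)
    also have "\<dots> = (z \<otimes> (comm g h \<otimes> y \<otimes> h)) \<otimes> g"
      using c z(1) y(1) by (simp add: E.m_assoc y(3)[of "comm g h"])
    also have "z \<otimes> (comm g h \<otimes> y \<otimes> h) = (comm g h \<otimes> y \<otimes> h) \<otimes> z"
      using c y(1) by (intro z(3)) simp
    finally show ?thesis using c z(1) y(1) by (simp add: E.m_assoc)
  qed
  finally show "g' \<otimes> h' = comm g h \<otimes> (h' \<otimes> g')" using c z(1) y(1) by (simp add: z(2) y(2) E.m_assoc)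
qed (use assms in auto)

text \<open>Conjugating a commutator by \<open>k\<close> gives the commutator of the conjugates, and
  by independence of lifts these may be replaced by any \<open>g'\<close>, \<open>h'\<close> with
  the same images.\<close>

lemma comm_conj:
  assumes c: "k \<in> carrier E" "g \<in> carrier E" "g' \<in> carrier E" "h \<in> carrier E" "h' \<in> carrier E"
    and g: "p k \<otimes>\<^bsub>G\<^esub> p g = p g' \<otimes>\<^bsub>G\<^esub> p k" and h: "p k \<otimes>\<^bsub>G\<^esub> p h = p h' \<otimes>\<^bsub>G\<^esub> p k"
  shows "k \<otimes> comm g h = comm g' h' \<otimes> k"
proof -
  have im: "p (k \<otimes> g \<otimes> inv k) = p g'" "p (k \<otimes> h \<otimes> inv k) = p h'"
    using c by (simp_all add: g h G.m_assoc)
  have "comm (k \<otimes> g \<otimes> inv k) (k \<otimes> h \<otimes> inv k) = k \<otimes> comm g h \<otimes> inv k"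
  proof (rule comm_unique)
    have "k \<otimes> (g \<otimes> h) \<otimes> inv k = k \<otimes> (comm g h \<otimes> (h \<otimes> g)) \<otimes> inv k"
      by (simp only: comm_eq[OF c(2,4), symmetric])
    moreover have "inv k \<otimes> (k \<otimes> z) = z" if "z \<in> carrier E" for z
      using c that by (simp add: E.m_assoc[symmetric])
    ultimately show "k \<otimes> g \<otimes> inv k \<otimes> (k \<otimes> h \<otimes> inv k) =
      k \<otimes> comm g h \<otimes> inv k \<otimes> (k \<otimes> h \<otimes> inv k \<otimes> (k \<otimes> g \<otimes> inv k))"
      using c by (simp add: E.m_assoc)
  qed (use c in auto)
  then have "comm g' h' = k \<otimes> comm g h \<otimes> inv k"
    using comm_indep[of "k \<otimes> g \<otimes> inv k" g' "k \<otimes> h \<otimes> inv k" h'] c im by simp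
  then show ?thesis using c by (simp add: E.m_assoc)
qed

end

text \<open>The proof builds lifts of the root subgroups that satisfy the hypotheses of
  \<open>steinberg_relation_lift\<close>. Commutators are used as lifts because they do not depend
  on choices and transform correctly under conjugation, while \<open>unip\<close> makes them
  additive.\<close>

lemma gl2_extension_steinberg:
  fixes E :: "('e, 'm) monoid_scheme" (structure)
    and p :: "'e \<Rightarrow> 'f::field \<times> 'f \<times> 'f \<times> 'f"
  assumes ext: "central_extension E gl2 p lift"
    and unip: "\<And>u v s t. \<lbrakk>u \<in> carrier E; v \<in> carrier E; p u = (1, s, 0, 1); p v = (1, t, 0, 1)\<rbrakk>
      \<Longrightarrow> u \<otimes> v = v \<otimes> u"
    and ab: "a + b = 1" "a \<noteq> 0" "b \<noteq> 0"
    and d: "d \<in> carrier E" "p d = (a, 0, 0, 1)" and h: "h \<in> carrier E" "p h = (b, 0, 0, 1 / b)"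
  shows "d \<otimes> h = h \<otimes> d"
proof -
  interpret central_extension E gl2 p lift by (rule ext)
  have a1: "a - 1 \<noteq> 0" using ab by auto
  have pcancel: "p u = g" if "u \<in> carrier E" "v \<in> carrier E" "g \<in> carrier gl2"
    "p u \<otimes>\<^bsub>gl2\<^esub> p v = g \<otimes>\<^bsub>gl2\<^esub> p v" for u v g
    using that by simp
  define U where "U t = lift (1, t, 0, 1)" for t :: 'f
  have U [simp]: "U t \<in> carrier E" "p (U t) = (1, t, 0, 1)" for t
    by (simp_all add: U_def lift)
  \<comment> \<open>The commutator of diag(a,1) with a unipotent of parameter s has parameter (a -
    1) s, whence the division. The divisor is nonzero because b = 1 - a is.\<close>
  define x where "x t = comm d (U (t / (a - 1)))" for t
  have x [simp]: "x t \<in> carrier E" for t by (simp add: x_def d)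
  have px [simp]: "p (x t) = (1, t, 0, 1)" for t
  proof (rule pcancel)
    let ?s = "t / (a - 1)"
    have "p (x t \<otimes> (U ?s \<otimes> d)) = p (d \<otimes> U ?s)"
      using d comm_eq[of d "U ?s"] by (simp add: x_def)
    moreover have "t + ?s = a * ?s" using a1 by (simp add: field_simps)
    ultimately show "p (x t) \<otimes>\<^bsub>gl2\<^esub> p (U ?s \<otimes> d) = (1, t, 0, 1) \<otimes>\<^bsub>gl2\<^esub> p (U ?s \<otimes> d)"
      using d by (simp add: add.commute)
    show "U ?s \<otimes> d \<in> carrier E" using d by simp
  qed simp_all
  have diag_x: "k \<otimes> x t = x (m / n * t) \<otimes> k"
    if k: "k \<in> carrier E" "p k = (m, 0, 0, n)" and mn: "m \<noteq> 0" "n \<noteq> 0" for k m n t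
    unfolding x_def by (rule comm_conj) (use k d mn in \<open>simp_all add: mult.commute\<close>)
  have x_add: "x (s + t) = x s \<otimes> x t" for s t
  proof -
    let ?u = "U (s / (a - 1))" and ?v = "U (t / (a - 1))"
    have "x (s + t) = comm d (?u \<otimes> ?v)"
      unfolding x_def by (rule comm_indep) (use d in \<open>simp_all add: add_divide_distrib add.commute\<close>)
    also have "\<dots> = x s \<otimes> x t"
    proof (rule comm_unique)
      have "d \<otimes> (?u \<otimes> ?v) = (d \<otimes> ?u) \<otimes> ?v" using d by (simp add: E.m_assoc)
      also have "d \<otimes> ?u = x s \<otimes> (?u \<otimes> d)" using comm_eq[of d ?u] d by (simp add: x_def)
      also have "\<dots> \<otimes> ?v = x s \<otimes> (?u \<otimes> (d \<otimes> ?v))" using d by (simp add: E.m_assoc)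
      also have "d \<otimes> ?v = x t \<otimes> (?v \<otimes> d)" using comm_eq[of d ?v] d by (simp add: x_def)
      also have "?u \<otimes> (x t \<otimes> (?v \<otimes> d)) = (?u \<otimes> x t) \<otimes> (?v \<otimes> d)" using d by (simp add: E.m_assoc)
      also have "?u \<otimes> x t = x t \<otimes> ?u" by (rule unip[of _ _ "s / (a - 1)" t]) simp_all
      finally show "d \<otimes> (?u \<otimes> ?v) = x s \<otimes> x t \<otimes> (?u \<otimes> ?v \<otimes> d)" using d by (simp add: E.m_assoc)
    qed (use d in simp_all)
    finally show ?thesis .
  qed
  \<comment> \<open>A lift of the Weyl element carries the upper unipotents to the lower ones. The
    sign in the definition of \<open>y\<close> compensates for the sign of this conjugation.\<close>
  define \<omega> where "\<omega> = lift (0, 1, -1, 0)"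
  have \<omega> [simp]: "\<omega> \<in> carrier E" "p \<omega> = (0, 1, -1, 0)"
    by (simp_all add: \<omega>_def lift)
  have p_inv_\<omega>: "p (inv \<omega>) = (0, -1, 1, 0)"
    by (rule pcancel[of _ \<omega>]) (simp_all flip: p_mult)
  define y where "y t = \<omega> \<otimes> x (- t) \<otimes> inv \<omega>" for t
  have y [simp]: "y t \<in> carrier E" for t by (simp add: y_def)
  have \<omega>x: "\<omega> \<otimes> x t = y (- t) \<otimes> \<omega>" for t by (simp add: y_def E.m_assoc)
  have py [simp]: "p (y t) = (1, 0, t, 1)" for t
    by (simp add: y_def p_inv_\<omega> del: p_inv)
  have cancel: "inv \<omega> \<otimes> (\<omega> \<otimes> z) = z" "\<omega> \<otimes> (inv \<omega> \<otimes> z) = z" if "z \<in> carrier E" for z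
    using that by (simp_all add: E.m_assoc[symmetric])
  have y_add: "y (s + t) = y s \<otimes> y t" for s t
    using x_add[of "- s" "- t"] by (simp add: y_def E.m_assoc cancel)
  have diag_y: "k \<otimes> y t = y (n / m * t) \<otimes> k"
    if k: "k \<in> carrier E" "p k = (m, 0, 0, n)" and mn: "m \<noteq> 0" "n \<noteq> 0" for k m n t
  proof -
    have "inv \<omega> \<otimes> k \<otimes> \<omega> \<otimes> x (- t) = x (n / m * - t) \<otimes> (inv \<omega> \<otimes> k \<otimes> \<omega>)"
      by (rule diag_x) (use k mn in \<open>simp_all add: p_inv_\<omega> del: p_inv\<close>)
    then have "\<omega> \<otimes> (inv \<omega> \<otimes> k \<otimes> \<omega> \<otimes> x (- t)) \<otimes> inv \<omega> = \<omega> \<otimes> (x (n / m * - t) \<otimes> (inv \<omega> \<otimes> k \<otimes> \<omega>)) \<otimes> inv \<omega>"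
      by simp
    then show ?thesis using k by (simp add: y_def E.m_assoc cancel)
  qed
  \<comment> \<open>An antidiagonal element times the inverse of \<omega> is diagonal, which reduces
    the claim to \<open>diag_y\<close>.\<close>
  have anti_x: "k \<otimes> x t = y (r / q * t) \<otimes> k"
    if k: "k \<in> carrier E" "p k = (0, q, r, 0)" and qr: "q \<noteq> 0" "r \<noteq> 0" for k q r t
  proof -
    have "k \<otimes> inv \<omega> \<otimes> y (- t) = y (- r / q * - t) \<otimes> (k \<otimes> inv \<omega>)"
      by (rule diag_y) (use k qr in \<open>simp_all add: p_inv_\<omega> del: p_inv\<close>)
    then have "k \<otimes> inv \<omega> \<otimes> y (- t) \<otimes> \<omega> = y (- r / q * - t) \<otimes> (k \<otimes> inv \<omega>) \<otimes> \<omega>" by simp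
    then show ?thesis using k by (simp add: E.m_assoc cancel \<omega>x[symmetric])
  qed
  have anti_y: "k \<otimes> y t = x (q / r * t) \<otimes> k"
    if k: "k \<in> carrier E" "p k = (0, q, r, 0)" and qr: "q \<noteq> 0" "r \<noteq> 0" for k q r t
  proof -
    have "k \<otimes> \<omega> \<otimes> x (- t) = x (- q / r * - t) \<otimes> (k \<otimes> \<omega>)"
      by (rule diag_x) (use k qr in simp_all)
    then have "k \<otimes> \<omega> \<otimes> x (- t) \<otimes> inv \<omega> = x (- q / r * - t) \<otimes> (k \<otimes> \<omega>) \<otimes> inv \<omega>" by simp
    then show ?thesis using k by (simp add: y_def E.m_assoc)
  qed
  define w where "w u = x u \<otimes> y (- 1 / u) \<otimes> x u" for u
  have w [simp]: "w u \<in> carrier E" for u by (simp add: w_def)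
  have pw: "p (w u) = (0, u, - 1 / u, 0)" if "u \<noteq> 0" for u
    using that by (simp add: w_def)
  have "d \<otimes> (w b \<otimes> w (- 1)) = (w b \<otimes> w (- 1)) \<otimes> d"
  proof (rule E.steinberg_relation_lift[of x y w d a b])
    show "w u = x u \<otimes> y (- 1 / u) \<otimes> x u" for u by (rule w_def)
    show "w u \<otimes> x t = y (- t / u\<^sup>2) \<otimes> w u" if "u \<noteq> 0" for u t
      using anti_x[OF w pw[OF that], of t] that by (simp add: power2_eq_square)
    show "w u \<otimes> y t = x (- t * u\<^sup>2) \<otimes> w u" if "u \<noteq> 0" for u t
      using anti_y[OF w pw[OF that], of t] that by (simp add: power2_eq_square mult.commute mult.left_commute)
    show "d \<otimes> x t = x (a * t) \<otimes> d" for t using diag_x[OF d, of t] ab by simp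
    show "d \<otimes> y t = y (t / a) \<otimes> d" for t using diag_y[OF d, of t] ab by simp
  qed (use d ab x_add y_add in simp_all)
  then have "comm d (w b \<otimes> w (- 1)) = \<one>"
    using d by (intro comm_unique) simp_all
  \<comment> \<open>The product w(b) w(-1) lies over diag(b, 1/b), as \<open>h\<close> does.\<close>
  moreover have "comm d (w b \<otimes> w (- 1)) = comm d h"
    by (rule comm_indep) (use d h ab in \<open>simp_all add: pw\<close>)
  ultimately show ?thesis using comm_eq[of d h] d h by simp
qed

section \<open>Cosets of additive subgroups and the extension given by the universal cocycle\<close>

lemma add_coset_eq_iff:
  fixes M (structure) and c c' :: "'a::ab_group_add"
  assumes H: "add_subgroup H" and mult: "\<And>x y. x \<otimes> y = x + y"
  shows "H #> c = H #> c' \<longleftrightarrow> c - c' \<in> H"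
proof
  assume "H #> c = H #> c'"
  moreover have "0 + c \<in> H #> c" using add_subgroup_zero[OF H] by (force simp: r_coset_def mult)
  ultimately obtain h where "h \<in> H" "c = h + c'" by (auto simp: r_coset_def mult)
  then show "c - c' \<in> H" by simp
next
  have sub: "H #> x \<subseteq> H #> y" if "x - y \<in> H" for x y
  proof
    fix z assume "z \<in> H #> x"
    then obtain h where h: "h \<in> H" "z = h + x" by (auto simp: r_coset_def mult)
    have "h + (x - y) \<in> H" using H h(1) that by (rule add_subgroup_add)
    moreover have "z = (h + (x - y)) + y" by (simp add: h)
    ultimately show "z \<in> H #> y" unfolding r_coset_def mult by blast
  qed
  assume "c - c' \<in> H"
  moreover from this have "c' - c \<in> H" using add_subgroup_minus[OF H] by fastforce
  ultimately show "H #> c = H #> c'" using sub by blast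
qed

lemma add_coset_mult:
  fixes M (structure) and c c' :: "'a::ab_group_add"
  assumes H: "add_subgroup H" and mult: "\<And>x y. x \<otimes> y = x + y"
  shows "(H #> c) <#> (H #> c') = H #> (c + c')"
proof
  show "(H #> c) <#> (H #> c') \<subseteq> H #> (c + c')"
  proof
    fix z assume "z \<in> (H #> c) <#> (H #> c')"
    then obtain h h' where "h \<in> H" "h' \<in> H" "z = (h + h') + (c + c')"
      by (auto simp: set_mult_def r_coset_def mult algebra_simps)
    then show "z \<in> H #> (c + c')" using add_subgroup_add[OF H] by (auto simp: r_coset_def mult)
  qed
  show "H #> (c + c') \<subseteq> (H #> c) <#> (H #> c')"
  proof
    fix z assume "z \<in> H #> (c + c')"
    then obtain h where "h \<in> H" "z = (h + c) + (0 + c')"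
      by (auto simp: r_coset_def mult algebra_simps)
    then show "z \<in> (H #> c) <#> (H #> c')"
      unfolding set_mult_def r_coset_def mult using add_subgroup_zero[OF H] by blast
  qed
qed

lemma subgroup_add:
  assumes "group M" "add_subgroup H" "H \<subseteq> carrier M" "\<And>x y. x \<otimes>\<^bsub>M\<^esub> y = x + y"
    "\<And>x. x \<in> carrier M \<Longrightarrow> inv\<^bsub>M\<^esub> x = - x"
  shows "subgroup H M"
  using assms by (intro group.subgroupI) (auto simp: add_subgroup_minus add_subgroup_add subset_iff dest: add_subgroup_zero)

lemma tail_word_closed:
  assumes "\<And>a b. a \<in> S \<Longrightarrow> b \<in> S \<Longrightarrow> a \<otimes>\<^bsub>G\<^esub> b \<in> S" "a \<in> S" "w \<in> tuples S n"
  shows "tail_word G a w \<in> chains_over S n"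
  using assms(2,3)
proof (induction w arbitrary: a n)
  case (Cons b w)
  then obtain m where "n = Suc m" "w \<in> tuples S m" "b \<in> S" by (cases n) (auto simp: tuples_def)
  then show ?case
    using Cons assms(1)
    by (auto intro!: add_subgroup_diff[OF add_subgroup_chains] cons_chain_closed simp: tuples_def)
qed (simp add: tuples_def)

lemma bar_boundary_closed:
  assumes "\<And>a b. a \<in> S \<Longrightarrow> b \<in> S \<Longrightarrow> a \<otimes>\<^bsub>G\<^esub> b \<in> S" "c \<in> chains_over S (Suc n)"
  shows "bar_boundary G c \<in> chains_over S n"
proof -
  have "Poly_Mapping.keys c \<subseteq> tuples S (Suc n)" using assms(2) by (simp add: chains_over_def)
  then show ?thesis
  proof (induction c rule: frag_induction)
    case (one w)
    then obtain a v where "w = a # v" "a \<in> S" "v \<in> tuples S n"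
      by (cases w) (auto simp: tuples_def)
    then show ?case
      using tail_word_closed[OF assms(1)] by (auto intro!: add_subgroup_diff[OF add_subgroup_chains])
  qed (auto simp: chain_ops_diff add_subgroup_zero add_subgroup_diff add_subgroup_chains)
qed

text \<open>The classes \<open>[g|h]\<close> modulo boundaries form the universal 2-cocycle of \<open>G\<close>: its cocycle
  identity is the boundary of \<open>[g|h|k]\<close>. In the resulting central extension, lifts of pairwise_commuting
  elements \<open>g\<close>, \<open>h\<close> commute if and only if \<open>\<^bold>c(g, h) = 0\<close>.\<close>

definition cocycle_quotient :: "('g, 'm) monoid_scheme \<Rightarrow> ('g list \<Rightarrow>\<^sub>0 int) set monoid" where
  "cocycle_quotient G = bar_chains G 2 Mod bar_boundaries G 2"

definition cocycle :: "('g, 'm) monoid_scheme \<Rightarrow> 'g \<Rightarrow> 'g \<Rightarrow> ('g list \<Rightarrow>\<^sub>0 int) set" where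
  "cocycle G g h = bar_boundaries G 2 #>\<^bsub>bar_chains G 2\<^esub> frag_of [g, h]"

text \<open>The coefficients are all 2-chains modulo boundaries, since a single symbol
  \<open>[g|h]\<close> need not be a cycle. The cocycle is not normalized, so the unit carries the
  inverse of its value at the pair of identities.\<close>

definition universal_extension ::
    "('g, 'm) monoid_scheme \<Rightarrow> (('g list \<Rightarrow>\<^sub>0 int) set \<times> 'g) monoid" where
  "universal_extension G = \<lparr>carrier = carrier (cocycle_quotient G) \<times> carrier G,
     monoid.mult = (\<lambda>(\<alpha>, g) (\<beta>, h).
       (\<alpha> \<otimes>\<^bsub>cocycle_quotient G\<^esub> \<beta> \<otimes>\<^bsub>cocycle_quotient G\<^esub> cocycle G g h, g \<otimes>\<^bsub>G\<^esub> h)),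
     one = (inv\<^bsub>cocycle_quotient G\<^esub> cocycle G \<one>\<^bsub>G\<^esub> \<one>\<^bsub>G\<^esub>, \<one>\<^bsub>G\<^esub>)\<rparr>"

lemma bar_chains_mult [simp]: "x \<otimes>\<^bsub>bar_chains G n\<^esub> y = x + y"
  by (simp add: bar_chains_def)

lemma (in group) comm_group_cocycle_quotient: "comm_group (cocycle_quotient G)"
proof -
  have sub: "bar_boundaries G 2 \<subseteq> carrier (bar_chains G 2)"
    unfolding bar_boundaries_eq carrier_bar_chains boundaries_def
    by (auto intro: bar_boundary_closed)
  have "subgroup (bar_boundaries G 2) (bar_chains G 2)"
    using sub by (intro subgroup_add) (auto simp: bar_chains_def add_subgroup_bar_boundaries)
  then show ?thesis
    unfolding cocycle_quotient_def bar_chains_def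
    by (intro comm_group.abelian_FactGroup abelian_free_Abelian_group)
qed

lemma (in group) cocycle_closed:
  "g \<in> carrier G \<Longrightarrow> h \<in> carrier G \<Longrightarrow> cocycle G g h \<in> carrier (cocycle_quotient G)"
  by (auto simp: cocycle_def cocycle_quotient_def FactGroup_def RCOSETS_def carrier_bar_chains tuples_def)

lemma (in group) cocycle_identity:
  assumes "g \<in> carrier G" "h \<in> carrier G" "k \<in> carrier G"
  shows "cocycle G g h \<otimes>\<^bsub>cocycle_quotient G\<^esub> cocycle G (g \<otimes> h) k =
    cocycle G h k \<otimes>\<^bsub>cocycle_quotient G\<^esub> cocycle G g (h \<otimes> k)"
proof -
  have "frag_of [g, h, k] \<in> chains_over (carrier G) 3"
    using assms by (simp add: tuples_def)
  then have "bar_boundary G (frag_of [g, h, k]) \<in> bar_boundaries G 2"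
    by (simp add: bar_boundaries_eq boundaries_def numeral_3_eq_3 numeral_2_eq_2 del: bar_boundary_Cons)
  then have "(frag_of [h, k] + frag_of [g, h \<otimes> k]) - (frag_of [g, h] + frag_of [g \<otimes> h, k]) \<in> bar_boundaries G 2"
    by (simp add: chain_ops_linear algebra_simps)
  then have "bar_boundaries G 2 #>\<^bsub>bar_chains G 2\<^esub> (frag_of [h, k] + frag_of [g, h \<otimes> k]) =
      bar_boundaries G 2 #>\<^bsub>bar_chains G 2\<^esub> (frag_of [g, h] + frag_of [g \<otimes> h, k])"
    by (subst add_coset_eq_iff[OF add_subgroup_bar_boundaries]) simp_all
  then show ?thesis
    by (simp add: cocycle_def cocycle_quotient_def FactGroup_def
        add_coset_mult[OF add_subgroup_bar_boundaries])
qed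

lemma (in group) universal_extension:
  shows "central_extension (universal_extension G) G snd (\<lambda>g. (\<one>\<^bsub>cocycle_quotient G\<^esub>, g))"
proof -
  let ?A = "cocycle_quotient G" and ?f = "cocycle G" and ?E = "universal_extension G"
  interpret A: comm_group ?A by (rule comm_group_cocycle_quotient)
  note f = cocycle_closed
  have E: "(\<alpha>, g) \<otimes>\<^bsub>?E\<^esub> (\<beta>, h) = (\<alpha> \<otimes>\<^bsub>?A\<^esub> \<beta> \<otimes>\<^bsub>?A\<^esub> ?f g h, g \<otimes> h)"
    "(\<alpha>, g) \<in> carrier ?E \<longleftrightarrow> \<alpha> \<in> carrier ?A \<and> g \<in> carrier G"
    "\<one>\<^bsub>?E\<^esub> = (inv\<^bsub>?A\<^esub> ?f \<one> \<one>, \<one>)" for \<alpha> g \<beta> h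
    by (simp_all add: universal_extension_def)
  \<comment> \<open>Degenerate instances of the cocycle identity, at (1, 1, g) and (g, 1, 1),
    replace normalization.\<close>
  have f1: "?f \<one> g = ?f \<one> \<one>" "?f g \<one> = ?f \<one> \<one>" if "g \<in> carrier G" for g
    using cocycle_identity[of \<one> \<one> g] cocycle_identity[of g \<one> \<one>] that f[of g \<one>] f[of \<one> g] f[of \<one> \<one>]
    by simp_all
  have grp: "group ?E"
  proof (rule groupI)
    fix u v z assume uvz: "u \<in> carrier ?E" "v \<in> carrier ?E" "z \<in> carrier ?E"
    obtain \<alpha> g \<beta> h \<gamma> k where eq: "u = (\<alpha>, g)" "v = (\<beta>, h)" "z = (\<gamma>, k)"
      by (metis surj_pair)
    then have c: "\<alpha> \<in> carrier ?A" "\<beta> \<in> carrier ?A" "\<gamma> \<in> carrier ?A" "g \<in> carrier G" "h \<in> carrier G" "k \<in> carrier G"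
      using uvz by (auto simp: E)
    have "\<alpha> \<otimes>\<^bsub>?A\<^esub> \<beta> \<otimes>\<^bsub>?A\<^esub> ?f g h \<otimes>\<^bsub>?A\<^esub> \<gamma> \<otimes>\<^bsub>?A\<^esub> ?f (g \<otimes> h) k =
      \<alpha> \<otimes>\<^bsub>?A\<^esub> \<beta> \<otimes>\<^bsub>?A\<^esub> \<gamma> \<otimes>\<^bsub>?A\<^esub> (?f g h \<otimes>\<^bsub>?A\<^esub> ?f (g \<otimes> h) k)"
      using c f by (simp add: A.m_ac)
    also have "\<dots> = \<alpha> \<otimes>\<^bsub>?A\<^esub> (\<beta> \<otimes>\<^bsub>?A\<^esub> \<gamma> \<otimes>\<^bsub>?A\<^esub> ?f h k) \<otimes>\<^bsub>?A\<^esub> ?f g (h \<otimes> k)"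
      using c f by (simp add: A.m_ac cocycle_identity)
    finally show "u \<otimes>\<^bsub>?E\<^esub> v \<otimes>\<^bsub>?E\<^esub> z = u \<otimes>\<^bsub>?E\<^esub> (v \<otimes>\<^bsub>?E\<^esub> z)"
      using c by (simp add: E eq m_assoc)
  next
    fix u assume u: "u \<in> carrier ?E"
    obtain \<alpha> g where eq: "u = (\<alpha>, g)" by (cases u)
    then have c: "\<alpha> \<in> carrier ?A" "g \<in> carrier G" using u by (auto simp: E)
    have "inv\<^bsub>?A\<^esub> ?f \<one> \<one> \<otimes>\<^bsub>?A\<^esub> \<alpha> \<otimes>\<^bsub>?A\<^esub> ?f \<one> \<one> = \<alpha>"
      using c(1) f[of \<one> \<one>] A.m_comm[of "inv\<^bsub>?A\<^esub> ?f \<one> \<one>" \<alpha>] by (simp add: A.m_assoc)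
    then show "\<one>\<^bsub>?E\<^esub> \<otimes>\<^bsub>?E\<^esub> u = u" using c by (simp add: E eq f1[OF c(2)])
    let ?v = "(inv\<^bsub>?A\<^esub> ?f \<one> \<one> \<otimes>\<^bsub>?A\<^esub> inv\<^bsub>?A\<^esub> (\<alpha> \<otimes>\<^bsub>?A\<^esub> ?f (inv g) g), inv g)"
    have fc: "?f (inv g) g \<in> carrier ?A" "?f \<one> \<one> \<in> carrier ?A" using c f by auto
    have "inv\<^bsub>?A\<^esub> ?f \<one> \<one> \<otimes>\<^bsub>?A\<^esub> inv\<^bsub>?A\<^esub> (\<alpha> \<otimes>\<^bsub>?A\<^esub> ?f (inv g) g) \<otimes>\<^bsub>?A\<^esub> \<alpha> \<otimes>\<^bsub>?A\<^esub> ?f (inv g) g =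
      inv\<^bsub>?A\<^esub> ?f \<one> \<one>"
      using c fc by (simp add: A.m_assoc)
    then have "?v \<otimes>\<^bsub>?E\<^esub> u = \<one>\<^bsub>?E\<^esub>"
      using c by (simp add: E eq)
    moreover have "?v \<in> carrier ?E" using c fc by (simp add: E)
    ultimately show "\<exists>v\<in>carrier ?E. v \<otimes>\<^bsub>?E\<^esub> u = \<one>\<^bsub>?E\<^esub>" by blast
  qed (auto simp: universal_extension_def cocycle_closed)
  show ?thesis
  proof (intro central_extension.intro central_extension_axioms.intro grp is_group)
    show "snd \<in> hom ?E G" by (auto simp: hom_def universal_extension_def)
    show "z \<otimes>\<^bsub>?E\<^esub> g = g \<otimes>\<^bsub>?E\<^esub> z" if zg: "z \<in> carrier ?E" "snd z = \<one>" "g \<in> carrier ?E" for z g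
    proof -
      obtain \<zeta> \<alpha> k where eq: "z = (\<zeta>, \<one>)" "g = (\<alpha>, k)"
        using zg(2) by (metis prod.collapse)
      then have c: "\<zeta> \<in> carrier ?A" "\<alpha> \<in> carrier ?A" "k \<in> carrier G" using zg by (auto simp: E)
      then show ?thesis by (simp add: eq E f1[OF c(3)] A.m_comm[of \<zeta> \<alpha>])
    qed
  qed (auto simp: universal_extension_def)
qed

text \<open>The first components commute and cancel, so what remains is the comparison of the
  cocycle at (g, h) and (h, g). The difference of their representatives is exactly the chain
  \<open>[g|h] - [h|g]\<close>.\<close>

lemma (in group) comm_chain_eq_zero_iff:
  assumes u: "(\<alpha>, g) \<in> carrier (universal_extension G)" and v: "(\<beta>, h) \<in> carrier (universal_extension G)"
    and gh: "g \<otimes> h = h \<otimes> g"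
  shows "(\<alpha>, g) \<otimes>\<^bsub>universal_extension G\<^esub> (\<beta>, h) = (\<beta>, h) \<otimes>\<^bsub>universal_extension G\<^esub> (\<alpha>, g) \<longleftrightarrow>
    comm_chain [g, h] \<in> bar_boundaries G 2"
proof -
  let ?A = "cocycle_quotient G"
  interpret A: comm_group ?A by (rule comm_group_cocycle_quotient)
  have c: "\<alpha> \<in> carrier ?A" "\<beta> \<in> carrier ?A" "g \<in> carrier G" "h \<in> carrier G"
    using u v by (auto simp: universal_extension_def)
  have "(\<alpha>, g) \<otimes>\<^bsub>universal_extension G\<^esub> (\<beta>, h) = (\<beta>, h) \<otimes>\<^bsub>universal_extension G\<^esub> (\<alpha>, g) \<longleftrightarrow>
    \<alpha> \<otimes>\<^bsub>?A\<^esub> \<beta> \<otimes>\<^bsub>?A\<^esub> cocycle G g h = \<alpha> \<otimes>\<^bsub>?A\<^esub> \<beta> \<otimes>\<^bsub>?A\<^esub> cocycle G h g"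
    using gh A.m_comm[of \<alpha> \<beta>] c by (simp add: universal_extension_def)
  also have "\<dots> \<longleftrightarrow> cocycle G g h = cocycle G h g"
    using c by (simp add: cocycle_closed)
  also have "\<dots> \<longleftrightarrow> comm_chain [g, h] \<in> bar_boundaries G 2"
    by (simp add: cocycle_def add_coset_eq_iff[OF add_subgroup_bar_boundaries])
  finally show ?thesis .
qed

text \<open>Conjugation by diag(t,1) divides both parameters by t. Together with antisymmetry this
  makes the pairing with \<open>x 1\<close> odd under inversion, so it vanishes. The same scaling
  reduces every nonzero second parameter to 1, and the parameter 0 is handled by additivity.\<close>

lemma gl2_unipotents:
  fixes s t :: "'f::field"
  assumes inf: "infinite (UNIV :: 'f set)"
  shows "comm_chain [(1, s, 0, 1), (1, t, 0, 1)] \<in> bar_boundaries (gl2 :: ('f \<times> 'f \<times> 'f \<times> 'f) monoid) 2"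
proof -
  let ?G = "gl2 :: ('f \<times> 'f \<times> 'f \<times> 'f) monoid"
  let ?N = "bar_boundaries ?G 2"
  interpret G: group ?G by (rule group_gl2)
  have N: "add_subgroup ?N" by (rule add_subgroup_bar_boundaries)
  define x :: "'f \<Rightarrow> 'f \<times> 'f \<times> 'f \<times> 'f" where "x t = (1, t, 0, 1)" for t
  have xc: "range x \<subseteq> carrier ?G" by (auto simp: x_def)
  have xmult: "x s \<otimes>\<^bsub>?G\<^esub> x t = x (s + t)" for s t by (simp add: x_def add.commute)
  have comm: "pairwise_commuting ?G (range x)" by (auto simp: pairwise_commuting_def xmult add.commute)
  have scale: "comm_chain [x (s / t), x (r / t)] - comm_chain [x s, x r] \<in> ?N" if t: "t \<noteq> 0" for s r t
  proof -
    let ?d = "(t, 0, 0, 1) :: 'f \<times> 'f \<times> 'f \<times> 'f" and ?d' = "(1 / t, 0, 0, 1) :: 'f \<times> 'f \<times> 'f \<times> 'f"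
    let ?\<phi> = "\<lambda>g. ?d' \<otimes>\<^bsub>?G\<^esub> g \<otimes>\<^bsub>?G\<^esub> ?d"
    have \<phi>: "?\<phi> (x s) = x (s / t)" for s using t by (simp add: x_def)
    have "comm_chain (map ?\<phi> [x s, x r]) - comm_chain [x s, x r] \<in> boundaries ?G (carrier ?G) (length [x s, x r])"
    proof (rule comm_chain_conj[where g = ?d])
      show "pairwise_commuting ?G (set [x s, x r])" by (rule pairwise_commuting_subset[OF comm]) auto
      show "?d \<in> carrier ?G" "set [x s, x r] \<subseteq> carrier ?G" "?\<phi> ` set [x s, x r] \<subseteq> carrier ?G"
        using t xc by (auto simp only: list.set image_insert image_empty \<phi>) (auto simp: x_def)
      show "?\<phi> (a \<otimes>\<^bsub>?G\<^esub> b) = ?\<phi> a \<otimes>\<^bsub>?G\<^esub> ?\<phi> b" if ab: "a \<in> set [x s, x r]" "b \<in> set [x s, x r]" for a b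
      proof -
        from ab obtain s' t' where "a = x s'" "b = x t'" by auto
        then show ?thesis by (simp only: xmult \<phi> add_divide_distrib)
      qed
      show "?d \<otimes>\<^bsub>?G\<^esub> ?\<phi> a = a \<otimes>\<^bsub>?G\<^esub> ?d" if "a \<in> set [x s, x r]" for a
        using that t by (auto simp: x_def)
    qed
    then show ?thesis by (simp only: list.map \<phi> bar_boundaries_eq) (simp add: numeral_2_eq_2)
  qed
  have add: "comm_chain [x (s + t), x r] - comm_chain [x s, x r] - comm_chain [x t, x r] \<in> ?N" for s t r
    using comm_chain_mult[OF comm, of "[]" "[x r]" "x s" "x t"] boundaries_mono[OF xc, of ?G 2]
    by (auto simp: xmult bar_boundaries_eq numeral_2_eq_2)
  have one: "comm_chain [x s, x 1] \<in> ?N" for s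
  proof (rule additive_inversion_odd_vanishes[OF inf N, where f = "\<lambda>s. comm_chain [x s, x 1]"])
    show "comm_chain [x (s + t), x 1] - comm_chain [x s, x 1] - comm_chain [x t, x 1] \<in> ?N" for s t
      by (rule add)
    show "comm_chain [x (1 / t), x 1] + comm_chain [x t, x 1] \<in> ?N" if "t \<noteq> 0" for t
      using scale[OF that, of 1 t] that comm_chain_swap[of "[]" "x 1" "x t" "[]"]
      by (simp del: comm_chain_simps)
  qed
  have nz: "comm_chain [x s, x t] \<in> ?N" if "t \<noteq> 0" for s t
  proof -
    have "comm_chain [x (s / t), x 1] - (comm_chain [x (s / t), x (t / t)] - comm_chain [x s, x t]) \<in> ?N"
      by (rule add_subgroup_diff[OF N one scale[OF that]])
    then show ?thesis using that by (simp del: comm_chain_simps)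
  qed
  have "comm_chain [x s, x t] \<in> ?N"
  proof (cases "t = 0")
    case True
    have "comm_chain [x s, x 0] = - comm_chain [x 0, x s]"
      using comm_chain_swap[of "[]" "x s" "x 0" "[]"] by (simp only: append_Nil)
    moreover have "comm_chain [x 0, x s] \<in> ?N"
      using add[of 0 0 s] by (simp add: add_subgroup_minus_iff[OF N] del: comm_chain_simps)
    ultimately show ?thesis using True add_subgroup_minus[OF N] by (simp del: comm_chain_simps)
  qed (rule nz)
  then show ?thesis by (simp only: x_def)
qed

lemma gl2_steinberg:
  fixes a b :: "'f::field"
  assumes inf: "infinite (UNIV :: 'f set)" and ab: "a + b = 1" "a \<noteq> 0" "b \<noteq> 0"
  shows "comm_chain [(a, 0, 0, 1), (b, 0, 0, 1 / b)] \<in> bar_boundaries gl2 2"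
proof -
  interpret G: group "gl2 :: ('f \<times> 'f \<times> 'f \<times> 'f) monoid" by (rule group_gl2)
  let ?E = "universal_extension (gl2 :: ('f \<times> 'f \<times> 'f \<times> 'f) monoid)"
  let ?l = "\<lambda>g. (\<one>\<^bsub>cocycle_quotient (gl2 :: ('f \<times> 'f \<times> 'f \<times> 'f) monoid)\<^esub>, g)"
  interpret central_extension ?E gl2 snd ?l by (rule G.universal_extension)
  have "?l (a, 0, 0, 1) \<otimes>\<^bsub>?E\<^esub> ?l (b, 0, 0, 1 / b) = ?l (b, 0, 0, 1 / b) \<otimes>\<^bsub>?E\<^esub> ?l (a, 0, 0, 1)"
  proof (rule gl2_extension_steinberg[OF G.universal_extension _ ab])
    fix u v s t assume uv: "u \<in> carrier ?E" "v \<in> carrier ?E" "snd u = (1, s, 0, 1)" "snd v = (1, t, 0, 1)"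
    have eq: "u = (fst u, (1, s, 0, 1))" "v = (fst v, (1, t, 0, 1))" using uv by (metis prod.collapse)+
    have m: "(fst u, (1, s, 0, 1)) \<in> carrier ?E" "(fst v, (1, t, 0, 1)) \<in> carrier ?E"
      using uv(1,2) eq by metis+
    have "(fst u, (1, s, 0, 1)) \<otimes>\<^bsub>?E\<^esub> (fst v, (1, t, 0, 1)) = (fst v, (1, t, 0, 1)) \<otimes>\<^bsub>?E\<^esub> (fst u, (1, s, 0, 1))"
      using G.comm_chain_eq_zero_iff[of "fst u" "(1, s, 0, 1)" "fst v" "(1, t, 0, 1)"]
        m gl2_unipotents[OF inf, of s t]
      by (simp add: add.commute del: comm_chain_simps)
    then show "u \<otimes>\<^bsub>?E\<^esub> v = v \<otimes>\<^bsub>?E\<^esub> u" using eq by metis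
  qed (use ab in \<open>auto intro!: lift\<close>)
  then show ?thesis
    using ab by (subst (asm) G.comm_chain_eq_zero_iff) (auto intro!: lift simp del: comm_chain_simps)
qed

section \<open>Chains of diagonal matrices\<close>

lemma GL_mult [simp]: "A \<otimes>\<^bsub>GL TYPE('a::field) n\<^esub> B = A * B"
  by (simp add: GL_def units_of_def ring_mat_simps)

lemma GL_one [simp]: "\<one>\<^bsub>GL TYPE('a::field) n\<^esub> = 1\<^sub>m n"
  by (simp add: GL_def units_of_def ring_mat_simps)

lemma GL_carrier_iff:
  "A \<in> carrier (GL TYPE('a::field) n) \<longleftrightarrow>
    A \<in> carrier_mat n n \<and> (\<exists>B\<in>carrier_mat n n. A * B = 1\<^sub>m n \<and> B * A = 1\<^sub>m n)"
  by (auto simp: GL_def units_of_def Units_def ring_mat_simps)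

definition torus :: "nat \<Rightarrow> 'a::field mat set" where
  "torus n = {mat_diag n d | d. \<forall>j. d j \<noteq> 0}"

lemma torus_subset: "torus n \<subseteq> carrier (GL TYPE('a::field) n)"
proof
  fix A :: "'a mat" assume "A \<in> torus n"
  then obtain d where d: "A = mat_diag n d" "\<And>j. d j \<noteq> 0" by (auto simp: torus_def)
  then have "A * mat_diag n (\<lambda>j. inverse (d j)) = 1\<^sub>m n" "mat_diag n (\<lambda>j. inverse (d j)) * A = 1\<^sub>m n"
    by simp_all
  then show "A \<in> carrier (GL TYPE('a) n)"
    unfolding GL_carrier_iff using d(1) mat_diag_dim by blast
qed

lemma pairwise_commuting_torus: "pairwise_commuting (GL TYPE('a::field) n) (torus n)"
  by (auto simp: pairwise_commuting_def torus_def mult.commute)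

text \<open>The cocharacter of the diagonal torus with exponent vector \<open>e\<close>, evaluated
  at \<open>a\<close>. It is multiplicative in \<open>a\<close> and turns sums of exponent vectors
  into products, so both become linear in a slot of a commuting class.\<close>

definition diag_pow :: "nat \<Rightarrow> (nat \<Rightarrow> int) \<Rightarrow> 'a::field \<Rightarrow> 'a mat" where
  "diag_pow n e a = mat_diag n (\<lambda>j. a powi e j)"

lemma diag_pow_torus: "a \<noteq> 0 \<Longrightarrow> diag_pow n e a \<in> torus n"
  by (auto simp: diag_pow_def torus_def)

lemma diag_pow_add: "a \<noteq> 0 \<Longrightarrow> diag_pow n (e + f) a = diag_pow n e a * diag_pow n f a"
  by (simp add: diag_pow_def power_int_add)

lemma diag_pow_mult: "diag_pow n e (a * b) = diag_pow n e a * diag_pow n e b"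
  by (simp add: diag_pow_def power_int_mult_distrib)

definition diag_chain :: "nat \<Rightarrow> ((nat \<Rightarrow> int) \<times> 'a::field) list \<Rightarrow> ('a mat list \<Rightarrow>\<^sub>0 int)" where
  "diag_chain n ps = comm_chain (map (\<lambda>(e, a). diag_pow n e a) ps)"

abbreviation GL_boundaries :: "'a::field itself \<Rightarrow> nat \<Rightarrow> nat \<Rightarrow> ('a mat list \<Rightarrow>\<^sub>0 int) set" where
  "GL_boundaries F n k \<equiv> bar_boundaries (GL F n) k"

lemma torus_boundaries:
  "c \<in> boundaries (GL TYPE('a::field) n) (torus n) k \<Longrightarrow> c \<in> GL_boundaries TYPE('a) n k"
  unfolding bar_boundaries_eq using boundaries_mono[OF torus_subset] by blast

lemma map_diag_pow_torus:
  "0 \<notin> snd ` set ps \<Longrightarrow> set (map (\<lambda>(e, a). diag_pow n e a) ps) \<subseteq> torus n"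
  by (force intro: diag_pow_torus)

lemma diag_chain_add:
  fixes a :: "'a::field"
  assumes "0 \<notin> snd ` set ps" "0 \<notin> snd ` set qs" "a \<noteq> 0"
  shows "diag_chain n (ps @ (e + f, a) # qs) - diag_chain n (ps @ (e, a) # qs) - diag_chain n (ps @ (f, a) # qs)
    \<in> GL_boundaries TYPE('a) n (length ps + Suc (length qs))"
  using comm_chain_mult[OF pairwise_commuting_torus map_diag_pow_torus[OF assms(1)] map_diag_pow_torus[OF assms(2)]
      diag_pow_torus[OF assms(3)] diag_pow_torus[OF assms(3)], of n e f]
  by (intro torus_boundaries) (simp add: diag_chain_def diag_pow_add assms(3))

lemma diag_chain_mult:
  fixes a b :: "'a::field"
  assumes "0 \<notin> snd ` set ps" "0 \<notin> snd ` set qs" "a \<noteq> 0" "b \<noteq> 0"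
  shows "diag_chain n (ps @ (e, a * b) # qs) - diag_chain n (ps @ (e, a) # qs) - diag_chain n (ps @ (e, b) # qs)
    \<in> GL_boundaries TYPE('a) n (length ps + Suc (length qs))"
  using comm_chain_mult[OF pairwise_commuting_torus map_diag_pow_torus[OF assms(1)] map_diag_pow_torus[OF assms(2)]
      diag_pow_torus[OF assms(3)] diag_pow_torus[OF assms(4)], of n e e]
  by (intro torus_boundaries) (simp add: diag_chain_def diag_pow_mult)

lemma diag_chain_swap: "diag_chain n (ps @ x # y # qs) = - diag_chain n (ps @ y # x # qs)"
  unfolding diag_chain_def map_append list.map by (rule comm_chain_swap)

section \<open>Permutation matrices and invariance under the Weyl group\<close>

definition swap_mat :: "nat \<Rightarrow> nat \<Rightarrow> nat \<Rightarrow> 'a::field mat" where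
  "swap_mat n i j = mat n n (\<lambda>(r, c). if r = Transposition.transpose i j c then 1 else 0)"

lemma swap_mat_carrier [simp]: "swap_mat n i j \<in> carrier_mat n n"
  by (simp add: swap_mat_def)

lemma swap_mat_square:
  assumes "i < n" "j < n"
  shows "swap_mat n i j * swap_mat n i j = (1\<^sub>m n :: 'a::field mat)"
proof (rule eq_matI)
  fix r c assume rc: "r < dim_row (1\<^sub>m n :: 'a mat)" "c < dim_col (1\<^sub>m n :: 'a mat)"
  let ?t = "Transposition.transpose i j"
  have "(swap_mat n i j * swap_mat n i j :: 'a mat) $$ (r, c) =
      (\<Sum>k\<in>{0..<n}. (if r = ?t k then 1 else 0) * (if k = ?t c then 1 else 0))"
    using rc by (simp add: swap_mat_def scalar_prod_def)
  also have "\<dots> = (\<Sum>k\<in>{0..<n}. if k = ?t c then (if r = ?t k then 1 else 0) else 0)"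
    by (intro sum.cong) auto
  also have "\<dots> = (if r = c then 1 else 0)"
    using assms rc by (simp add: sum.delta') (auto simp: transpose_def)
  finally show "(swap_mat n i j * swap_mat n i j :: 'a mat) $$ (r, c) = 1\<^sub>m n $$ (r, c)"
    using rc by simp
qed (simp_all add: swap_mat_def)

lemma swap_mat_diag:
  "mat_diag n d * swap_mat n i j = swap_mat n i j * mat_diag n (d \<circ> Transposition.transpose i j)"
  by (subst mat_diag_mult_left[of _ n n], simp, subst mat_diag_mult_right[of _ n n], simp)
     (rule cong_mat, auto simp: swap_mat_def)

text \<open>Exchanging two coordinates in all exponent vectors at once is conjugation by a
  permutation matrix, hence invisible in homology.\<close>

lemma diag_chain_transpose:
  fixes ps :: "((nat \<Rightarrow> int) \<times> 'a::field) list"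
  assumes ij: "i < n" "j < n" and ps: "0 \<notin> snd ` set ps"
  shows "diag_chain n (map (\<lambda>(e, a). (e \<circ> Transposition.transpose i j, a)) ps) - diag_chain n ps
    \<in> GL_boundaries TYPE('a) n (length ps)"
proof -
  let ?P = "swap_mat n i j :: 'a mat"
  let ?gs = "map (\<lambda>(e, a). diag_pow n e a) ps"
  define \<phi> where "\<phi> A = ?P * (A * ?P)" for A :: "'a mat"
  have \<phi>: "\<phi> (mat_diag n d) = mat_diag n (d \<circ> Transposition.transpose i j)" for d :: "nat \<Rightarrow> 'a"
    unfolding \<phi>_def swap_mat_diag
    by (subst assoc_mult_mat[symmetric, of _ n n _ n _ n]) (simp_all add: swap_mat_square[OF ij] left_mult_one_mat[OF mat_diag_dim])
  have gs: "set ?gs \<subseteq> torus n" using ps by (rule map_diag_pow_torus)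
  have tor: "\<exists>d. A = mat_diag n d \<and> (\<forall>j. d j \<noteq> 0)" if "A \<in> set ?gs" for A
    using gs that by (auto simp: torus_def)
  have "comm_chain (map \<phi> ?gs) - comm_chain ?gs \<in> boundaries (GL TYPE('a) n) (carrier (GL TYPE('a) n)) (length ?gs)"
  proof (rule comm_chain_conj[where g = ?P])
    show "pairwise_commuting (GL TYPE('a) n) (set ?gs)" using pairwise_commuting_torus gs by (rule pairwise_commuting_subset)
    show "set ?gs \<subseteq> carrier (GL TYPE('a) n)" using gs torus_subset by (rule subset_trans)
    show "\<phi> ` set ?gs \<subseteq> carrier (GL TYPE('a) n)"
    proof (rule subset_trans[OF _ torus_subset], rule image_subsetI)
      fix A assume "A \<in> set ?gs"
      then obtain d where d: "A = mat_diag n d" "\<forall>j. d j \<noteq> 0" using tor by blast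
      then show "\<phi> A \<in> torus n" by (auto simp: \<phi> torus_def)
    qed
    show "?P \<in> carrier (GL TYPE('a) n)"
      unfolding GL_carrier_iff using swap_mat_square[OF ij] by auto
    show "\<phi> (A \<otimes>\<^bsub>GL TYPE('a) n\<^esub> B) = \<phi> A \<otimes>\<^bsub>GL TYPE('a) n\<^esub> \<phi> B" if "A \<in> set ?gs" "B \<in> set ?gs" for A B
      using tor[OF that(1)] tor[OF that(2)] by (auto simp: \<phi> comp_def)
    show "?P \<otimes>\<^bsub>GL TYPE('a) n\<^esub> \<phi> A = A \<otimes>\<^bsub>GL TYPE('a) n\<^esub> ?P" if "A \<in> set ?gs" for A
      using tor[OF that] by (auto simp: \<phi> swap_mat_diag)
  qed
  moreover have "map \<phi> ?gs = map (\<lambda>(e, a). diag_pow n e a) (map (\<lambda>(e, a). (e \<circ> Transposition.transpose i j, a)) ps)"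
    by (auto simp: diag_pow_def \<phi> comp_def)
  ultimately show ?thesis by (simp only: diag_chain_def bar_boundaries_eq length_map)
qed

text \<open>This allows a congruence that is additive in an exponent vector to be checked on
  generators and then extended by closure under sums and differences.\<close>

lemma add_subgroup_preimage:
  fixes L :: "'a::ab_group_add \<Rightarrow> 'b::ab_group_add"
  assumes N: "add_subgroup N" and L: "\<And>x y. L (x + y) - L x - L y \<in> N"
  shows "add_subgroup {x. L x \<in> N}"
  unfolding add_subgroup_def
proof (intro conjI ballI)
  have "L (0 + 0) - L 0 - L 0 \<in> N" by (rule L)
  then show "0 \<in> {x. L x \<in> N}" by (simp add: add_subgroup_minus_iff[OF N])
  fix x y assume "x \<in> {x. L x \<in> N}" "y \<in> {x. L x \<in> N}"
  then have xy: "L x \<in> N" "L y \<in> N" by auto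
  have "L x - (L (x - y + y) - L (x - y) - L y) - L y \<in> N"
    by (intro add_subgroup_diff[OF N] L xy)
  then show "x - y \<in> {x. L x \<in> N}" by simp
qed

lemma sum_fun_apply: "(\<Sum>i\<in>I. f i) x = (\<Sum>i\<in>I. f i x)"
  by (induction I rule: infinite_finite_induct) simp_all

section \<open>Exponent vectors of the matrices and antisymmetry of the symbols\<close>

definition unit_exp :: "nat \<Rightarrow> nat \<Rightarrow> int" where
  "unit_exp k = (\<lambda>j. if j = k then 1 else 0)"

definition A_exp :: "nat \<Rightarrow> nat \<Rightarrow> int" where
  "A_exp k = (\<lambda>j. if k = 0 then (if j = 0 then 1 else 0)
     else if j < k then 1 else if j = k then - int k else 0)"

lemma A_exp_0: "A_exp 0 = unit_exp 0"
  by (auto simp: A_exp_def unit_exp_def)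

lemma A_exp_eq_sum: "k > 0 \<Longrightarrow> A_exp k = (\<Sum>j<k. unit_exp j - unit_exp k)"
  by (rule ext) (simp add: A_exp_def unit_exp_def sum_fun_apply sum_subtractf)

text \<open>Successive exponent vectors differ by a multiple of the simple coroot e_k - e_(k+1). The
  case k = 0 differs because \<open>A_exp 0\<close> is the first unit vector, while the general
  pattern would give zero there.\<close>

lemma A_exp_Suc:
  "A_exp (Suc k) = (if k = 0 then 0 else A_exp k) + (\<Sum>j<Suc k. unit_exp k - unit_exp (Suc k))"
  by (rule ext) (auto simp: A_exp_def unit_exp_def sum_fun_apply)

lemma unit_exp_comp_transpose: "unit_exp k \<circ> Transposition.transpose i j = unit_exp (Transposition.transpose i j k)"
  by (auto simp: unit_exp_def fun_eq_iff transpose_eq_iff)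

text \<open>The Weyl group reflection exchanging the coordinates \<open>i\<close> and \<open>i + 1\<close> makes the bilinear form
  \<open>B\<close> below symmetric on \<open>A_exp i\<close>, \<open>A_exp (i + 1)\<close>, although it is not symmetric in general.\<close>

lemma diag_chain_A_exp_symmetric:
  fixes a b :: "'a::field"
  assumes i: "Suc i < n" and nz: "0 \<notin> snd ` set ps" "0 \<notin> snd ` set qs" "a \<noteq> 0" "b \<noteq> 0"
    and fixed: "\<And>e c. (e, c) \<in> set ps \<union> set qs \<Longrightarrow> e (Suc i) = e i"
  shows "diag_chain n (ps @ (A_exp i, a) # (A_exp (Suc i), b) # qs) -
      diag_chain n (ps @ (A_exp (Suc i), a) # (A_exp i, b) # qs)
    \<in> GL_boundaries TYPE('a) n (length ps + Suc (Suc (length qs)))"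
proof -
  let ?N = "GL_boundaries TYPE('a) n (length ps + Suc (Suc (length qs)))"
  have N: "add_subgroup ?N" by (rule add_subgroup_bar_boundaries)
  define B where "B e f = diag_chain n (ps @ (e, a) # (f, b) # qs)" for e f
  let ?t = "Transposition.transpose i (Suc i)"
  let ?u = "unit_exp :: nat \<Rightarrow> nat \<Rightarrow> int"
  define \<beta> where "\<beta> = ?u i - ?u (Suc i)"
  have B1: "B (e + e') f - B e f - B e' f \<in> ?N" for e e' f
    using diag_chain_add[of ps "(f, b) # qs" a n e e'] nz by (simp add: B_def)
  have B2: "B e (f + f') - B e f - B e f' \<in> ?N" for e f f'
    using diag_chain_add[of "ps @ [(e, a)]" qs b n f f'] nz by (simp add: B_def image_Un)
  have W: "B (e \<circ> ?t) (f \<circ> ?t) - B e f \<in> ?N" for e f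
  proof -
    have inv: "map (\<lambda>(e, a). (e \<circ> ?t, a)) xs = xs" if "set xs \<subseteq> set ps \<union> set qs" for xs
    proof (rule map_idI)
      fix x assume x: "x \<in> set xs"
      obtain e c where ec: "x = (e, c)" by (cases x)
      have "e (Suc i) = e i" using fixed[of e c] x that ec by auto
      then have "e \<circ> ?t = e" by (auto simp: fun_eq_iff transpose_def)
      then show "(case x of (e, a) \<Rightarrow> (e \<circ> ?t, a)) = x" by (simp add: ec)
    qed
    show ?thesis
      using diag_chain_transpose[of i n "Suc i" "ps @ (e, a) # (f, b) # qs"] i nz inv[of ps] inv[of qs]
      by (simp add: B_def image_Un)
  qed
  have B1d: "B (e - e') f - B e f + B e' f \<in> ?N" for e e' f
    using add_subgroup_minus[OF N B1[of "e - e'" e' f]] by (simp add: algebra_simps)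
  have B2d: "B e (f - f') - B e f + B e f' \<in> ?N" for e f f'
    using add_subgroup_minus[OF N B2[of e "f - f'" f']] by (simp add: algebra_simps)
  have sub1: "add_subgroup {e. B e f - B f e \<in> ?N}" for f
  proof (rule add_subgroup_preimage[OF N])
    fix x y
    have "(B (x + y) f - B x f - B y f) - (B f (x + y) - B f x - B f y) \<in> ?N"
      by (intro add_subgroup_diff[OF N] B1 B2)
    then show "(B (x + y) f - B f (x + y)) - (B x f - B f x) - (B y f - B f y) \<in> ?N"
      by (simp add: algebra_simps)
  qed
  \<comment> \<open>For k < i the reflection fixes \<open>unit_exp k\<close> and exchanges the two
    terms of \<beta>, so both sides vanish. For k = i the diagonal terms agree and the reflection
    exchanges the two mixed terms.\<close>
  have unit: "B (?u k) \<beta> - B \<beta> (?u k) \<in> ?N" if k: "k \<le> i" for k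
  proof (cases "k = i")
    case True
    have "(B (?u i) \<beta> - B (?u i) (?u i) + B (?u i) (?u (Suc i)))
        - (B \<beta> (?u i) - B (?u i) (?u i) + B (?u (Suc i)) (?u i))
        + (B (?u i \<circ> ?t) (?u (Suc i) \<circ> ?t) - B (?u i) (?u (Suc i))) \<in> ?N"
      unfolding \<beta>_def by (intro add_subgroup_diff[OF N] add_subgroup_add[OF N] B1d B2d W)
    then show ?thesis using True by (simp add: unit_exp_comp_transpose)
  next
    case False
    then have t: "?t k = k" using k by (simp add: transpose_def)
    have "(B (?u k) \<beta> - B (?u k) (?u i) + B (?u k) (?u (Suc i)))
        - (B (?u k \<circ> ?t) (?u i \<circ> ?t) - B (?u k) (?u i))
        - ((B \<beta> (?u k) - B (?u i) (?u k) + B (?u (Suc i)) (?u k))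
        - (B (?u i \<circ> ?t) (?u k \<circ> ?t) - B (?u i) (?u k))) \<in> ?N"
      unfolding \<beta>_def by (intro add_subgroup_diff[OF N] add_subgroup_add[OF N] B1d B2d W)
    then show ?thesis by (simp add: unit_exp_comp_transpose t)
  qed
  have "A_exp i \<in> {e. B e \<beta> - B \<beta> e \<in> ?N}"
  proof (cases "i = 0")
    case True
    then show ?thesis using unit[of 0] by (simp add: A_exp_0)
  next
    case False
    then show ?thesis
      unfolding A_exp_eq_sum[OF False[unfolded neq0_conv]]
      by (intro add_subgroup_sum[OF sub1] add_subgroup_diff[OF sub1])
         (simp_all only: mem_Collect_eq lessThan_iff less_imp_le order_refl unit)
  qed
  then have "\<beta> \<in> {e. B e (A_exp i) - B (A_exp i) e \<in> ?N}"
    using add_subgroup_minus[OF N] by fastforce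
  moreover have "A_exp i \<in> {e. B e (A_exp i) - B (A_exp i) e \<in> ?N}"
    using add_subgroup_zero[OF N] by simp
  moreover have "0 \<in> {e. B e (A_exp i) - B (A_exp i) e \<in> ?N}" by (rule add_subgroup_zero[OF sub1])
  \<comment> \<open>Pairing with \<open>A_exp i\<close> is symmetric on \<beta> and on
    \<open>A_exp i\<close> itself, and the next exponent vector is a sum of copies of these.\<close>
  ultimately have "A_exp (Suc i) \<in> {e. B e (A_exp i) - B (A_exp i) e \<in> ?N}"
    unfolding A_exp_Suc \<beta>_def[symmetric]
    by (intro add_subgroup_add[OF sub1] add_subgroup_sum[OF sub1]) (simp_all only: simp_thms split: if_splits)
  then show ?thesis
    using add_subgroup_minus[OF N] by (fastforce simp: B_def)
qed

definition GL_chain :: "'a::field list \<Rightarrow> ('a mat list \<Rightarrow>\<^sub>0 int)" where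
  "GL_chain as = diag_chain (length as) (zip (map A_exp [0..<length as]) as)"

lemma A_mat_eq: "k < length as \<Longrightarrow> A_mat as k = diag_pow (length as) (A_exp k) (as ! k)"
  unfolding A_mat_def diag_pow_def by (rule arg_cong[where f = "mat_diag _"]) (auto simp: A_exp_def)

lemma GL_chain_eq: "GL_chain as = comm_chain (map (A_mat as) [0..<length as])"
proof -
  have "map (A_mat as) [0..<length as] = map (\<lambda>(e, a). diag_pow (length as) e a) (zip (map A_exp [0..<length as]) as)"
    by (rule nth_equalityI) (simp_all add: A_mat_eq)
  then show ?thesis by (simp add: GL_chain_def diag_chain_def)
qed

lemma GL_symbol_eq:
  fixes as :: "'a::field list"
  shows "GL_symbol as = homology_class (GL TYPE('a) (length as)) (length as) (GL_chain as)"
  by (simp add: GL_symbol_def comm_class_eq GL_chain_eq)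

lemma zip_A_exp_append:
  "zip (map A_exp [0..<length (u @ v)]) (u @ v) =
    zip (map A_exp [0..<length u]) u @ zip (map A_exp [length u..<length u + length v]) v"
proof -
  have "[0..<length u + length v] = [0..<length u] @ [length u..<length u + length v]"
    using upt_add_eq_append[of 0 "length u" "length v"] by simp
  then show ?thesis by (simp add: zip_append)
qed

lemma zip_nonzero: "0 \<notin> set u \<Longrightarrow> 0 \<notin> snd ` set (zip es u)"
  by (auto dest: set_zip_rightD)

lemma GL_chain_mult:
  fixes x y :: "'a::field"
  assumes "0 \<notin> set u" "0 \<notin> set v" "x \<noteq> 0" "y \<noteq> 0"
  shows "GL_chain (u @ (x * y) # v) - GL_chain (u @ x # v) - GL_chain (u @ y # v)
    \<in> GL_boundaries TYPE('a) (Suc (length u + length v)) (Suc (length u + length v))"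
proof -
  let ?i = "length u" and ?n = "Suc (length u + length v)"
  let ?ps = "zip (map A_exp [0..<?i]) u" and ?qs = "zip (map A_exp [Suc ?i..<?i + Suc (length v)]) v"
  have split: "zip (map A_exp [0..<length (u @ c # v)]) (u @ c # v) = ?ps @ (A_exp ?i, c) # ?qs" for c
    using zip_A_exp_append[of u "c # v"] by (simp add: upt_conv_Cons del: upt_Suc)
  have "diag_chain ?n (?ps @ (A_exp ?i, x * y) # ?qs) - diag_chain ?n (?ps @ (A_exp ?i, x) # ?qs)
      - diag_chain ?n (?ps @ (A_exp ?i, y) # ?qs) \<in> GL_boundaries TYPE('a) ?n (length ?ps + Suc (length ?qs))"
    by (rule diag_chain_mult) (use assms zip_nonzero[OF assms(1)] zip_nonzero[OF assms(2)] in auto)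
  then show ?thesis
    unfolding GL_chain_def split by (simp del: upt_Suc)
qed

text \<open>Symmetry of the form allows the scalars \<open>a\<close> and \<open>b\<close> to trade
  matrices. Antisymmetry of the commuting class then restores the order of the matrices and supplies
  the sign.\<close>

lemma GL_chain_swap:
  fixes a b :: "'a::field"
  assumes "0 \<notin> set u" "0 \<notin> set v" "a \<noteq> 0" "b \<noteq> 0"
  shows "GL_chain (u @ a # b # v) + GL_chain (u @ b # a # v)
    \<in> GL_boundaries TYPE('a) (length (u @ a # b # v)) (length (u @ a # b # v))"
proof -
  let ?i = "length u" and ?n = "length (u @ a # b # v)"
  let ?ps = "zip (map A_exp [0..<?i]) u" and ?qs = "zip (map A_exp [Suc (Suc ?i)..<?i + Suc (Suc (length v))]) v"
  have split: "zip (map A_exp [0..<length (u @ c # d # v)]) (u @ c # d # v) = ?ps @ (A_exp ?i, c) # (A_exp (Suc ?i), d) # ?qs" for c d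
    using zip_A_exp_append[of u "c # d # v"] by (simp add: upt_conv_Cons del: upt_Suc)
  have "diag_chain ?n (?ps @ (A_exp ?i, a) # (A_exp (Suc ?i), b) # ?qs) -
      diag_chain ?n (?ps @ (A_exp (Suc ?i), a) # (A_exp ?i, b) # ?qs)
    \<in> GL_boundaries TYPE('a) ?n (length ?ps + Suc (Suc (length ?qs)))"
  proof (rule diag_chain_A_exp_symmetric)
    \<comment> \<open>Every other vector is constant on the two coordinates involved: zero there if
      its index is smaller, one if its index is larger.\<close>
    fix e c assume "(e, c) \<in> set ?ps \<union> set ?qs"
    then have "e \<in> A_exp ` ({0..<?i} \<union> {Suc (Suc ?i)..})"
      by (auto dest!: set_zip_leftD)
    then show "e (Suc ?i) = e ?i" by (auto simp: A_exp_def)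
  qed (use assms zip_nonzero[OF assms(1)] zip_nonzero[OF assms(2)] in auto)
  moreover have "diag_chain ?n (?ps @ (A_exp (Suc ?i), a) # (A_exp ?i, b) # ?qs) =
      - diag_chain ?n (?ps @ (A_exp ?i, b) # (A_exp (Suc ?i), a) # ?qs)"
    by (rule diag_chain_swap)
  ultimately show ?thesis
    unfolding GL_chain_def split by (simp del: upt_Suc)
qed

section \<open>The Steinberg relation for the symbols\<close>

fun gl2_entry :: "'a::field \<times> 'a \<times> 'a \<times> 'a \<Rightarrow> nat \<Rightarrow> nat \<Rightarrow> 'a" where
  "gl2_entry (p, q, r, s) i j =
     (if i = 0 \<and> j = 0 then p else if i = 0 \<and> j = 1 then q else if i = 1 \<and> j = 0 then r
      else if i = 1 \<and> j = 1 then s else if i = j then 1 else 0)"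

definition gl2_embed :: "nat \<Rightarrow> 'a::field \<times> 'a \<times> 'a \<times> 'a \<Rightarrow> 'a mat" where
  "gl2_embed n g = mat n n (\<lambda>(i, j). gl2_entry g i j)"

lemma gl2_embed_carrier_mat [simp]: "gl2_embed n g \<in> carrier_mat n n"
  by (simp add: gl2_embed_def)

lemma gl2_embed_mult:
  assumes "n \<ge> 2"
  shows "gl2_embed n (g \<otimes>\<^bsub>gl2\<^esub> h) = gl2_embed n g * gl2_embed n h"
proof (rule eq_matI)
  obtain m where m: "n = Suc (Suc m)" using assms by (metis add_2_eq_Suc le_Suc_ex)
  obtain p q r s where g: "g = (p, q, r, s)" by (cases g)
  obtain p' q' r' s' where h: "h = (p', q', r', s')" by (cases h)
  fix i j assume "i < dim_row (gl2_embed n g * gl2_embed n h)" "j < dim_col (gl2_embed n g * gl2_embed n h)"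
  then have ij: "i < n" "j < n" by (simp_all add: gl2_embed_def)
  have "(gl2_embed n g * gl2_embed n h) $$ (i, j) = (\<Sum>k\<in>{0..<n}. gl2_entry g i k * gl2_entry h k j)"
    using ij by (simp add: gl2_embed_def scalar_prod_def)
  also have "\<dots> = gl2_entry g i 0 * gl2_entry h 0 j + (gl2_entry g i 1 * gl2_entry h 1 j
      + (\<Sum>k\<in>{0..<m}. gl2_entry g i (Suc (Suc k)) * gl2_entry h (Suc (Suc k)) j))"
    unfolding m sum.atLeast0_lessThan_Suc_shift by simp
  also have "(\<Sum>k\<in>{0..<m}. gl2_entry g i (Suc (Suc k)) * gl2_entry h (Suc (Suc k)) j)
      = (\<Sum>k\<in>{0..<m}. if i = Suc (Suc k) then (if i = j then 1 else 0) else 0)"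
    by (intro sum.cong) (auto simp: g h)
  also have "\<dots> = (if 2 \<le> i \<and> i = j then 1 else 0)"
  proof (cases "2 \<le> i")
    case True
    then obtain k where "i = Suc (Suc k)" by (metis add_2_eq_Suc le_Suc_ex)
    then show ?thesis using ij m by (simp add: sum.delta)
  qed (auto intro!: sum.neutral)
  finally show "gl2_embed n (g \<otimes>\<^bsub>gl2\<^esub> h) $$ (i, j) = (gl2_embed n g * gl2_embed n h) $$ (i, j)"
    using ij by (auto simp: gl2_embed_def g h not_le less_2_cases_iff)
qed (simp_all add: gl2_embed_def)

lemma gl2_embed_one: "gl2_embed n \<one>\<^bsub>gl2\<^esub> = 1\<^sub>m n"
  by (rule eq_matI) (auto simp: gl2_embed_def)

lemma gl2_embed_GL:
  assumes n: "n \<ge> 2" and g: "g \<in> carrier gl2"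
  shows "gl2_embed n g \<in> carrier (GL TYPE('a::field) n)"
proof -
  interpret group gl2 by (rule group_gl2)
  have "gl2_embed n g * gl2_embed n (inv\<^bsub>gl2\<^esub> g) = 1\<^sub>m n" "gl2_embed n (inv\<^bsub>gl2\<^esub> g) * gl2_embed n g = 1\<^sub>m n"
    unfolding gl2_embed_mult[OF n, symmetric] using g by (simp_all add: gl2_embed_one del: gl2_simps)
  then show ?thesis unfolding GL_carrier_iff by auto
qed

lemma gl2_embed_diag: "gl2_embed n (p, 0, 0, s) = mat_diag n (\<lambda>j. if j = 0 then p else if j = 1 then s else 1)"
  unfolding gl2_embed_def mat_diag_def by (rule cong_mat) auto

lemma gl2_embed_commute:
  assumes "d 0 = d (Suc 0)"
  shows "mat_diag n d * gl2_embed n g = gl2_embed n g * mat_diag n d"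
  by (cases g, subst mat_diag_mult_left[of _ n n], simp, subst mat_diag_mult_right[of _ n n], simp)
     (rule cong_mat, use assms in \<open>auto simp: gl2_embed_def mult.commute\<close>)

text \<open>From the third one on, the matrices \<open>A\<^bsub>i,n\<^esub>\<close> are scalar on the first two coordinates, so that
  multiplication by them is defined on the chains of the embedded \<open>GL\<^sub>2\<close>.\<close>

lemma GL_chain_steinberg_front:
  fixes a b :: "'a::field"
  assumes inf: "infinite (UNIV :: 'a set)" and ab: "a + b = 1" "a \<noteq> 0" "b \<noteq> 0" and v: "0 \<notin> set v"
  shows "GL_chain (a # b # v) \<in> GL_boundaries TYPE('a) (length (a # b # v)) (length (a # b # v))"
proof -
  let ?n = "Suc (Suc (length v))" and ?G = "GL TYPE('a) (Suc (Suc (length v)))"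
  define zs where "zs = map (\<lambda>(e, a). diag_pow ?n e a) (zip (map A_exp [2..<?n]) v)"
  \<comment> \<open>The bounding chain lives in the embedded block. The factors \<open>zs\<close>
    are added because multiplication by them inserts them as entries.\<close>
  let ?S = "gl2_embed ?n ` carrier gl2 \<union> set zs"
  have zs: "\<exists>d. z = mat_diag ?n d \<and> d 0 = d (Suc 0) \<and> (\<forall>j. d j \<noteq> 0)" if z: "z \<in> set zs" for z
  proof -
    obtain e c where ec: "(e, c) \<in> set (zip (map A_exp [2..<?n]) v)" "z = diag_pow ?n e c"
      using z by (auto simp: zs_def simp del: upt_Suc)
    then obtain k where "2 \<le> k" "e = A_exp k" "c \<in> set v"
      using set_zip_leftD[OF ec(1)] set_zip_rightD[OF ec(1)] by (auto simp del: upt_Suc)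
    with ec(2) show ?thesis
      using v by (intro exI[of _ "\<lambda>j. c powi A_exp k j"]) (auto simp: diag_pow_def A_exp_def)
  qed
  have x: "diag_pow ?n (A_exp 0) a = gl2_embed ?n (a, 0, 0, 1)"
    unfolding gl2_embed_diag diag_pow_def by (rule arg_cong[where f = "mat_diag _"]) (auto simp: A_exp_def)
  have y: "diag_pow ?n (A_exp 1) b = gl2_embed ?n (b, 0, 0, 1 / b)"
    unfolding gl2_embed_diag diag_pow_def
    by (rule arg_cong[where f = "mat_diag _"]) (auto simp: A_exp_def inverse_eq_divide power_int_minus)
  have "map_chain (gl2_embed ?n) (comm_chain [(a, 0, 0, 1), (b, 0, 0, 1 / b)]) \<in> boundaries ?G ?S 2"
  proof (rule map_chain_boundaries[of "carrier gl2" _ gl2])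
    show "comm_chain [(a, 0, 0, 1), (b, 0, 0, 1 / b)] \<in> boundaries gl2 (carrier gl2) 2"
      using gl2_steinberg[OF inf ab] by (simp only: bar_boundaries_eq)
  qed (auto simp: gl2_embed_mult)
  then have "comm_chain [diag_pow ?n (A_exp 0) a, diag_pow ?n (A_exp 1) b] \<in> boundaries ?G ?S 2"
    by (simp only: map_chain_comm_chain list.map x y)
  then have "foldr shuffle zs (comm_chain [diag_pow ?n (A_exp 0) a, diag_pow ?n (A_exp 1) b])
      \<in> boundaries ?G ?S (length zs + 2)"
  proof (rule foldr_shuffle_boundaries[rotated 2])
    fix z g assume z: "z \<in> set zs" and g: "g \<in> ?S"
    obtain d where d: "z = mat_diag ?n d" "d 0 = d (Suc 0)" using zs[OF z] by blast
    from g show "z \<otimes>\<^bsub>?G\<^esub> g = g \<otimes>\<^bsub>?G\<^esub> z"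
    proof
      assume "g \<in> gl2_embed ?n ` carrier gl2"
      then show ?thesis using gl2_embed_commute[OF d(2)] by (auto simp: d(1))
    next
      assume "g \<in> set zs"
      then obtain d' where "g = mat_diag ?n d'" using zs by blast
      then show ?thesis by (simp add: d(1) mult.commute)
    qed
  qed simp
  moreover have "?S \<subseteq> carrier ?G"
  proof -
    have "set zs \<subseteq> torus ?n" using zs by (auto simp: torus_def)
    then show ?thesis using torus_subset by (auto intro!: gl2_embed_GL)
  qed
  ultimately have "comm_chain (zs @ [diag_pow ?n (A_exp 0) a, diag_pow ?n (A_exp 1) b])
      \<in> bar_boundaries ?G (length zs + 2)"
    unfolding comm_chain_append bar_boundaries_eq using boundaries_mono by blast
  moreover have "GL_chain (a # b # v) = comm_chain (diag_pow ?n (A_exp 0) a # diag_pow ?n (A_exp 1) b # zs)"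
    by (simp add: GL_chain_def diag_chain_def zs_def upt_conv_Cons numeral_2_eq_2 del: upt_Suc comm_chain_simps)
  moreover have "length zs = length v" by (simp add: zs_def del: upt_Suc)
  ultimately show ?thesis by (simp only: comm_chain_rotate2) simp
qed

text \<open>The last entry \<open>c\<close> before the pair is moved behind it by two exchanges,
  first with \<open>a\<close> and then with \<open>b\<close>. This shortens the prefix, with
  \<open>c\<close> joining the arbitrary suffix.\<close>

lemma GL_chain_steinberg:
  fixes a b :: "'a::field"
  assumes inf: "infinite (UNIV :: 'a set)" and ab: "a + b = 1" "a \<noteq> 0" "b \<noteq> 0"
    and uv: "0 \<notin> set u" "0 \<notin> set v"
  shows "GL_chain (u @ a # b # v) \<in> GL_boundaries TYPE('a) (length (u @ a # b # v)) (length (u @ a # b # v))"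
  using uv
proof (induction u arbitrary: v rule: rev_induct)
  case Nil
  then show ?case using GL_chain_steinberg_front[OF inf ab] by simp
next
  case (snoc c u)
  let ?N = "GL_boundaries TYPE('a) (length (u @ a # b # c # v)) (length (u @ a # b # c # v))"
  have N: "add_subgroup ?N" by (rule add_subgroup_bar_boundaries)
  have c: "0 \<notin> set u" "c \<noteq> 0" using snoc.prems by auto
  have 1: "GL_chain (u @ a # b # c # v) \<in> ?N"
    using snoc.IH[of "c # v"] snoc.prems c by simp
  have 2: "GL_chain (u @ a # b # c # v) + GL_chain (u @ a # c # b # v) \<in> ?N"
    using GL_chain_swap[of "u @ [a]" v b c] snoc.prems ab c by simp
  have 3: "GL_chain (u @ a # c # b # v) + GL_chain (u @ c # a # b # v) \<in> ?N"
    using GL_chain_swap[of u "b # v" a c] snoc.prems ab c by simp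
  have "(GL_chain (u @ a # c # b # v) + GL_chain (u @ c # a # b # v))
      - (GL_chain (u @ a # b # c # v) + GL_chain (u @ a # c # b # v)) + GL_chain (u @ a # b # c # v) \<in> ?N"
    by (intro add_subgroup_add[OF N] add_subgroup_diff[OF N] 1 2 3)
  then show ?case by simp
qed

section \<open>Well-definedness on Milnor K-groups\<close>

lemma free_ring_simps [simp]:
  "carrier (free_ring S) = {c. Poly_Mapping.keys c \<subseteq> lists S}"
  "x \<otimes>\<^bsub>free_ring S\<^esub> y = free_ring_mult x y" "\<one>\<^bsub>free_ring S\<^esub> = frag_of []"
  "x \<oplus>\<^bsub>free_ring S\<^esub> y = x + y" "\<zero>\<^bsub>free_ring S\<^esub> = 0"
  by (simp_all add: free_ring_def free_Abelian_group_def)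

lemma frag_extend_fun_diff: "frag_extend (\<lambda>w. f w - g w) c = frag_extend f c - frag_extend g c"
  by (induction c rule: chain_induct) (simp_all add: frag_extend_diff)

lemma frag_extend_frag_extend: "frag_extend f (frag_extend g c) = frag_extend (\<lambda>w. frag_extend f (g w)) c"
  by (induction c rule: chain_induct) (simp_all add: frag_extend_diff)

lemma free_ring_mult_diff:
  "free_ring_mult (p - p') q = free_ring_mult p q - free_ring_mult p' q"
  "free_ring_mult p (q - q') = free_ring_mult p q - free_ring_mult p q'"
  by (simp_all add: free_ring_mult_def frag_extend_diff frag_extend_fun_diff)

lemma free_ring_mult_0 [simp]: "free_ring_mult 0 q = 0" "free_ring_mult p 0 = 0"
  using free_ring_mult_diff(1)[of 0 0 q] free_ring_mult_diff(2)[of p 0 0] by simp_all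

lemma free_ring_mult_add:
  "free_ring_mult (p + p') q = free_ring_mult p q + free_ring_mult p' q"
  "free_ring_mult p (q + q') = free_ring_mult p q + free_ring_mult p q'"
proof -
  show "free_ring_mult (p + p') q = free_ring_mult p q + free_ring_mult p' q"
    using free_ring_mult_diff(1)[of "p + p'" p' q] by (simp add: eq_diff_eq)
  show "free_ring_mult p (q + q') = free_ring_mult p q + free_ring_mult p q'"
    using free_ring_mult_diff(2)[of p "q + q'" q'] by (simp add: eq_diff_eq)
qed

lemma free_ring_mult_of [simp]: "free_ring_mult (frag_of u) (frag_of v) = frag_of (u @ v)"
  by (simp add: free_ring_mult_def)

lemma free_ring_mult_assoc: "free_ring_mult (free_ring_mult x y) z = free_ring_mult x (free_ring_mult y z)"
proof (induction x rule: chain_induct)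
  case (word u)
  show ?case
  proof (induction y rule: chain_induct)
    case (word v)
    show ?case
      by (induction z rule: chain_induct) (simp_all add: free_ring_mult_diff)
  qed (simp_all add: free_ring_mult_diff)
qed (simp_all add: free_ring_mult_diff)

lemma free_ring_mult_one: "free_ring_mult (frag_of []) x = x" "free_ring_mult x (frag_of []) = x"
  by (induction x rule: chain_induct) (simp_all add: free_ring_mult_diff)

lemma add_subgroup_keys: "add_subgroup {c. Poly_Mapping.keys c \<subseteq> S}"
  unfolding add_subgroup_def using keys_diff by fastforce

lemma ring_free_ring: "ring (free_ring S)"
proof (rule ringI)
  note sub = add_subgroup_keys[of "lists S"]
  show "abelian_group (free_ring S)"
  proof (rule abelian_groupI)
    fix x assume "x \<in> carrier (free_ring S)"
    then show "\<exists>y\<in>carrier (free_ring S). y \<oplus>\<^bsub>free_ring S\<^esub> x = \<zero>\<^bsub>free_ring S\<^esub>"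
      by (intro bexI[of _ "- x"]) auto
  qed (use add_subgroup_add[OF sub] in \<open>simp_all add: add_ac\<close>)
  show "monoid (free_ring S)"
  proof (rule monoidI)
    fix x y assume "x \<in> carrier (free_ring S)" "y \<in> carrier (free_ring S)"
    then have "frag_extend (\<lambda>u. frag_extend (\<lambda>v. frag_of (u @ v)) y) x \<in> {c. Poly_Mapping.keys c \<subseteq> lists S}"
      by (intro frag_extend_in[OF sub, of _ "lists S"]) auto
    then show "x \<otimes>\<^bsub>free_ring S\<^esub> y \<in> carrier (free_ring S)" by (simp add: free_ring_mult_def)
  qed (simp_all add: free_ring_mult_assoc free_ring_mult_one)
qed (simp_all add: free_ring_mult_add)

text \<open>The largest ideal contained in the kernel of the additive map \<open>\<kappa>\<close> modulo \<open>N\<close>.\<close>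

definition core_ideal :: "'a set \<Rightarrow> ('a list \<Rightarrow> ('b \<Rightarrow>\<^sub>0 int)) \<Rightarrow> ('b \<Rightarrow>\<^sub>0 int) set \<Rightarrow> ('a list \<Rightarrow>\<^sub>0 int) set" where
  "core_ideal S \<kappa> N = {p. Poly_Mapping.keys p \<subseteq> lists S \<and>
     (\<forall>u\<in>lists S. \<forall>v\<in>lists S. frag_extend (\<lambda>w. \<kappa> (u @ w @ v)) p \<in> N)}"

lemma core_idealD:
  "p \<in> core_ideal S \<kappa> N \<Longrightarrow> u \<in> lists S \<Longrightarrow> v \<in> lists S \<Longrightarrow> frag_extend (\<lambda>w. \<kappa> (u @ w @ v)) p \<in> N"
  unfolding core_ideal_def by blast

lemma add_subgroup_core_ideal: "add_subgroup N \<Longrightarrow> add_subgroup (core_ideal S \<kappa> N)"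
  unfolding add_subgroup_def[of "core_ideal S \<kappa> N"]
proof (intro conjI ballI)
  assume N: "add_subgroup N"
  show "0 \<in> core_ideal S \<kappa> N" by (simp add: core_ideal_def add_subgroup_zero[OF N])
  fix x y assume xy: "x \<in> core_ideal S \<kappa> N" "y \<in> core_ideal S \<kappa> N"
  then have "x - y \<in> {c. Poly_Mapping.keys c \<subseteq> lists S}"
    by (intro add_subgroup_diff[OF add_subgroup_keys]) (simp_all add: core_ideal_def)
  then show "x - y \<in> core_ideal S \<kappa> N"
    using core_idealD[OF xy(1)] core_idealD[OF xy(2)] add_subgroup_diff[OF N]
    unfolding core_ideal_def by (simp add: frag_extend_diff)
qed

text \<open>Multiplication by a word only enlarges the context \<open>u\<close> or \<open>v\<close>,
  over which the condition already quantifies.\<close>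

lemma ideal_core_ideal:
  assumes N: "add_subgroup N"
  shows "ideal (core_ideal S \<kappa> N) (free_ring S)"
proof (rule idealI)
  let ?K = "core_ideal S \<kappa> N" and ?R = "free_ring S"
  have K: "add_subgroup ?K" using N by (rule add_subgroup_core_ideal)
  interpret R: ring ?R by (rule ring_free_ring)
  show "subgroup ?K (add_monoid ?R)"
  proof (rule subgroup_add[OF _ K])
    show "Group.group (add_monoid ?R)" by (rule R.add.group_axioms)
    fix x assume "x \<in> carrier (add_monoid ?R)"
    then show "inv\<^bsub>add_monoid ?R\<^esub> x = - x"
      by (intro group.inv_equality[OF R.add.group_axioms]) auto
  qed (auto simp: core_ideal_def)
  fix p q assume p: "p \<in> ?K" and q: "q \<in> carrier ?R"
  then have pc: "p \<in> carrier ?R" by (simp add: core_ideal_def)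
  show "q \<otimes>\<^bsub>?R\<^esub> p \<in> ?K"
  proof -
    have "frag_extend (\<lambda>w. \<kappa> (u @ w @ v)) (free_ring_mult q p) \<in> N" if uv: "u \<in> lists S" "v \<in> lists S" for u v
      unfolding free_ring_mult_def frag_extend_frag_extend frag_extend_of
    proof (rule frag_extend_in[OF N, of _ "lists S"])
      fix w assume "w \<in> lists S"
      then have "frag_extend (\<lambda>x. \<kappa> ((u @ w) @ x @ v)) p \<in> N" using uv by (intro core_idealD[OF p]) auto
      then show "frag_extend (\<lambda>x. \<kappa> (u @ (w @ x) @ v)) p \<in> N" by simp
    qed (use q in auto)
    moreover have "Poly_Mapping.keys (free_ring_mult q p) \<subseteq> lists S"
      using R.m_closed[OF q pc] by simp
    ultimately show ?thesis by (simp add: core_ideal_def)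
  qed
  have "Poly_Mapping.keys q \<subseteq> lists S" using q by simp
  then have "free_ring_mult p q \<in> ?K"
  proof (induction q rule: frag_induction)
    case (one x)
    have "frag_extend (\<lambda>w. \<kappa> (u @ w @ v)) (free_ring_mult p (frag_of x)) \<in> N"
      if uv: "u \<in> lists S" "v \<in> lists S" for u v
    proof -
      have "frag_extend (\<lambda>w. \<kappa> (u @ w @ (x @ v))) p \<in> N"
        using uv one by (intro core_idealD[OF p]) auto
      then show ?thesis by (simp add: free_ring_mult_def frag_extend_frag_extend)
    qed
    moreover have "Poly_Mapping.keys (free_ring_mult p (frag_of x)) \<subseteq> lists S"
      using R.m_closed[OF pc, of "frag_of x"] one by simp
    ultimately show ?case by (simp add: core_ideal_def)
  qed (simp_all add: add_subgroup_zero[OF K] free_ring_mult_diff add_subgroup_diff[OF K])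
  then show "p \<otimes>\<^bsub>?R\<^esub> q \<in> ?K" by simp
qed (rule ring_free_ring)

lemma ideal_tensor_ideal: "ideal (tensor_ideal A) (free_ring (carrier A))"
  if "monoid A" for A :: "('a, 'm) monoid_scheme"
  unfolding tensor_ideal_def
proof (rule ring.genideal_ideal[OF ring_free_ring], safe)
  interpret monoid A by fact
  fix x y assume xy: "x \<in> carrier A" "y \<in> carrier A"
  have "frag_of [x \<otimes>\<^bsub>A\<^esub> y] - frag_of [x] - frag_of [y] \<in> {c. Poly_Mapping.keys c \<subseteq> lists (carrier A)}"
    using xy by (intro add_subgroup_diff[OF add_subgroup_keys]) auto
  then show "frag_of [x \<otimes>\<^bsub>A\<^esub> y] - frag_of [x] - frag_of [y] \<in> carrier (free_ring (carrier A))" by simp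
qed

lemma (in ideal) image_ideal:
  assumes J: "ideal J R"
  shows "ideal ((+>) I ` J) (R Quot I)"
proof (rule idealI)
  interpret h: ring_hom_ring R "R Quot I" "(+>) I" by (rule rcos_ring_hom_ring)
  interpret J: ideal J R by fact
  show "ring (R Quot I)" by (rule quotient_is_ring)
  have "group_hom (add_monoid R) (add_monoid (R Quot I)) ((+>) I)"
    using h.a_group_hom .
  then show "subgroup ((+>) I ` J) (add_monoid (R Quot I))"
    using J.a_subgroup by (rule group_hom.subgroup_img_is_subgroup)
  fix a x assume "a \<in> (+>) I ` J" and x: "x \<in> carrier (R Quot I)"
  then obtain j where j: "j \<in> J" "a = I +> j" by auto
  obtain r where r: "r \<in> carrier R" "x = I +> r"
    using x unfolding FactRing_def partial_object.simps A_RCOSETS_def' by blast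
  have "j \<in> carrier R" using j(1) by (rule J.Icarr)
  then have "x \<otimes>\<^bsub>R Quot I\<^esub> a = I +> (r \<otimes> j)" "a \<otimes>\<^bsub>R Quot I\<^esub> x = I +> (j \<otimes> r)"
    using j r by (simp_all only: h.hom_mult)
  then show "x \<otimes>\<^bsub>R Quot I\<^esub> a \<in> (+>) I ` J" "a \<otimes>\<^bsub>R Quot I\<^esub> x \<in> (+>) I ` J"
    using J.I_l_closed[OF j(1) r(1)] J.I_r_closed[OF j(1) r(1)] by auto
qed

lemma mult_group_simps [simp]:
  "carrier (mult_group TYPE('a::field)) = UNIV - {0}"
  "x \<otimes>\<^bsub>mult_group TYPE('a)\<^esub> y = x * y" "\<one>\<^bsub>mult_group TYPE('a)\<^esub> = 1"
  by (simp_all add: mult_group_def)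

lemma monoid_mult_group: "monoid (mult_group TYPE('a::field))"
  by (rule monoidI) auto

definition milnor_elem :: "('a::field list \<Rightarrow>\<^sub>0 int) \<Rightarrow> ('a list \<Rightarrow>\<^sub>0 int) set set" where
  "milnor_elem p = milnor_class TYPE('a) (tensor_class (mult_group TYPE('a)) p)"

context
  fixes F :: "'a::field itself"
begin

abbreviation (input) "words \<equiv> free_ring (UNIV - {0 :: 'a})"
abbreviation (input) "T0 \<equiv> tensor_ideal (mult_group TYPE('a))"
abbreviation (input) "T \<equiv> tensor_algebra (mult_group TYPE('a))"

lemma tensor_ideal_mult_group: "ideal T0 words"
  using ideal_tensor_ideal[OF monoid_mult_group[where 'a='a]] by simp

lemma tensor_algebra_eq: "T = words Quot T0"
  by (simp add: tensor_algebra_def)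

lemma ring_tensor_algebra: "ring T"
  unfolding tensor_algebra_eq using tensor_ideal_mult_group by (rule ideal.quotient_is_ring)

lemma tensor_class_eq: "tensor_class (mult_group TYPE('a)) = (+>\<^bsub>words\<^esub>) T0"
  by (rule ext) (simp add: tensor_class_def)

lemma tensor_class_hom: "ring_hom_ring words T (tensor_class (mult_group TYPE('a)))"
  unfolding tensor_class_eq tensor_algebra_eq using tensor_ideal_mult_group by (rule ideal.rcos_ring_hom_ring)

lemma steinberg_gens:
  "{pure_tensor (mult_group TYPE('a)) [a, 1 - a] | a. a \<in> carrier (mult_group TYPE('a)) - {1}} \<subseteq> carrier T"
proof -
  have "pure_tensor (mult_group TYPE('a)) [a, 1 - a] \<in> carrier T" if "a \<noteq> 0" "a \<noteq> 1" for a :: 'a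
    using that unfolding pure_tensor_def by (intro ring_hom_closed[OF ring_hom_ring.homh[OF tensor_class_hom]]) auto
  then show ?thesis by auto
qed

lemma ideal_steinberg: "ideal (steinberg_ideal TYPE('a)) T"
  unfolding steinberg_ideal_def using ring_tensor_algebra steinberg_gens by (rule ring.genideal_ideal)

lemma milnor_class_eq: "milnor_class TYPE('a) = (+>\<^bsub>T\<^esub>) (steinberg_ideal TYPE('a))"
  by (rule ext) (simp add: milnor_class_def)

lemma milnor_class_hom: "ring_hom_ring T (milnor_ring TYPE('a)) (milnor_class TYPE('a))"
  unfolding milnor_class_eq milnor_ring_def using ideal_steinberg by (rule ideal.rcos_ring_hom_ring)

lemma milnor_elem_hom: "group_hom (add_monoid words) (add_monoid (milnor_ring TYPE('a))) milnor_elem"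
proof -
  interpret f: ring_hom_ring words T "tensor_class (mult_group TYPE('a))" by (rule tensor_class_hom)
  interpret g: ring_hom_ring T "milnor_ring TYPE('a)" "milnor_class TYPE('a)" by (rule milnor_class_hom)
  have "milnor_elem = milnor_class TYPE('a) \<circ> tensor_class (mult_group TYPE('a))"
    by (rule ext) (simp add: milnor_elem_def)
  moreover have "milnor_class TYPE('a) \<circ> tensor_class (mult_group TYPE('a))
      \<in> hom (add_monoid words) (add_monoid (milnor_ring TYPE('a)))"
    using group_hom.homh[OF f.a_group_hom] group_hom.homh[OF g.a_group_hom] by (rule hom_compose)
  ultimately show ?thesis
    using group_hom.axioms(1)[OF f.a_group_hom] group_hom.axioms(2)[OF g.a_group_hom]
    by (simp add: group_hom_def group_hom_axioms_def)
qed

text \<open>The universal property of the two-stage quotient. The hypotheses put both kinds of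
  relators into the core ideal, so it contains the tensor ideal and its image contains the Steinberg
  ideal. An element with zero class therefore lies in the core ideal, and the empty context gives
  the conclusion.\<close>

lemma milnor_elem_eq_zeroD:
  fixes \<kappa> :: "'a list \<Rightarrow> ('b \<Rightarrow>\<^sub>0 int)"
  assumes N: "add_subgroup N"
    and mult: "\<And>u v x y. \<lbrakk>0 \<notin> set u; 0 \<notin> set v; x \<noteq> 0; y \<noteq> 0\<rbrakk> \<Longrightarrow>
      \<kappa> (u @ (x * y) # v) - \<kappa> (u @ x # v) - \<kappa> (u @ y # v) \<in> N"
    and stein: "\<And>u v a. \<lbrakk>0 \<notin> set u; 0 \<notin> set v; a \<noteq> 0; a \<noteq> 1\<rbrakk> \<Longrightarrow> \<kappa> (u @ a # (1 - a) # v) \<in> N"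
    and p: "p \<in> carrier words" and zero: "milnor_elem p = \<zero>\<^bsub>milnor_ring TYPE('a)\<^esub>"
  shows "frag_extend \<kappa> p \<in> N"
proof -
  let ?K = "core_ideal (UNIV - {0 :: 'a}) \<kappa> N"
  interpret W: ring words by (rule ring_free_ring)
  interpret T: ring T by (rule ring_tensor_algebra)
  interpret T0: ideal T0 words by (rule tensor_ideal_mult_group)
  interpret I: ideal "steinberg_ideal TYPE('a)" T by (rule ideal_steinberg)
  have K: "ideal ?K words" using N by (rule ideal_core_ideal)
  have Kadd: "add_subgroup ?K" using N by (rule add_subgroup_core_ideal)
  have nz: "0 \<notin> set u" if "u \<in> lists (UNIV - {0 :: 'a})" for u using that by auto
  have T0K: "T0 \<subseteq> ?K"
  proof -
    have "frag_of [x * y] - frag_of [x] - frag_of [y] \<in> ?K" if xy: "x \<noteq> 0" "y \<noteq> 0" for x y :: 'a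
    proof -
    have "frag_of [x * y] - frag_of [x] - frag_of [y] \<in> {c. Poly_Mapping.keys c \<subseteq> lists (UNIV - {0})}"
      using xy by (intro add_subgroup_diff[OF add_subgroup_keys]) auto
    then show ?thesis
      using mult[OF nz nz xy] by (simp add: core_ideal_def frag_extend_diff)
    qed
    then show ?thesis
      unfolding tensor_ideal_def mult_group_simps(1) by (intro W.genideal_minimal[OF K]) auto
  qed
  have IK: "steinberg_ideal TYPE('a) \<subseteq> tensor_class (mult_group TYPE('a)) ` ?K"
    unfolding steinberg_ideal_def
  proof (rule T.genideal_minimal)
    show "ideal (tensor_class (mult_group TYPE('a)) ` ?K) T"
      unfolding tensor_class_eq tensor_algebra_eq by (rule T0.image_ideal[OF K])
    have "frag_of [a, 1 - a] \<in> ?K" if "a \<noteq> 0" "a \<noteq> 1" for a :: 'a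
      using stein[OF nz nz that] that by (simp add: core_ideal_def)
    then show "{pure_tensor (mult_group TYPE('a)) [a, 1 - a] |a. a \<in> carrier (mult_group TYPE('a)) - {1}}
        \<subseteq> tensor_class (mult_group TYPE('a)) ` ?K"
      by (auto simp: pure_tensor_def)
  qed
  have pT: "tensor_class (mult_group TYPE('a)) p \<in> carrier T"
    using p by (rule ring_hom_closed[OF ring_hom_ring.homh[OF tensor_class_hom]])
  have "tensor_class (mult_group TYPE('a)) p \<in> steinberg_ideal TYPE('a)"
  proof (rule I.rcos_const_imp_mem[OF pT])
    show "steinberg_ideal TYPE('a) +>\<^bsub>T\<^esub> tensor_class (mult_group TYPE('a)) p = steinberg_ideal TYPE('a)"
      using zero by (simp add: milnor_elem_def milnor_class_def milnor_ring_def FactRing_def)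
  qed
  then obtain k where k: "k \<in> ?K" "tensor_class (mult_group TYPE('a)) p = tensor_class (mult_group TYPE('a)) k"
    using IK by blast
  have T0add: "add_subgroup T0"
    unfolding add_subgroup_def
  proof (intro conjI ballI)
    show "0 \<in> T0" using T0.zero_closed by simp
    fix x y assume xy: "x \<in> T0" "y \<in> T0"
    have "\<ominus>\<^bsub>words\<^esub> y = - y"
      using T0.Icarr[OF xy(2)] by (intro W.minus_equality) auto
    then show "x - y \<in> T0" using T0.a_closed[OF xy(1) T0.a_inv_closed[OF xy(2)]] by simp
  qed
  have "p - k \<in> T0"
    using k(2) unfolding tensor_class_eq a_r_coset_def
    by (subst (asm) add_coset_eq_iff[OF T0add]) auto
  then have "(p - k) + k \<in> ?K" using T0K k(1) add_subgroup_add[OF Kadd] by blast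
  then have "p \<in> ?K" by simp
  from core_idealD[OF this, of "[]" "[]"] show ?thesis by simp
qed

end

section \<open>Suslin's map\<close>

lemma bar_cycles_mult [simp]: "x \<otimes>\<^bsub>bar_cycles G n\<^esub> y = x + y"
  by (simp add: bar_cycles_def)

lemma carrier_bar_cycles:
  "c \<in> carrier (bar_cycles G n) \<longleftrightarrow> c \<in> chains_over (carrier G) n \<and> bar_boundary G c = 0"
  by (simp add: bar_cycles_def carrier_bar_chains)

lemma add_subgroup_bar_cycles: "add_subgroup (carrier (bar_cycles G n))"
  unfolding add_subgroup_def
  by (auto simp: carrier_bar_cycles add_subgroup_zero add_subgroup_diff add_subgroup_chains chain_ops_diff)

lemma subgroup_bar_cycles: "subgroup (carrier (bar_cycles G n)) (bar_chains G n)"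
  using add_subgroup_bar_cycles
  by (rule subgroup_add[rotated])
     (auto simp: bar_chains_def bar_cycles_def)

lemma group_bar_cycles: "group (bar_cycles G n)"
proof -
  have "group (bar_chains G n)" by (simp add: bar_chains_def)
  from group.subgroup_imp_group[OF this subgroup_bar_cycles[of G n]] show ?thesis
    by (simp add: bar_cycles_def)
qed

lemma int_pow_bar_cycles:
  assumes "c \<in> carrier (bar_cycles G n)"
  shows "c [^]\<^bsub>bar_cycles G n\<^esub> (k :: int) = frag_cmul k c"
proof -
  have "group (bar_chains G n)" by (simp add: bar_chains_def)
  from group.int_pow_consistent[OF this subgroup_bar_cycles assms, of k]
  have "c [^]\<^bsub>bar_chains G n\<^esub> k = c [^]\<^bsub>bar_cycles G n\<^esub> k" by (simp add: bar_cycles_def)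
  then show ?thesis using assms by (simp add: bar_chains_def bar_cycles_def)
qed

lemma homology_class_eq_iff:
  "homology_class G n c = homology_class G n c' \<longleftrightarrow> c - c' \<in> bar_boundaries G n"
  unfolding homology_class_def by (rule add_coset_eq_iff[OF add_subgroup_bar_boundaries]) simp

lemma homology_class_add:
  "homology_class G n c \<otimes>\<^bsub>group_homology G n\<^esub> homology_class G n c' = homology_class G n (c + c')"
  unfolding homology_class_def group_homology_def FactGroup_def
  by (simp add: add_coset_mult[OF add_subgroup_bar_boundaries])

lemma homology_class_closed:
  "c \<in> carrier (bar_cycles G n) \<Longrightarrow> homology_class G n c \<in> carrier (group_homology G n)"
  unfolding homology_class_def group_homology_def FactGroup_def RCOSETS_def by auto

text \<open>Images of homologous cycles are homologous, so the set of image classes is a singleton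
  and \<open>the_elem\<close> returns its element.\<close>

lemma homology_map_class:
  assumes "\<And>a b. a \<in> carrier G \<Longrightarrow> b \<in> carrier G \<Longrightarrow> f (a \<otimes>\<^bsub>G\<^esub> b) = f a \<otimes>\<^bsub>H\<^esub> f b"
    and "f ` carrier G \<subseteq> carrier H"
  shows "homology_map H n f (homology_class G n c) = homology_class H n (map_chain f c)"
proof -
  have "(\<lambda>c. homology_class H n (frag_extend (\<lambda>gs. frag_of (map f gs)) c)) ` homology_class G n c
      = {homology_class H n (map_chain f c)}"
  proof -
    have "homology_class H n (map_chain f (b + c)) = homology_class H n (map_chain f c)"
      if "b \<in> bar_boundaries G n" for b
      using map_chain_boundaries[OF assms, of b n] that
      by (simp add: homology_class_eq_iff chain_ops_add bar_boundaries_eq)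
    moreover have "homology_class G n c = (\<lambda>b. b + c) ` bar_boundaries G n"
      by (auto simp: homology_class_def r_coset_def)
    moreover have "bar_boundaries G n \<noteq> {}"
      using add_subgroup_zero[OF add_subgroup_bar_boundaries] by blast
    ultimately show ?thesis
      unfolding map_chain_def[symmetric] by (auto simp: image_image)
  qed
  then show ?thesis by (simp add: homology_map_def)
qed

section \<open>Diagonal classes that come from the smaller general linear group\<close>

lemma diag_chain_cycle:
  fixes ps :: "((nat \<Rightarrow> int) \<times> 'a::field) list"
  assumes "0 \<notin> snd ` set ps"
  shows "diag_chain n ps \<in> carrier (bar_cycles (GL TYPE('a) n) (length ps))"
proof -
  let ?gs = "map (\<lambda>(e, a). diag_pow n e a) ps"
  have gs: "set ?gs \<subseteq> torus n" using assms by (rule map_diag_pow_torus)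
  have "comm_chain ?gs \<in> chains_over (carrier (GL TYPE('a) n)) (length ?gs)"
    using gs torus_subset by (intro comm_chain_closed) blast
  moreover have "bar_boundary (GL TYPE('a) n) (comm_chain ?gs) = 0"
    using pairwise_commuting_subset[OF pairwise_commuting_torus gs] by (rule bar_boundary_comm_chain)
  ultimately show ?thesis by (simp add: carrier_bar_cycles diag_chain_def)
qed

lemma GL_stabilize_mult:
  assumes "A \<in> carrier_mat m m" "B \<in> carrier_mat m m"
  shows "GL_stabilize m (A * B) = GL_stabilize m A * GL_stabilize m B"
  using assms unfolding GL_stabilize_def
  by (subst mult_four_block_mat[of _ m m _ 1 _ 1 _ _ m _ 1]) auto

lemma GL_stabilize_one: "GL_stabilize m (1\<^sub>m m) = 1\<^sub>m (Suc m)"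
  unfolding GL_stabilize_def by (rule eq_matI) auto

lemma GL_stabilize_carrier:
  assumes "A \<in> carrier (GL TYPE('a::field) m)"
  shows "GL_stabilize m A \<in> carrier (GL TYPE('a) (Suc m))"
proof -
  obtain B where B: "A \<in> carrier_mat m m" "B \<in> carrier_mat m m" "A * B = 1\<^sub>m m" "B * A = 1\<^sub>m m"
    using assms by (auto simp: GL_carrier_iff)
  have c: "GL_stabilize m C \<in> carrier_mat (Suc m) (Suc m)" if "C \<in> carrier_mat m m" for C :: "'a mat"
    using that by (auto simp: GL_stabilize_def)
  show ?thesis
    unfolding GL_carrier_iff using B c GL_stabilize_mult[of A m B] GL_stabilize_mult[of B m A]
    by (auto simp: GL_stabilize_one)
qed

lemma GL_stabilize_diag_pow: "e m = 0 \<Longrightarrow> GL_stabilize m (diag_pow m e a) = diag_pow (Suc m) e a"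
  unfolding GL_stabilize_def diag_pow_def mat_diag_def by (rule eq_matI) (auto simp: less_Suc_eq)

lemma diag_chain_stabilized:
  fixes ps :: "((nat \<Rightarrow> int) \<times> 'a::field) list"
  assumes k: "k < Suc m" and nz: "0 \<notin> snd ` set ps" and e: "\<And>e a. (e, a) \<in> set ps \<Longrightarrow> e k = 0"
  shows "homology_class (GL TYPE('a) (Suc m)) (length ps) (diag_chain (Suc m) ps)
    \<in> homology_map (GL TYPE('a) (Suc m)) (length ps) (GL_stabilize m) `
        carrier (group_homology (GL TYPE('a) m) (length ps))"
proof -
  let ?n = "length ps"
  define qs where "qs = map (\<lambda>(e, a). (e \<circ> Transposition.transpose k m, a)) ps"
  have qs: "0 \<notin> snd ` set qs" "length qs = ?n" "\<And>e a. (e, a) \<in> set qs \<Longrightarrow> e m = 0"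
    using nz e by (auto simp: qs_def image_image split_beta)
  have "homology_class (GL TYPE('a) (Suc m)) ?n (diag_chain (Suc m) qs)
      = homology_class (GL TYPE('a) (Suc m)) ?n (diag_chain (Suc m) ps)"
    using diag_chain_transpose[OF k lessI nz] by (simp add: homology_class_eq_iff qs_def)
  moreover have "map_chain (GL_stabilize m) (diag_chain m qs) = diag_chain (Suc m) qs"
    using qs(3) unfolding diag_chain_def map_chain_comm_chain
    by (intro arg_cong[where f = comm_chain]) (auto simp: GL_stabilize_diag_pow)
  moreover have "homology_map (GL TYPE('a) (Suc m)) ?n (GL_stabilize m) (homology_class (GL TYPE('a) m) ?n (diag_chain m qs))
      = homology_class (GL TYPE('a) (Suc m)) ?n (map_chain (GL_stabilize m) (diag_chain m qs))"
    by (rule homology_map_class) (auto simp: GL_carrier_iff[of _ m] GL_stabilize_mult intro!: GL_stabilize_carrier)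
  ultimately have eq: "homology_class (GL TYPE('a) (Suc m)) ?n (diag_chain (Suc m) ps) =
      homology_map (GL TYPE('a) (Suc m)) ?n (GL_stabilize m) (homology_class (GL TYPE('a) m) ?n (diag_chain m qs))"
    by simp
  have "homology_class (GL TYPE('a) m) ?n (diag_chain m qs) \<in> carrier (group_homology (GL TYPE('a) m) ?n)"
    using diag_chain_cycle[OF qs(1), of m] by (intro homology_class_closed) (simp add: qs(2))
  then show ?thesis unfolding eq by (rule imageI)
qed

section \<open>Comparison of the symbols with the classes defining Suslin's map\<close>

lemma additive_mod_sum:
  fixes L :: "'a::comm_monoid_add \<Rightarrow> ('b \<Rightarrow>\<^sub>0 int)"
  assumes N: "add_subgroup N" and L: "\<And>x y. L (x + y) - L x - L y \<in> N"
    and c: "\<And>i. i < m \<Longrightarrow> L (x i) + c \<in> N"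
  shows "L (\<Sum>i<m. x i) + frag_cmul (int m) c \<in> N"
  using c
proof (induction m)
  case 0
  have "L (0 + 0) - L 0 - L 0 \<in> N" by (rule L)
  then show ?case by (simp add: add_subgroup_minus_iff[OF N])
next
  case (Suc m)
  have "(L ((\<Sum>i<m. x i) + x m) - L (\<Sum>i<m. x i) - L (x m))
      + (L (\<Sum>i<m. x i) + frag_cmul (int m) c) + (L (x m) + c) \<in> N"
    by (intro add_subgroup_add[OF N] L Suc.IH Suc.prems) simp_all
  then show ?case by (simp add: frag_cmul_distrib algebra_simps)
qed

text \<open>An interpolation: the first \<open>m\<close> slots carry the matrices of the symbol, the
  others the coordinate matrices of Suslin's normalization.\<close>

definition mixed_chain :: "'a::field list \<Rightarrow> nat \<Rightarrow> ('a mat list \<Rightarrow>\<^sub>0 int)" where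
  "mixed_chain as m = diag_chain (length as)
     (zip (map A_exp [0..<m]) (take m as) @ zip (map unit_exp [m..<length as]) (drop m as))"

text \<open>Expanding \<open>A\<^bsub>m+1,n\<^esub>\<close> into its diagonal entries, every term but the last misses the
  coordinate \<open>m + 1\<close> and hence comes from \<open>GL\<^bsub>n-1\<^esub>\<close> up to conjugation.\<close>

lemma mixed_chain_step:
  fixes as :: "'a::field list"
  assumes N: "add_subgroup N" and as: "0 \<notin> set as" and m: "0 < m" "m < length as"
    and B: "\<And>c. c \<in> carrier (bar_cycles (GL TYPE('a) (length as)) (length as)) \<Longrightarrow>
      c \<in> GL_boundaries TYPE('a) (length as) (length as) \<Longrightarrow> c \<in> N"
    and stab: "\<And>ps k. \<lbrakk>length ps = length as; 0 \<notin> snd ` set ps; k < length as;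
      \<And>e a. (e, a) \<in> set ps \<Longrightarrow> e k = 0\<rbrakk> \<Longrightarrow> diag_chain (length as) ps \<in> N"
  shows "mixed_chain as (Suc m) + frag_cmul (int m) (mixed_chain as m) \<in> N"
proof -
  let ?n = "length as"
  let ?P = "zip (map A_exp [0..<m]) (take m as)" and ?Q = "zip (map unit_exp [Suc m..<?n]) (drop (Suc m) as)"
  define L where "L e = diag_chain ?n (?P @ (e, as ! m) # ?Q)" for e
  have nz: "0 \<notin> snd ` set ?P" "0 \<notin> snd ` set ?Q" "as ! m \<noteq> 0"
    using as m by (auto dest!: set_zip_rightD in_set_takeD in_set_dropD) (metis nth_mem)
  have len: "length ?P + Suc (length ?Q) = ?n" using m by simp
  have cyc: "L e \<in> carrier (bar_cycles (GL TYPE('a) ?n) ?n)" for e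
  proof -
    have "0 \<notin> snd ` set (?P @ (e, as ! m) # ?Q)" using nz by auto
    moreover have "length (?P @ (e, as ! m) # ?Q) = ?n" using len by simp
    ultimately show ?thesis using diag_chain_cycle unfolding L_def by metis
  qed
  have Ladd: "L (e + f) - L e - L f \<in> N" for e f
  proof (rule B)
    show "L (e + f) - L e - L f \<in> carrier (bar_cycles (GL TYPE('a) ?n) ?n)"
      by (intro add_subgroup_diff[OF add_subgroup_bar_cycles] cyc)
    show "L (e + f) - L e - L f \<in> GL_boundaries TYPE('a) ?n ?n"
      using diag_chain_add[OF nz(1,2,3), of ?n e f] unfolding L_def len .
  qed
  \<comment> \<open>Coordinate \<open>m\<close> is missing altogether: the earlier vectors end
    before it, the later unit vectors lie beyond it, and the unit vector in slot \<open>m\<close>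
    now points to j < m.\<close>
  have small: "L (unit_exp j) \<in> N" if j: "j < m" for j
    unfolding L_def
  proof (rule stab[where k = m])
    fix e a assume "(e, a) \<in> set (?P @ (unit_exp j, as ! m) # ?Q)"
    then have "e \<in> A_exp ` {0..<m} \<union> {unit_exp j} \<union> unit_exp ` {Suc m..<?n}"
      by (auto dest!: set_zip_leftD)
    then show "e m = 0" using j by (auto simp: A_exp_def unit_exp_def)
  qed (use nz m in auto)
  \<comment> \<open>Each of the \<open>m\<close> summands of \<open>A_exp m\<close> thus contributes
    the negative of the coordinate class.\<close>
  have "L (unit_exp j - unit_exp m) + L (unit_exp m) \<in> N" if j: "j < m" for j
    using add_subgroup_diff[OF N small[OF j] Ladd[of "unit_exp j - unit_exp m" "unit_exp m"]]
    by (simp add: add.commute)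
  then have "L (\<Sum>j<m. unit_exp j - unit_exp m) + frag_cmul (int m) (L (unit_exp m)) \<in> N"
    by (intro additive_mod_sum[OF N, where L = L] Ladd)
  moreover have "mixed_chain as (Suc m) = L (A_exp m)"
    using m by (simp add: mixed_chain_def L_def take_Suc_conv_app_nth)
  moreover have "mixed_chain as m = L (unit_exp m)"
    using m by (simp add: mixed_chain_def L_def upt_conv_Cons Cons_nth_drop_Suc[symmetric] del: upt_Suc)
  ultimately show ?thesis using A_exp_eq_sum[OF m(1)] by simp
qed

lemma mixed_chain_length: "mixed_chain as (length as) = GL_chain as"
  by (simp add: mixed_chain_def GL_chain_def)

lemma D_chain_eq:
  "diag_chain (length as) (zip (map unit_exp [0..<length as]) as) =
    comm_chain (map (D_mat as) [0..<length as])"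
proof -
  have "map (\<lambda>(e, a). diag_pow (length as) e a) (zip (map unit_exp [0..<length as]) as)
      = map (D_mat as) [0..<length as]" (is "?l = ?r")
  proof (rule nth_equalityI)
    fix k assume k: "k < length ?l"
    have "diag_pow (length as) (unit_exp k) (as ! k) = D_mat as k"
      unfolding D_mat_def diag_pow_def by (rule arg_cong[where f = "mat_diag _"]) (auto simp: unit_exp_def)
    then show "?l ! k = ?r ! k" using k by simp
  qed simp
  then show ?thesis by (simp add: diag_chain_def)
qed

lemma mixed_chain_one:
  assumes "as \<noteq> []"
  shows "mixed_chain as 1 = comm_chain (map (D_mat as) [0..<length as])"
proof -
  obtain a bs where as: "as = a # bs" using assms by (cases as) auto
  have "mixed_chain as 1 = diag_chain (length as) (zip (map unit_exp [0..<length as]) as)"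
    by (simp add: mixed_chain_def as upt_conv_Cons A_exp_0 del: upt_Suc)
  then show ?thesis by (simp only: D_chain_eq)
qed

text \<open>The factors -1, ..., -(n-1) of the successive replacements multiply to the stated
  constant. The subgroup \<open>N\<close> is kept abstract with just the two closure properties
  used, and is later taken to be the cycles killed by Suslin's map.\<close>

lemma GL_chain_mod_stable:
  fixes as :: "'a::field list"
  assumes N: "add_subgroup N" and as: "0 \<notin> set as" "as \<noteq> []"
    and B: "\<And>c. c \<in> carrier (bar_cycles (GL TYPE('a) (length as)) (length as)) \<Longrightarrow>
      c \<in> GL_boundaries TYPE('a) (length as) (length as) \<Longrightarrow> c \<in> N"
    and stab: "\<And>ps k. \<lbrakk>length ps = length as; 0 \<notin> snd ` set ps; k < length as;
      \<And>e a. (e, a) \<in> set ps \<Longrightarrow> e k = 0\<rbrakk> \<Longrightarrow> diag_chain (length as) ps \<in> N"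
  shows "GL_chain as - frag_cmul ((- 1) ^ (length as - 1) * fact (length as - 1))
    (comm_chain (map (D_mat as) [0..<length as])) \<in> N"
proof -
  \<comment> \<open>The induction starts at one slot, since \<open>A_exp 0\<close> is already a unit
    vector and the first matrix needs no replacement.\<close>
  have "mixed_chain as (Suc j) - frag_cmul ((- 1) ^ j * fact j) (mixed_chain as 1) \<in> N" if "j < length as" for j
    using that
  proof (induction j)
    case 0
    then show ?case by (simp add: add_subgroup_zero[OF N])
  next
    case (Suc j)
    let ?c = "(- 1) ^ j * fact j :: int"
    have step: "mixed_chain as (Suc (Suc j)) + frag_cmul (int (Suc j)) (mixed_chain as (Suc j)) \<in> N"
      using Suc.prems B stab by (intro mixed_chain_step[OF N as(1)]) blast+
    have "frag_cmul (int (Suc j)) (mixed_chain as (Suc j) - frag_cmul ?c (mixed_chain as 1)) \<in> N"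
      using Suc.IH Suc.prems by (intro add_subgroup_cmul[OF N]) simp_all
    with step have "(mixed_chain as (Suc (Suc j)) + frag_cmul (int (Suc j)) (mixed_chain as (Suc j)))
        - frag_cmul (int (Suc j)) (mixed_chain as (Suc j) - frag_cmul ?c (mixed_chain as 1)) \<in> N"
      by (rule add_subgroup_diff[OF N])
    moreover have "frag_cmul k (x - y) = frag_cmul k x - frag_cmul k y" for k and x y :: "'a mat list \<Rightarrow>\<^sub>0 int"
      using frag_cmul_distrib2[of k "x - y" y] by simp
    moreover have "frag_cmul ((- 1) ^ Suc j * fact (Suc j)) (mixed_chain as 1) =
        - frag_cmul (int (Suc j)) (frag_cmul ?c (mixed_chain as 1))"
      unfolding minus_frag_cmul frag_cmul_cmul
      by (rule arg_cong[where f = "\<lambda>k. frag_cmul k (mixed_chain as 1)"]) simp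
    moreover have "(x + y) - (y - z) = x - (- z)" for x y z :: "'a mat list \<Rightarrow>\<^sub>0 int" by simp
    ultimately show ?case by (simp only:)
  qed
  from this[of "length as - 1"] as(2) show ?thesis
    by (simp add: mixed_chain_length mixed_chain_one[symmetric])
qed

section \<open>Assembling the homomorphism on Milnor K-groups\<close>

lemma tuples_subset_lists: "tuples S n \<subseteq> lists S"
  by (auto simp: tuples_def)

lemma carrier_milnor_K:
  "carrier (milnor_K TYPE('a::field) n) = milnor_elem ` {p. Poly_Mapping.keys p \<subseteq> tuples (UNIV - {0 :: 'a}) n}"
proof -
  have "carrier (free_Abelian_group (tuples (UNIV - {0 :: 'a}) n)) = {p. Poly_Mapping.keys p \<subseteq> tuples (UNIV - {0}) n}"
    by (simp add: free_Abelian_group_def)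
  then show ?thesis
    by (simp add: milnor_K_def tensor_power_def image_image milnor_elem_def)
qed

lemma milnor_K_simps [simp]:
  "\<one>\<^bsub>milnor_K TYPE('a::field) n\<^esub> = \<zero>\<^bsub>milnor_ring TYPE('a)\<^esub>"
  "x \<otimes>\<^bsub>milnor_K TYPE('a) n\<^esub> y = x \<oplus>\<^bsub>milnor_ring TYPE('a)\<^esub> y"
  by (simp_all add: milnor_K_def)

lemma ring_milnor_ring: "ring (milnor_ring TYPE('a::field))"
  unfolding milnor_ring_def by (rule ideal.quotient_is_ring[OF ideal_steinberg])

lemma comm_group_milnor_K: "comm_group (milnor_K TYPE('a::field) n)"
proof -
  let ?W = "free_ring (UNIV - {0 :: 'a})" and ?P = "{p. Poly_Mapping.keys p \<subseteq> tuples (UNIV - {0 :: 'a}) n}"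
  interpret M: ring "milnor_ring TYPE('a)" by (rule ring_milnor_ring)
  interpret W: ring ?W by (rule ring_free_ring)
  have "subgroup ?P (add_monoid ?W)"
  proof (rule subgroup_add)
    fix x assume "x \<in> carrier (add_monoid ?W)"
    then show "inv\<^bsub>add_monoid ?W\<^esub> x = - x"
      by (intro group.inv_equality[OF W.add.group_axioms]) auto
  qed (use tuples_subset_lists[of "UNIV - {0 :: 'a}" n] W.add.group_axioms in \<open>auto simp: add_subgroup_keys\<close>)
  then have "subgroup (milnor_elem ` ?P) (add_monoid (milnor_ring TYPE('a)))"
    by (rule group_hom.subgroup_img_is_subgroup[OF milnor_elem_hom])
  then have "group (milnor_K TYPE('a) n)"
    using group.subgroup_imp_group[OF M.add.group_axioms] carrier_milnor_K[of n, where 'a='a]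
    by (simp add: milnor_K_def)
  moreover have "carrier (milnor_K TYPE('a) n) \<subseteq> carrier (milnor_ring TYPE('a))"
    using subgroup.subset[OF \<open>subgroup (milnor_elem ` ?P) _\<close>] by (simp add: carrier_milnor_K)
  ultimately show ?thesis
    by (intro group.group_comm_groupI) (auto intro!: M.a_comm)
qed

lemma milnor_elem_add:
  fixes p q :: "'a::field list \<Rightarrow>\<^sub>0 int"
  assumes "Poly_Mapping.keys p \<subseteq> lists (UNIV - {0})" "Poly_Mapping.keys q \<subseteq> lists (UNIV - {0})"
  shows "milnor_elem (p + q) = milnor_elem p \<oplus>\<^bsub>milnor_ring TYPE('a)\<^esub> milnor_elem q"
  using group_hom.hom_mult[OF milnor_elem_hom, of p q] assms by simp

lemma milnor_elem_eqD:
  fixes p q :: "'a::field list \<Rightarrow>\<^sub>0 int"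
  assumes "Poly_Mapping.keys p \<subseteq> lists (UNIV - {0})" "Poly_Mapping.keys q \<subseteq> lists (UNIV - {0})"
    and "milnor_elem p = milnor_elem q"
  shows "milnor_elem (p - q) = \<zero>\<^bsub>milnor_ring TYPE('a)\<^esub>"
proof -
  interpret M: ring "milnor_ring TYPE('a)" by (rule ring_milnor_ring)
  have pq: "Poly_Mapping.keys (p - q) \<subseteq> lists (UNIV - {0})"
    using add_subgroup_diff[OF add_subgroup_keys, of p "lists (UNIV - {0 :: 'a})" q] assms(1,2) by simp
  have "milnor_elem (p - q) \<oplus>\<^bsub>milnor_ring TYPE('a)\<^esub> milnor_elem q = milnor_elem q"
    using milnor_elem_add[OF pq assms(2)] assms(3) by simp
  moreover have "milnor_elem (p - q) \<in> carrier (milnor_ring TYPE('a))" "milnor_elem q \<in> carrier (milnor_ring TYPE('a))"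
    using group_hom.hom_closed[OF milnor_elem_hom] pq assms(2) by simp_all
  ultimately show ?thesis by (simp add: M.add.l_cancel_one)
qed

lemma milnor_symbol_eq: "milnor_symbol as = milnor_elem (frag_of as)" for as :: "'a::field list"
  by (simp add: milnor_symbol_def milnor_elem_def pure_tensor_def)

text \<open>Words of other lengths go to zero because the defining ideals contain elements of every
  degree. Both kinds of relators are homogeneous, so this extension still respects them.\<close>

definition symbol_chain :: "nat \<Rightarrow> ('a::field list \<Rightarrow>\<^sub>0 int) \<Rightarrow> ('a mat list \<Rightarrow>\<^sub>0 int)" where
  "symbol_chain n = frag_extend (\<lambda>as. if length as = n then GL_chain as else 0)"

lemma GL_chain_cycle:
  fixes as :: "'a::field list"
  assumes "0 \<notin> set as"
  shows "GL_chain as \<in> carrier (bar_cycles (GL TYPE('a) (length as)) (length as))"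
  using diag_chain_cycle[OF zip_nonzero[OF assms], of "length as" "map A_exp [0..<length as]"]
  by (simp add: GL_chain_def)

lemma symbol_chain_cycle:
  fixes p :: "'a::field list \<Rightarrow>\<^sub>0 int"
  assumes "Poly_Mapping.keys p \<subseteq> tuples (UNIV - {0}) n"
  shows "symbol_chain n p \<in> carrier (bar_cycles (GL TYPE('a) n) n)"
  unfolding symbol_chain_def
  by (rule frag_extend_in[OF add_subgroup_bar_cycles assms])
     (use GL_chain_cycle in \<open>auto simp: tuples_def\<close>)

lemma symbol_chain_well_defined:
  fixes p :: "'a::field list \<Rightarrow>\<^sub>0 int"
  assumes inf: "infinite (UNIV :: 'a set)"
    and p: "Poly_Mapping.keys p \<subseteq> lists (UNIV - {0})" and zero: "milnor_elem p = \<zero>\<^bsub>milnor_ring TYPE('a)\<^esub>"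
  shows "symbol_chain n p \<in> GL_boundaries TYPE('a) n n"
  unfolding symbol_chain_def
proof (rule milnor_elem_eq_zeroD[OF add_subgroup_bar_boundaries _ _ _ zero])
  have N: "0 \<in> GL_boundaries TYPE('a) n n"
    by (rule add_subgroup_zero[OF add_subgroup_bar_boundaries])
  fix u v :: "'a list" assume uv: "0 \<notin> set u" "0 \<notin> set v"
  show "(if length (u @ (x * y) # v) = n then GL_chain (u @ (x * y) # v) else 0)
      - (if length (u @ x # v) = n then GL_chain (u @ x # v) else 0)
      - (if length (u @ y # v) = n then GL_chain (u @ y # v) else 0) \<in> GL_boundaries TYPE('a) n n"
    if "x \<noteq> 0" "y \<noteq> 0" for x y
    using GL_chain_mult[OF uv that] N by auto
  show "(if length (u @ a # (1 - a) # v) = n then GL_chain (u @ a # (1 - a) # v) else 0) \<in> GL_boundaries TYPE('a) n n"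
    if "a \<noteq> 0" "a \<noteq> 1" for a
    using GL_chain_steinberg[OF inf _ _ _ uv, of a "1 - a"] that N by auto
qed (use p in auto)

theorem proposition3p3:
  fixes n :: nat
  assumes "infinite (UNIV :: 'a::field set)" and "n \<ge> 1"
  shows "\<exists>\<nu> \<in> hom (milnor_K TYPE('a) n) (group_homology (GL TYPE('a) n) n).
    (\<forall>as \<in> tuples (carrier (mult_group TYPE('a))) n. \<nu> (milnor_symbol as) = GL_symbol as) \<and>
    (\<forall>s. suslin_map TYPE('a) n s \<longrightarrow>
      (\<forall>x \<in> carrier (milnor_K TYPE('a) n).
        s (\<nu> x) = x [^]\<^bsub>milnor_K TYPE('a) n\<^esub> ((- 1) ^ (n - 1) * fact (n - 1) :: int)))"
proof -
  let ?G = "GL TYPE('a) n" and ?K = "milnor_K TYPE('a) n" and ?S = "tuples (UNIV - {0 :: 'a}) n"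
  let ?Z = "bar_cycles (GL TYPE('a) n) n"
  interpret K: comm_group ?K by (rule comm_group_milnor_K)
  define cls where "cls = homology_class ?G n"
  \<comment> \<open>A representative of degree \<open>n\<close> is chosen. The next fact shows that
    the resulting class does not depend on it.\<close>
  define \<nu> where "\<nu> \<xi> = cls (symbol_chain n (SOME p. Poly_Mapping.keys p \<subseteq> ?S \<and> \<xi> = milnor_elem p))" for \<xi>
  have S: "Poly_Mapping.keys p \<subseteq> lists (UNIV - {0 :: 'a})" if "Poly_Mapping.keys p \<subseteq> ?S" for p
    using that tuples_subset_lists by (rule subset_trans)
  have \<nu>: "\<nu> (milnor_elem p) = cls (symbol_chain n p)" if p: "Poly_Mapping.keys p \<subseteq> ?S" for p
  proof -
    define q where "q = (SOME q. Poly_Mapping.keys q \<subseteq> ?S \<and> milnor_elem p = milnor_elem q)"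
    have q: "Poly_Mapping.keys q \<subseteq> ?S \<and> milnor_elem p = milnor_elem q"
      unfolding q_def by (rule someI[of _ p]) (use p in auto)
    have "symbol_chain n (q - p) \<in> GL_boundaries TYPE('a) n n"
    proof (rule symbol_chain_well_defined[OF assms(1)])
      show "Poly_Mapping.keys (q - p) \<subseteq> lists (UNIV - {0})"
        using add_subgroup_diff[OF add_subgroup_keys, of q "lists (UNIV - {0})" p]
          S[OF p] S[OF conjunct1[OF q]] by simp
      show "milnor_elem (q - p) = \<zero>\<^bsub>milnor_ring TYPE('a)\<^esub>"
        using S[OF p] S[OF conjunct1[OF q]] q by (intro milnor_elem_eqD) simp_all
    qed
    then show ?thesis
      by (simp add: \<nu>_def q_def[symmetric] cls_def homology_class_eq_iff symbol_chain_def frag_extend_diff)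
  qed
  have sadd: "symbol_chain n (p + q) = symbol_chain n p + symbol_chain n q" for p q :: "'a list \<Rightarrow>\<^sub>0 int"
    by (simp add: symbol_chain_def frag_extend_add)
  have \<nu>_hom: "\<nu> \<in> hom ?K (group_homology ?G n)"
  proof (rule homI)
    fix x assume "x \<in> carrier ?K"
    then obtain p where p: "Poly_Mapping.keys p \<subseteq> ?S" "x = milnor_elem p" by (auto simp: carrier_milnor_K)
    then show "\<nu> x \<in> carrier (group_homology ?G n)"
      using homology_class_closed[OF symbol_chain_cycle[OF p(1)]] by (simp add: \<nu> cls_def)
    fix y assume "y \<in> carrier ?K"
    then obtain q where q: "Poly_Mapping.keys q \<subseteq> ?S" "y = milnor_elem q" by (auto simp: carrier_milnor_K)
    have "Poly_Mapping.keys (p + q) \<subseteq> ?S"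
      using add_subgroup_add[OF add_subgroup_keys, of p ?S q] p q by simp
    moreover have "x \<otimes>\<^bsub>?K\<^esub> y = milnor_elem (p + q)"
      using milnor_elem_add[OF S S] p q by simp
    ultimately show "\<nu> (x \<otimes>\<^bsub>?K\<^esub> y) = \<nu> x \<otimes>\<^bsub>group_homology ?G n\<^esub> \<nu> y"
      using p q by (simp only: \<nu> cls_def homology_class_add sadd)
  qed
  have \<nu>_symbol: "\<nu> (milnor_symbol as) = GL_symbol as" if "as \<in> ?S" for as
  proof -
    have "length as = n" using that by (simp add: tuples_def)
    then show ?thesis
      using \<nu>[of "frag_of as"] that
      by (simp add: milnor_symbol_eq GL_symbol_eq cls_def symbol_chain_def)
  qed
  have comp: "s (\<nu> x) = x [^]\<^bsub>?K\<^esub> ((- 1) ^ (n - 1) * fact (n - 1) :: int)"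
    if s: "suslin_map TYPE('a) n s" and x: "x \<in> carrier ?K" for s x
  proof -
    let ?k = "(- 1) ^ (n - 1) * fact (n - 1) :: int"
    have s_hom: "s \<in> hom (group_homology ?G n) ?K"
      using s by (simp add: suslin_map_def epi_def)
    have s_ker: "s \<xi> = \<one>\<^bsub>?K\<^esub>" if "\<xi> \<in> homology_map ?G n (GL_stabilize (n - 1)) ` carrier (group_homology (GL TYPE('a) (n - 1)) n)" for \<xi>
    proof -
      have "\<xi> \<in> kernel (group_homology ?G n) ?K s" using s that by (simp add: suslin_map_def)
      then show ?thesis by (simp add: kernel_def)
    qed
    have s_D: "s (comm_class ?G (map (D_mat as) [0..<n])) = milnor_symbol as" if "as \<in> ?S" for as
      using s that by (simp add: suslin_map_def)
    \<comment> \<open>Suslin's map is pulled back to cycles, where the chain congruences apply and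
      powers are integer multiples.\<close>
    define \<sigma> where "\<sigma> c = s (cls c)" for c
    have cls_closed: "cls c \<in> carrier (group_homology ?G n)" if "c \<in> carrier ?Z" for c
      using that by (simp add: cls_def homology_class_closed)
    have \<sigma>_hom: "\<sigma> \<in> hom ?Z ?K"
    proof (rule homI)
      show "\<sigma> c \<in> carrier ?K" if "c \<in> carrier ?Z" for c
        using hom_in_carrier[OF s_hom cls_closed[OF that]] by (simp add: \<sigma>_def)
      show "\<sigma> (c \<otimes>\<^bsub>?Z\<^esub> d) = \<sigma> c \<otimes>\<^bsub>?K\<^esub> \<sigma> d" if "c \<in> carrier ?Z" "d \<in> carrier ?Z" for c d
        using hom_mult[OF s_hom cls_closed[OF that(1)] cls_closed[OF that(2)]]
        by (simp add: \<sigma>_def cls_def homology_class_add)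
    qed
    interpret \<sigma>: group_hom ?Z ?K \<sigma>
      using group_bar_cycles K.is_group \<sigma>_hom by (simp add: group_hom_def group_hom_axioms_def)
    note Z = add_subgroup_bar_cycles[of ?G n]
    have \<sigma>_diff: "\<sigma> (c - d) \<otimes>\<^bsub>?K\<^esub> \<sigma> d = \<sigma> c" if "c \<in> carrier ?Z" "d \<in> carrier ?Z" for c d
      using \<sigma>.hom_mult[of "c - d" d] add_subgroup_diff[OF Z that] that by simp
    have \<sigma>0: "\<sigma> 0 = \<one>\<^bsub>?K\<^esub>"
      using \<sigma>.hom_one by (simp add: bar_cycles_def bar_chains_def)
    \<comment> \<open>The kernel on cycles contains the cycles that are boundaries and, by the
      kernel condition on \<open>s\<close>, the diagonal chains missing a coordinate.\<close>
    define N where "N = {c \<in> carrier ?Z. \<sigma> c = \<one>\<^bsub>?K\<^esub>}"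
    have N: "add_subgroup N"
      unfolding add_subgroup_def
    proof (intro conjI ballI)
      show "0 \<in> N" using add_subgroup_zero[OF Z] \<sigma>0 by (simp add: N_def)
      fix c d assume cd: "c \<in> N" "d \<in> N"
      then have c: "c - d \<in> carrier ?Z" by (auto simp: N_def intro: add_subgroup_diff[OF Z])
      then have "\<sigma> (c - d) \<otimes>\<^bsub>?K\<^esub> \<one>\<^bsub>?K\<^esub> = \<one>\<^bsub>?K\<^esub>"
        using \<sigma>_diff[of c d] cd unfolding N_def by auto
      then show "c - d \<in> N" using c K.r_one[OF \<sigma>.hom_closed[OF c]] unfolding N_def by simp
    qed
    have boundary: "c \<in> N" if "c \<in> carrier ?Z" "c \<in> GL_boundaries TYPE('a) n n" for c
    proof -
      have "cls c = cls 0" using that(2) by (simp add: cls_def homology_class_eq_iff)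
      then show ?thesis using that(1) \<sigma>0 by (simp add: N_def \<sigma>_def)
    qed
    have stable: "diag_chain n ps \<in> N" if ps: "length ps = n" "0 \<notin> snd ` set ps" "k < n"
      "\<And>e a. (e, a) \<in> set ps \<Longrightarrow> e k = 0" for ps :: "((nat \<Rightarrow> int) \<times> 'a) list" and k
    proof -
      have "homology_class ?G n (diag_chain n ps) \<in> homology_map ?G n (GL_stabilize (n - 1)) ` carrier (group_homology (GL TYPE('a) (n - 1)) n)"
        using diag_chain_stabilized[of k "n - 1" ps] ps assms(2) by simp
      then show ?thesis
        using s_ker diag_chain_cycle[OF ps(2), of n] ps(1) by (simp add: N_def \<sigma>_def cls_def)
    qed
    have symbol: "\<sigma> (GL_chain as) = milnor_symbol as [^]\<^bsub>?K\<^esub> ?k" if as: "as \<in> ?S" for as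
    proof -
      let ?D = "comm_chain (map (D_mat as) [0..<n])"
      have l: "length as = n" "0 \<notin> set as" "as \<noteq> []" using as assms(2) by (auto simp: tuples_def)
      have "?D = diag_chain n (zip (map unit_exp [0..<n]) as)"
        using D_chain_eq[of as] l(1) by simp
      then have D: "?D \<in> carrier ?Z"
        using diag_chain_cycle[OF zip_nonzero[OF l(2)], of n "map unit_exp [0..<n]"] l(1) by simp
      have A: "GL_chain as \<in> carrier ?Z" using GL_chain_cycle[OF l(2)] l(1) by simp
      have kD: "frag_cmul ?k ?D \<in> carrier ?Z" using add_subgroup_cmul[OF Z D] .
      have "GL_chain as - frag_cmul ?k ?D \<in> N"
        using GL_chain_mod_stable[OF N l(2,3)] boundary stable unfolding l(1) by blast
      then have "\<sigma> (GL_chain as) = \<sigma> (frag_cmul ?k ?D)"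
        using \<sigma>_diff[OF A kD] K.l_one[OF \<sigma>.hom_closed[OF kD]] unfolding N_def by auto
      also have "\<dots> = \<sigma> ?D [^]\<^bsub>?K\<^esub> ?k"
        using \<sigma>.hom_int_pow[OF D, of ?k] by (simp only: int_pow_bar_cycles[OF D])
      also have "\<sigma> ?D = milnor_symbol as"
        using s_D[OF as] by (simp add: \<sigma>_def cls_def comm_class_eq)
      finally show ?thesis .
    qed
    \<comment> \<open>Both sides are additive in \<open>p\<close>, because the target group is
      commutative and powers distribute over its products. It is enough to compare them on
      symbols.\<close>
    have "\<sigma> (symbol_chain n p) = milnor_elem p [^]\<^bsub>?K\<^esub> ?k" if "Poly_Mapping.keys p \<subseteq> ?S" for p
    proof (rule free_Abelian_group_induct[OF that, of "\<lambda>p. \<sigma> (symbol_chain n p) = milnor_elem p [^]\<^bsub>?K\<^esub> ?k"])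
      have "milnor_elem (0 - 0) = \<zero>\<^bsub>milnor_ring TYPE('a)\<^esub>" by (rule milnor_elem_eqD) simp_all
      then have "milnor_elem 0 [^]\<^bsub>?K\<^esub> ?k = \<one>\<^bsub>?K\<^esub>" using K.int_pow_one[of ?k] by simp
      then show "\<sigma> (symbol_chain n 0) = milnor_elem 0 [^]\<^bsub>?K\<^esub> ?k"
        using \<sigma>0 by (simp add: symbol_chain_def)
    next
      fix p q :: "'a list \<Rightarrow>\<^sub>0 int"
      assume 2: "Poly_Mapping.keys p \<subseteq> ?S" "Poly_Mapping.keys q \<subseteq> ?S"
        "\<sigma> (symbol_chain n p) = milnor_elem p [^]\<^bsub>?K\<^esub> ?k"
        "\<sigma> (symbol_chain n q) = milnor_elem q [^]\<^bsub>?K\<^esub> ?k"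
      have pq: "Poly_Mapping.keys (p - q) \<subseteq> ?S"
        using add_subgroup_diff[OF add_subgroup_keys, of p ?S q] 2 by simp
      have c: "milnor_elem p \<in> carrier ?K" "milnor_elem q \<in> carrier ?K" "milnor_elem (p - q) \<in> carrier ?K"
        using 2 pq by (auto simp: carrier_milnor_K)
      have "milnor_elem (p - q) \<otimes>\<^bsub>?K\<^esub> milnor_elem q = milnor_elem p"
        using milnor_elem_add[OF S[OF pq] S[OF 2(2)]] by simp
      then have "milnor_elem (p - q) [^]\<^bsub>?K\<^esub> ?k \<otimes>\<^bsub>?K\<^esub> milnor_elem q [^]\<^bsub>?K\<^esub> ?k = milnor_elem p [^]\<^bsub>?K\<^esub> ?k"
        using K.int_pow_distrib[OF c(3,2), of ?k] by simp
      also have "\<dots> = \<sigma> (symbol_chain n (p - q)) \<otimes>\<^bsub>?K\<^esub> milnor_elem q [^]\<^bsub>?K\<^esub> ?k"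
        using \<sigma>_diff[OF symbol_chain_cycle[OF 2(1)] symbol_chain_cycle[OF 2(2)]] 2(3,4)
        by (simp add: symbol_chain_def frag_extend_diff)
      finally show "\<sigma> (symbol_chain n (p - q)) = milnor_elem (p - q) [^]\<^bsub>?K\<^esub> ?k"
        using c \<sigma>.hom_closed[OF symbol_chain_cycle[OF pq]] K.int_pow_closed K.r_cancel by metis
    next
      fix as assume as: "as \<in> ?S"
      then have "length as = n" by (simp add: tuples_def)
      then show "\<sigma> (symbol_chain n (frag_of as)) = milnor_elem (frag_of as) [^]\<^bsub>?K\<^esub> ?k"
        using symbol[OF as] by (simp add: symbol_chain_def milnor_symbol_eq)
    qed
    then show ?thesis using x \<nu> by (auto simp: carrier_milnor_K \<sigma>_def)
  qed
  show ?thesis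
    using \<nu>_hom \<nu>_symbol comp by (intro bexI[of _ \<nu>] conjI) auto
qed

end
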